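(* Let $E\in\mathcal E$, let $M\ne\{0\}$ be a closed subspace of $E$ having the division property, let $\pi:E\to E/M$ be the canonical surjection, and let $U:E/M\to E/M$ be the linear map satisfying $U\circ\pi\circ S_{|E}=\pi$. For $r\in[0,1)$ set $\Delta_E(r)=\sum_{n=0}^{+\infty}r^n\Vert T_{|E}^n\Vert$. (i) If $\int_0^1\sqrt{\frac{\log\Delta_E(t)}{1-t}}\,dt<+\infty$, then $$\log^+\left\Vert\sum_{n=0}^{+\infty}\lambda^nU^{n+1}\pi(1)\right\Vert=O\left(\frac1{1-|\lambda|}\right)\ \text{ as }|\lambda|\to1^-,$$ and so $\log^+\Vert U^n\pi(1)\Vert=O(\sqrt n)$ as $n\to+\infty$. (ii) If $\int_0^1\sqrt{\frac{\log\Delta_E(t)}{1-t}}\,dt=+\infty$, then for every $\epsilon>0$, $$\limsup_{|\lambda|\to1^-}(1-|\lambda|)\log\left\Vert\sum_{n=0}^{+\infty}\lambda^nU^{n+1}\pi(1)\right\Vert\left[\int_0^{|\lambda|^{\frac1{1+\epsilon}}}\sqrt{\frac{\log\Delta_E(t)}{1-t}}\,dt\right]^{-2}\le C(\epsilon),$$ where $$C(\epsilon)=\frac{54}{\pi}\epsilon^{-3}(1+\epsilon)\left(1+\frac{2\epsilon}{3}\right)^2\left(1+\frac{44}{5}e^{(26\pi+3/2)(2+\epsilon^{-1})}\right),$$ and so if we set $L_{\epsilon,E}(r)=\frac{C(\epsilon)+1}{1-r}\left[\int_0^{r^{\frac1{1+\epsilon}}}\sqrt{\frac{\log\Delta_E(t)}{1-t}}\,dt\right]^2$,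 we have, when $n$ is sufficiently large, $$\Vert U^n\pi(1)\Vert\le\inf_{0<r<1}r^{-n}e^{L_{\epsilon,E}(r)}.$$
   Context: $\mathbb D$ is the open unit disc, $\mathcal H(\mathbb D)$ the space of holomorphic functions on $\mathbb D$. On $\mathcal H(\mathbb D)$ put $Sf(z)=zf(z)$ and $Tf(z)=\frac{f(z)-f(0)}{z}$. A linear subspace $M\subset\mathcal H(\mathbb D)$ has the division property if for every $\lambda\in\mathbb D$ and every $f\in M$ with $f(\lambda)=0$ the function $z\mapsto\frac{f(z)}{z-\lambda}$ belongs to $M$. $\mathcal E$ is the class of nonzero (complex) Banach spaces $E\subset\mathcal H(\mathbb D)$ such that $S(E)\subset E$, $T(E)\subset E$, $S_{|E}$ and $T_{|E}$ are continuous on $E$, and $\max(\rho(S_{|E}),\rho(T_{|E}))\le1$, where $\rho$ is the spectral radius. Such an $E$ contains the constant function $1$. For $M\neq\{0\}$ with the division property the map $U$ exists and is unique. Norms of elements of $E/M$ are quotient norms; $\log^+x=\max(\log x,0)$, and $\log 0=-\infty$. *)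

theory Defs
  imports
    "HOL-Analysis.Analysis"
    "HOL-Complex_Analysis.Complex_Analysis"
    "HOL-Library.Function_Algebras"
    "HOL-Library.Set_Algebras"
    "HOL-Library.Landau_Symbols"
begin

section \<open>Holomorphic functions on the unit disc\<close>

abbreviation disc :: "complex set" where
  "disc \<equiv> ball 0 1"

text \<open>A holomorphic function on the disc is represented by its extension by zero to the plane, so
  that equality of functions on the disc is equality in HOL.\<close>

definition hol_disc :: "(complex \<Rightarrow> complex) set" where
  "hol_disc = {f. f holomorphic_on disc \<and> (\<forall>z. z \<notin> disc \<longrightarrow> f z = 0)}"

definition cscale :: "complex \<Rightarrow> (complex \<Rightarrow> complex) \<Rightarrow> (complex \<Rightarrow> complex)" where
  "cscale c f = (\<lambda>z. c * f z)"

global_interpretation cfun: vector_space cscale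
  by standard (simp_all add: cscale_def fun_eq_iff algebra_simps)

definition const_one :: "complex \<Rightarrow> complex" where
  "const_one = indicator disc"

definition shift :: "(complex \<Rightarrow> complex) \<Rightarrow> (complex \<Rightarrow> complex)" where
  "shift f = (\<lambda>z. z * f z)"

text \<open>The function \<open>z \<mapsto> f z / (z - a)\<close> for \<open>f\<close> vanishing at \<open>a\<close>, with the removable singularity
  filled in.\<close>

definition divide_zero :: "complex \<Rightarrow> (complex \<Rightarrow> complex) \<Rightarrow> (complex \<Rightarrow> complex)" where
  "divide_zero a f = (\<lambda>z. if z = a then deriv f a else f z / (z - a))"

text \<open>The constant \<open>f 0\<close> has to be cut off outside the disc as well.\<close>

definition bshift :: "(complex \<Rightarrow> complex) \<Rightarrow> (complex \<Rightarrow> complex)" where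
  "bshift f = divide_zero 0 (f - cscale (f 0) const_one)"

lemma bshift_eq:
  assumes "f \<in> hol_disc"
  shows "bshift f z = (if z \<notin> disc then 0 else if z = 0 then deriv f 0 else (f z - f 0) / z)"
proof -
  have *: "deriv (f - cscale (f 0) const_one) 0 = deriv f 0"
  proof (rule DERIV_imp_deriv)
    have "f holomorphic_on disc"
      using assms by (simp add: hol_disc_def)
    then have "(f has_field_derivative deriv f 0) (at 0)"
      by (rule holomorphic_derivI) auto
    then have "((\<lambda>z. f z - f 0) has_field_derivative deriv f 0) (at 0)"
      by (auto intro!: derivative_eq_intros)
    then show "((f - cscale (f 0) const_one) has_field_derivative deriv f 0) (at 0)"
      by (rule has_field_derivative_transform_within_open[where S = disc])
        (auto simp: cscale_def const_one_def)
  qed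
  show ?thesis
    using assms * by (auto simp: bshift_def divide_zero_def hol_disc_def cscale_def const_one_def)
qed

definition division_property :: "(complex \<Rightarrow> complex) set \<Rightarrow> bool" where
  "division_property M \<longleftrightarrow> (\<forall>a\<in>disc. \<forall>f\<in>M. f a = 0 \<longrightarrow> divide_zero a f \<in> M)"

section \<open>Complex Banach spaces of functions and operators on them\<close>

text \<open>The value outside \<open>E\<close> is irrelevant; it makes \<open>norm_dist E N\<close> a total nonnegative symmetric
  function, as required by \<^locale>\<open>Metric_space\<close>.\<close>

definition norm_dist ::
  "(complex \<Rightarrow> complex) set \<Rightarrow> ((complex \<Rightarrow> complex) \<Rightarrow> real) \<Rightarrow>
   (complex \<Rightarrow> complex) \<Rightarrow> (complex \<Rightarrow> complex) \<Rightarrow> real" where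
  "norm_dist E N f g = (if f \<in> E \<and> g \<in> E then N (f - g) else 0)"

abbreviation norm_topology ::
  "(complex \<Rightarrow> complex) set \<Rightarrow> ((complex \<Rightarrow> complex) \<Rightarrow> real) \<Rightarrow> (complex \<Rightarrow> complex) topology" where
  "norm_topology E N \<equiv> Metric_space.mtopology E (norm_dist E N)"

definition norm_on :: "(complex \<Rightarrow> complex) set \<Rightarrow> ((complex \<Rightarrow> complex) \<Rightarrow> real) \<Rightarrow> bool" where
  "norm_on E N \<longleftrightarrow>
     (\<forall>f\<in>E. 0 \<le> N f \<and> (N f = 0 \<longleftrightarrow> f = 0)) \<and>
     (\<forall>f\<in>E. \<forall>c. N (cscale c f) = cmod c * N f) \<and>
     (\<forall>f\<in>E. \<forall>g\<in>E. N (f + g) \<le> N f + N g)"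

definition banach_on :: "(complex \<Rightarrow> complex) set \<Rightarrow> ((complex \<Rightarrow> complex) \<Rightarrow> real) \<Rightarrow> bool" where
  "banach_on E N \<longleftrightarrow>
     cfun.subspace E \<and> norm_on E N \<and> Metric_space.mcomplete E (norm_dist E N)"

definition cont_linear_on ::
  "(complex \<Rightarrow> complex) set \<Rightarrow> ((complex \<Rightarrow> complex) \<Rightarrow> real) \<Rightarrow>
   ((complex \<Rightarrow> complex) \<Rightarrow> (complex \<Rightarrow> complex)) \<Rightarrow> bool" where
  "cont_linear_on E N A \<longleftrightarrow>
     A ` E \<subseteq> E \<and>
     (\<forall>f\<in>E. \<forall>g\<in>E. A (f + g) = A f + A g) \<and>
     (\<forall>c. \<forall>f\<in>E. A (cscale c f) = cscale c (A f)) \<and>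
     continuous_map (norm_topology E N) (norm_topology E N) A"

text \<open>Compare \<^const>\<open>onorm\<close>; here the operator acts on the carrier \<open>E\<close> only.\<close>

definition op_norm ::
  "(complex \<Rightarrow> complex) set \<Rightarrow> ((complex \<Rightarrow> complex) \<Rightarrow> real) \<Rightarrow>
   ((complex \<Rightarrow> complex) \<Rightarrow> (complex \<Rightarrow> complex)) \<Rightarrow> real" where
  "op_norm E N A = (SUP f\<in>E. N (A f) / N f)"

definition op_spectrum ::
  "(complex \<Rightarrow> complex) set \<Rightarrow> ((complex \<Rightarrow> complex) \<Rightarrow> real) \<Rightarrow>
   ((complex \<Rightarrow> complex) \<Rightarrow> (complex \<Rightarrow> complex)) \<Rightarrow> complex set" where
  "op_spectrum E N A =
     {c. \<not> (\<exists>B. cont_linear_on E N B \<and>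
            (\<forall>f\<in>E. B (cscale c f - A f) = f \<and> cscale c (B f) - A (B f) = f))}"

definition op_spectral_radius ::
  "(complex \<Rightarrow> complex) set \<Rightarrow> ((complex \<Rightarrow> complex) \<Rightarrow> real) \<Rightarrow>
   ((complex \<Rightarrow> complex) \<Rightarrow> (complex \<Rightarrow> complex)) \<Rightarrow> ereal" where
  "op_spectral_radius E N A = (SUP c\<in>op_spectrum E N A. ereal (cmod c))"

definition class_E :: "(complex \<Rightarrow> complex) set \<Rightarrow> ((complex \<Rightarrow> complex) \<Rightarrow> real) \<Rightarrow> bool" where
  "class_E E N \<longleftrightarrow>
     E \<subseteq> hol_disc \<and> E \<noteq> {0} \<and> banach_on E N \<and>
     shift ` E \<subseteq> E \<and> bshift ` E \<subseteq> E \<and>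
     continuous_map (norm_topology E N) (norm_topology E N) shift \<and>
     continuous_map (norm_topology E N) (norm_topology E N) bshift \<and>
     max (op_spectral_radius E N shift) (op_spectral_radius E N bshift) \<le> 1"

definition Delta :: "(complex \<Rightarrow> complex) set \<Rightarrow> ((complex \<Rightarrow> complex) \<Rightarrow> real) \<Rightarrow> real \<Rightarrow> real" where
  "Delta E N r = (\<Sum>n. r ^ n * op_norm E N (bshift ^^ n))"

definition weight :: "(complex \<Rightarrow> complex) set \<Rightarrow> ((complex \<Rightarrow> complex) \<Rightarrow> real) \<Rightarrow> real \<Rightarrow> real" where
  "weight E N t = sqrt (ln (Delta E N t) / (1 - t))"

section \<open>The quotient \<open>E / M\<close>\<close>

text \<open>Elements of the quotient are the cosets \<open>f +o M\<close>. Addition of cosets, including finite sums, is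
  the addition of sets from \<^theory>\<open>HOL-Library.Set_Algebras\<close>. Multiplication by a scalar adds \<open>M\<close>
  so that the zero multiple of a coset is \<open>M\<close> rather than \<open>{0}\<close>.\<close>

definition quot :: "(complex \<Rightarrow> complex) set \<Rightarrow> (complex \<Rightarrow> complex) set \<Rightarrow> (complex \<Rightarrow> complex) set set" where
  "quot E M = (\<lambda>f. f +o M) ` E"

definition quot_scale ::
  "(complex \<Rightarrow> complex) set \<Rightarrow> complex \<Rightarrow> (complex \<Rightarrow> complex) set \<Rightarrow> (complex \<Rightarrow> complex) set" where
  "quot_scale M c x = cscale c ` x + M"

definition quot_norm :: "((complex \<Rightarrow> complex) \<Rightarrow> real) \<Rightarrow> (complex \<Rightarrow> complex) set \<Rightarrow> real" where
  "quot_norm N x = (INF f\<in>x. N f)"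

definition quot_dist ::
  "(complex \<Rightarrow> complex) set \<Rightarrow> ((complex \<Rightarrow> complex) \<Rightarrow> real) \<Rightarrow> (complex \<Rightarrow> complex) set \<Rightarrow>
   (complex \<Rightarrow> complex) set \<Rightarrow> (complex \<Rightarrow> complex) set \<Rightarrow> real" where
  "quot_dist E N M x y =
     (if x \<in> quot E M \<and> y \<in> quot E M then quot_norm N (x + quot_scale M (- 1) y) else 0)"

definition quot_linear ::
  "(complex \<Rightarrow> complex) set \<Rightarrow> (complex \<Rightarrow> complex) set \<Rightarrow>
   ((complex \<Rightarrow> complex) set \<Rightarrow> (complex \<Rightarrow> complex) set) \<Rightarrow> bool" where
  "quot_linear E M U \<longleftrightarrow>
     U ` quot E M \<subseteq> quot E M \<and>
     (\<forall>x\<in>quot E M. \<forall>y\<in>quot E M. U (x + y) = U x + U y) \<and>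
     (\<forall>c. \<forall>x\<in>quot E M. U (quot_scale M c x) = quot_scale M c (U x))"

definition quot_sums ::
  "(complex \<Rightarrow> complex) set \<Rightarrow> ((complex \<Rightarrow> complex) \<Rightarrow> real) \<Rightarrow> (complex \<Rightarrow> complex) set \<Rightarrow>
   (nat \<Rightarrow> (complex \<Rightarrow> complex) set) \<Rightarrow> (complex \<Rightarrow> complex) set \<Rightarrow> bool" where
  "quot_sums E N M a x \<longleftrightarrow>
     limitin (Metric_space.mtopology (quot E M) (quot_dist E N M)) (\<lambda>k. \<Sum>n\<le>k. a n) x sequentially"

definition quot_suminf ::
  "(complex \<Rightarrow> complex) set \<Rightarrow> ((complex \<Rightarrow> complex) \<Rightarrow> real) \<Rightarrow> (complex \<Rightarrow> complex) set \<Rightarrow>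
   (nat \<Rightarrow> (complex \<Rightarrow> complex) set) \<Rightarrow> (complex \<Rightarrow> complex) set" where
  "quot_suminf E N M a = (THE x. quot_sums E N M a x)"

definition U_term ::
  "(complex \<Rightarrow> complex) set \<Rightarrow> ((complex \<Rightarrow> complex) set \<Rightarrow> (complex \<Rightarrow> complex) set) \<Rightarrow>
   complex \<Rightarrow> nat \<Rightarrow> (complex \<Rightarrow> complex) set" where
  "U_term M U l n = quot_scale M (l ^ n) ((U ^^ Suc n) (const_one +o M))"

section \<open>Logarithms and bounds\<close>

text \<open>\<^term>\<open>ln (0::real)\<close> is \<open>0\<close>, whereas the logarithm of a vanishing norm is minus infinity.\<close>

definition elog :: "real \<Rightarrow> ereal" where
  "elog x = (if x > 0 then ereal (ln x) else -\<infinity>)"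

definition log_plus :: "real \<Rightarrow> real" where
  "log_plus x = real_of_ereal (max (elog x) 0)"

text \<open>The filter of \<open>l\<close> in the disc with \<open>cmod l\<close> tending to \<open>1\<close>.\<close>

definition to_circle :: "complex filter" where
  "to_circle = filtercomap cmod (at_left 1)"

definition C_const :: "real \<Rightarrow> real" where
  "C_const e = 54 / pi * (1 / e ^ 3) * (1 + e) * (1 + 2 * e / 3)\<^sup>2 *
     (1 + 44 / 5 * exp ((26 * pi + 3 / 2) * (2 + 1 / e)))"

definition weight_integral ::
  "(complex \<Rightarrow> complex) set \<Rightarrow> ((complex \<Rightarrow> complex) \<Rightarrow> real) \<Rightarrow> real \<Rightarrow> real \<Rightarrow> real" where
  "weight_integral E N e r = integral {0..r powr (1 / (1 + e))} (weight E N)"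

definition L_fun ::
  "(complex \<Rightarrow> complex) set \<Rightarrow> ((complex \<Rightarrow> complex) \<Rightarrow> real) \<Rightarrow> real \<Rightarrow> real \<Rightarrow> real" where
  "L_fun E N e r = (C_const e + 1) / (1 - r) * (weight_integral E N e r)\<^sup>2"

end

theory Submission
  imports Defs
begin

text \<open>The idea. Choose \<open>f0\<close> in \<open>M\<close> with \<open>f0 0 = 1\<close>. Solving \<open>w - l T w = T f\<close> for \<open>f\<close> in \<open>M\<close> gives
  \<open>(z - l) w(z) = f(z) - f(l)\<close>, and applying \<open>U\<close> to the coset of this function yields
  \<open>(1 - l U) \<pi>(w) = - f(l) U \<pi>(1)\<close>. Hence the resolvent series \<open>F(l) = \<Sum>n. l^n U^(n+1) \<pi>(1)\<close>
  satisfies \<open>f(l) F(l) = - \<pi>(w)\<close>, where \<open>\<parallel>w\<parallel> \<le> \<Delta>(\<bar>l\<bar>) \<parallel>T f\<parallel>\<close>; the values of \<open>f\<close> are also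
  bounded by a multiple of \<open>\<Delta>(\<bar>l\<bar>)\<close>. So \<open>F\<close> is a quotient of two analytic functions that are both
  dominated by a multiple of \<open>\<Delta>\<close>, and everything rests on a division theorem for such quotients.

  Convergence of the series. One has to know that \<open>U\<close> has spectral radius at most \<open>1\<close>. The
  division property shows that \<open>1 - l U\<close> is bijective with bounded inverse for every \<open>l\<close> in the disc
  (\<open>U_lift_resolvent_surj\<close>, \<open>U_lift_resolvent_inj\<close>); the passage from resolvents to powers is
  \<open>power_tends_to_zero\<close>, Rickart's elementary proof of the spectral radius formula by averaging over
  roots of unity. It is applied to \<open>T\<close> on \<open>E\<close> as well, to see that \<open>\<Delta>\<close> is finite on \<open>[0,1)\<close>.
  \<open>U\<close> is handled through a linear lift to \<open>E\<close>, where the quotient norm is a seminorm.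

  Division. A Hahn-Banach functional (\<open>scalarization\<close>) replaces \<open>F\<close> by a scalar function \<open>h\<close> with
  \<open>\<bar>h\<bar> \<le> \<parallel>F\<parallel>\<close>, which attains \<open>\<parallel>F(l)\<parallel>\<close> at a given \<open>l\<close>, or has a given coefficient of size at
  least \<open>\<parallel>U^n \<pi>(1)\<parallel>\<close>. If \<open>f\<close> and \<open>h f\<close> are bounded by \<open>1\<close> on the disc, then removing the zeros of
  \<open>f\<close> by Blaschke factors and using Harnack's inequality gives
  \<open>ln \<bar>h z\<bar> \<le> - ln \<bar>f 0\<bar> (1 + \<bar>z\<bar>) / (1 - \<bar>z\<bar>)\<close> (\<open>division_disc\<close>). When instead \<open>f\<close> and \<open>h f\<close> are
  bounded by \<open>exp (L \<bar>z\<bar>)\<close>, this is applied to \<open>f \<circ> \<phi>\<close> and \<open>h \<circ> \<phi>\<close> with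
  \<open>\<phi>(z) = u R z exp (- p z)\<close>, where \<open>u\<close> is unimodular and \<open>Re p \<ge> 0\<close>. The function \<open>p\<close> is a sum of
  explicit rational functions whose real parts are at least one half outside small neighbourhoods of
  \<open>1\<close>: so \<open>\<phi>\<close> maps the disc into a region that touches the circle of radius \<open>R\<close> only near
  \<open>u\<close>, and the same functions provide a harmonic majorant of \<open>L \<bar>\<phi>\<bar>\<close> (\<open>division_step\<close>).
  If the weights of \<open>p\<close> satisfy a discrete Dini condition, \<open>\<phi>\<close> does not move the point under
  consideration too close to the circle. Balancing that condition against the size of the majorant at
  \<open>0\<close>, with \<open>s\<^sup>2\<close> roughly proportional to \<open>(1 - x) / L x\<close> as the Cauchy-Schwarz inequality suggests,
  produces the square of the integral of \<open>sqrt (L t / (1 - t))\<close> (\<open>division_integral\<close>).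
  The constant obtained is polynomial in \<open>1 / e\<close>, much smaller than \<open>C_const e\<close>. The bounds on \<open>\<parallel>U^n \<pi>(1)\<parallel>\<close> follow by Cauchy's estimate.\<close>

section \<open>Division of bounded analytic functions\<close>

text \<open>The upper half of Harnack's inequality, from the Schwarz lemma applied to the Cayley transform of \<open>k\<close>.\<close>

lemma Harnack_disc:
  assumes hol: "k holomorphic_on ball 0 1" and pos: "\<And>z. z \<in> ball 0 1 \<Longrightarrow> Re (k z) > 0"
    and z: "z \<in> ball (0::complex) 1"
  shows "Re (k z) \<le> Re (k 0) * ((1 + norm z) / (1 - norm z))"
proof -
  define c where "c = k 0"
  define w where "w = (\<lambda>z. (k z - c) / (k z + cnj c))"
  have c0: "Re c > 0" using pos[of 0] by (simp add: c_def)
  have den: "k u + cnj c \<noteq> 0" if "u \<in> ball 0 1" for u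
  proof -
    have "Re (k u + cnj c) > 0" using pos[OF that] c0 by simp
    then show ?thesis by (metis less_irrefl zero_complex.simps(1))
  qed
  have "w holomorphic_on ball 0 1"
    unfolding w_def using den by (intro holomorphic_intros hol) auto
  moreover have "w 0 = 0" by (simp add: w_def c_def)
  moreover have "norm (w u) < 1" if "norm u < 1" for u
  proof -
    have u: "u \<in> ball 0 1" using that by simp
    have "(norm (k u - c))\<^sup>2 < (norm (k u + cnj c))\<^sup>2"
      using mult_pos_pos[OF pos[OF u] c0]
      unfolding cmod_power2 by (simp add: power2_eq_square algebra_simps)
    then have "norm (k u - c) < norm (k u + cnj c)"
      by (simp add: power2_less_imp_less)
    then show ?thesis using den[OF u] by (simp add: w_def norm_divide divide_simps)
  qed
  ultimately have "norm (w z) \<le> norm z"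
    using z by (intro Schwarz_Lemma(1)) auto
  then have 1: "norm (k z - c) \<le> norm z * norm (k z + cnj c)"
    using den[OF z] by (simp add: w_def norm_divide divide_simps)
  have "norm (k z + cnj c) \<le> norm (k z - c) + 2 * Re c"
  proof -
    have "k z + cnj c = (k z - c) + of_real (2 * Re c)"
      by (simp add: complex_eq_iff)
    then show ?thesis using norm_triangle_ineq[of "k z - c" "of_real (2 * Re c)"] c0 
      by (metis abs_of_pos mult_pos_pos norm_of_real zero_less_numeral)
  qed
  then have "norm (k z - c) \<le> norm z * (norm (k z - c) + 2 * Re c)"
    using 1 by (meson order_trans mult_left_mono norm_ge_zero)
  then have "norm (k z - c) * (1 - norm z) \<le> 2 * Re c * norm z"
    by (simp add: algebra_simps)
  then have "norm (k z - c) \<le> 2 * Re c * norm z / (1 - norm z)"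
    using z by (simp add: divide_simps)
  moreover have "Re (k z) - Re c \<le> norm (k z - c)"
    using complex_Re_le_cmod[of "k z - c"] by simp
  moreover have "Re c + 2 * Re c * norm z / (1 - norm z) = Re c * ((1 + norm z) / (1 - norm z))"
    using z by (simp add: field_simps)
  ultimately show ?thesis by (simp add: c_def)
qed

lemma blaschke_identity:
  "(norm (1 - cnj a * z))\<^sup>2 - (norm (z - a))\<^sup>2 = (1 - (norm a)\<^sup>2) * (1 - (norm z)\<^sup>2)"
  unfolding cmod_power2 by (simp add: power2_eq_square algebra_simps)

lemma blaschke_denom_nonzero:
  assumes "a \<in> ball 0 1" "u \<in> ball (0::complex) 1" shows "1 - cnj a * u \<noteq> 0"
proof -
  have "norm (cnj a * u) < 1 * 1" unfolding norm_mult
    using assms by (intro mult_strict_mono') auto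
  then show ?thesis by auto
qed

text \<open>Dividing by a Blaschke factor keeps the bound \<open>1\<close>: on circles of radius \<open>t\<close> close to \<open>1\<close> the
  square of its modulus is at least \<open>q t\<close>, which tends to \<open>1\<close>.\<close>

lemma blaschke_divide_le_one:
  assumes a: "a \<in> ball 0 1" and hol: "g holomorphic_on ball 0 1"
    and le: "\<And>z. z \<in> ball 0 1 \<Longrightarrow> norm ((z - a) / (1 - cnj a * z) * g z) \<le> 1"
    and z: "z \<in> ball (0::complex) 1"
  shows "norm (g z) \<le> 1"
proof -
  define q where "q = (\<lambda>t. 1 - (1 - t\<^sup>2) * ((1 - (norm a)\<^sup>2) / (1 - norm a)\<^sup>2))"
  have na: "norm a < 1" using a by simp
  have main: "(norm (g z))\<^sup>2 * q t \<le> 1" if t: "t < 1" "norm z < t" "q t > 0" for t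
  proof -
    have fr: "norm (g w) \<le> 1 / sqrt (q t)" if "w \<in> frontier (ball 0 t)" for w
    proof -
      have "t > 0" using t(2) norm_ge_zero[of z] by linarith
      then have w: "norm w = t" using that by (simp add: frontier_ball)
      have wb: "w \<in> ball 0 1" using w t by simp
      have n1: "norm (1 - cnj a * w) \<ge> 1 - norm a"
      proof -
        have "norm (cnj a * w) \<le> norm a * 1" unfolding norm_mult 
          using w t by (intro mult_mono) auto
        then show ?thesis using norm_triangle_ineq2[of 1 "cnj a * w"] by simp
      qed
      define b where "b = norm ((w - a) / (1 - cnj a * w))"
      have "b\<^sup>2 = 1 - (1 - t\<^sup>2) * (1 - (norm a)\<^sup>2) / (norm (1 - cnj a * w))\<^sup>2"
      proof -
        define D where "D = (norm (1 - cnj a * w))\<^sup>2"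
        have "D > 0" using n1 na unfolding D_def by (intro zero_less_power) linarith
        moreover have "(norm (w - a))\<^sup>2 = D - (1 - t\<^sup>2) * (1 - (norm a)\<^sup>2)"
          using blaschke_identity[of a w] by (simp add: w D_def algebra_simps)
        ultimately show ?thesis
          unfolding b_def norm_divide power_divide D_def[symmetric] by (simp add: diff_divide_distrib)
      qed
      also have "\<dots> \<ge> q t"
      proof -
        have "(1 - t\<^sup>2) * (1 - (norm a)\<^sup>2) / (norm (1 - cnj a * w))\<^sup>2
           \<le> (1 - t\<^sup>2) * (1 - (norm a)\<^sup>2) / (1 - norm a)\<^sup>2"
          using n1 na t norm_ge_zero[of z] 
          by (intro divide_left_mono power_mono mult_nonneg_nonneg mult_pos_pos zero_less_power)
             (auto simp: power_le_one abs_square_le_1 simp del: norm_ge_zero)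
        then show ?thesis by (simp add: q_def)
      qed
      finally have "sqrt (q t) \<le> b"
        by (metis b_def norm_ge_zero real_le_lsqrt real_sqrt_le_iff real_sqrt_unique)
      then have "norm (g w) * sqrt (q t) \<le> b * norm (g w)"
        using mult_right_mono[OF _ norm_ge_zero, of "sqrt (q t)" b "g w"] by (simp add: mult.commute)
      also have "\<dots> \<le> 1" using le[OF wb] unfolding b_def norm_mult .
      finally show ?thesis using t(3) by (simp add: field_simps)
    qed
    have "norm (g z) \<le> 1 / sqrt (q t)"
    proof (rule maximum_modulus_frontier[of g "ball 0 t"])
      show "g holomorphic_on interior (ball 0 t)"
        using hol by (rule holomorphic_on_subset) (use t in auto)
      have "closure (ball (0::complex) t) \<subseteq> ball 0 1" using t norm_ge_zero[of z] by (auto simp del: norm_ge_zero)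
      then show "continuous_on (closure (ball 0 t)) g"
        using hol holomorphic_on_imp_continuous_on continuous_on_subset by blast
    qed (use fr t in auto)
    then have "norm (g z) * sqrt (q t) \<le> 1" using t(3) by (simp add: field_simps)
    then have "(norm (g z) * sqrt (q t))\<^sup>2 \<le> 1" using t(3) by (simp add: abs_square_le_1)
    then show ?thesis using t(3) by (simp add: power_mult_distrib)
  qed
  have qlim: "(q \<longlongrightarrow> 1) (at_left 1)"
    unfolding q_def by (rule tendsto_eq_intros refl | simp)+
  have "\<forall>\<^sub>F t in at_left 1. q t > 0"
    using qlim by (rule order_tendstoD) simp
  moreover have "\<forall>\<^sub>F t in at_left 1. t < (1::real) \<and> norm z < t"
    using z by (intro eventually_conj eventually_at_left_1 eventually_at_leftI[of "norm z"]) auto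
  ultimately have "\<forall>\<^sub>F t in at_left 1. (norm (g z))\<^sup>2 * q t \<le> 1"
    by eventually_elim (use main in auto)
  moreover have "((\<lambda>t. (norm (g z))\<^sup>2 * q t) \<longlongrightarrow> (norm (g z))\<^sup>2 * 1) (at_left 1)"
    by (intro tendsto_intros qlim)
  ultimately have "(norm (g z))\<^sup>2 * 1 \<le> 1"
    using tendsto_upperbound[OF _ _ trivial_limit_at_left_real] by blast
  then show ?thesis by (simp add: abs_square_le_1)
qed

lemma blaschke_power_divide_le_one:
  assumes a: "a \<in> ball 0 1"
  shows "g holomorphic_on ball 0 1 \<Longrightarrow>
    (\<And>z. z \<in> ball 0 1 \<Longrightarrow> norm (((z - a) / (1 - cnj a * z)) ^ n * g z) \<le> 1) \<Longrightarrow>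
    z \<in> ball (0::complex) 1 \<Longrightarrow> norm (g z) \<le> 1"
proof (induction n arbitrary: z)
  case 0 then show ?case by auto
next
  case (Suc n)
  have nz: "1 - cnj a * u \<noteq> 0" if "u \<in> ball 0 1" for u
    using blaschke_denom_nonzero a that by blast
  have "norm (((u - a) / (1 - cnj a * u)) ^ n * g u) \<le> 1" if "u \<in> ball 0 1" for u
  proof (rule blaschke_divide_le_one[OF a _ _ that])
    show "(\<lambda>u. ((u - a) / (1 - cnj a * u)) ^ n * g u) holomorphic_on ball 0 1"
      using nz by (intro holomorphic_intros Suc.prems) auto
  next
    fix w :: complex assume "w \<in> ball 0 1"
    from Suc.prems(2)[OF this]
    show "norm ((w - a) / (1 - cnj a * w) * (((w - a) / (1 - cnj a * w)) ^ n * g w)) \<le> 1"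
      by (simp add: mult.assoc)
  qed
  then show ?case using Suc by blast
qed

lemma factor_out_zero:
  assumes hol: "f holomorphic_on S" and S: "open S" "connected S"
    and a: "a \<in> S" "f a = 0" and nz: "b \<in> S" "f b \<noteq> 0"
  obtains g n where "g holomorphic_on S" "0 < n" "g a \<noteq> 0"
    "\<And>z. z \<in> S \<Longrightarrow> f z = (z - a) ^ n * g z"
proof -
  have "\<not> f constant_on S"
    using a nz by (force simp: constant_on_def)
  then obtain g r n where g: "0 < n" "0 < r" "ball a r \<subseteq> S" "g holomorphic_on ball a r"
    "\<And>w. w \<in> ball a r \<Longrightarrow> f w = (w - a)^n * g w" "\<And>w. w \<in> ball a r \<Longrightarrow> g w \<noteq> 0"
    using holomorphic_factor_zero_nonconstant[OF hol S a] by metis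
  define G where "G = (\<lambda>z. if z \<in> ball a r then g z else f z / (z - a) ^ n)"
  have G2: "G z = f z / (z - a) ^ n" if "z \<noteq> a" for z
    using that g(5)[of z] by (auto simp: G_def)
  show thesis
  proof (rule that[of G n])
    have "G holomorphic_on ball a r"
      using g(4) by (rule holomorphic_transform) (auto simp: G_def)
    moreover have "G holomorphic_on (S - {a})"
    proof (rule holomorphic_transform)
      show "(\<lambda>z. f z / (z - a) ^ n) holomorphic_on (S - {a})"
        by (intro holomorphic_intros holomorphic_on_subset[OF hol]) auto
    qed (use G2 in auto)
    ultimately have "G holomorphic_on (ball a r \<union> (S - {a}))"
      by (rule holomorphic_on_Un) (use S in auto)
    moreover have "ball a r \<union> (S - {a}) = S" using g(2,3) a by auto
    ultimately show "G holomorphic_on S" by simp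
    show "G a \<noteq> 0" using g(2) g(6)[of a] by (simp add: G_def)
    show "f z = (z - a) ^ n * G z" if "z \<in> S" for z
      using that G2[of z] a g(1) by (cases "z = a") auto
  qed (use g in auto)
qed

text \<open>Induction on the number of distinct zeros of \<open>f\<close>. Dividing by a Blaschke factor does not
  decrease \<open>\<bar>f 0\<bar>\<close>; without zeros, \<open>- ln \<bar>f\<bar>\<close> is the real part of a holomorphic function and
  Harnack's inequality applies.\<close>

lemma division_finite_zeros:
  assumes "finite {z \<in> ball 0 1. f z = 0}"
    and "f holomorphic_on ball 0 1" "h holomorphic_on ball 0 1"
    and "\<And>z. z \<in> ball 0 1 \<Longrightarrow> norm (f z) \<le> 1"
    and "\<And>z. z \<in> ball 0 1 \<Longrightarrow> norm (h z * f z) \<le> 1"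
    and "f 0 \<noteq> 0" and z: "z \<in> ball (0::complex) 1"
  shows "ln (norm (h z)) \<le> - ln (norm (f 0)) * ((1 + norm z) / (1 - norm z))"
  using assms(1-6)
proof (induction "card {z \<in> ball 0 1. f z = 0}" arbitrary: f)
  case 0
  then have nz: "f u \<noteq> 0" if "u \<in> ball 0 1" for u using that by auto
  have "contractible (ball (0::complex) 1)" by (simp add: convex_imp_contractible)
  then obtain k where k: "k holomorphic_on ball 0 1" "\<And>u. u \<in> ball 0 1 \<Longrightarrow> f u = exp (k u)"
    using contractible_imp_holomorphic_log[OF 0(3)] nz 
    by (metis (no_types, lifting) simply_connected_imp_connected contractible_imp_simply_connected)
  have nf: "ln (norm (f u)) = Re (k u)" if "u \<in> ball 0 1" for u
    using k(2)[OF that] by simp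
  have le0: "Re (k u) \<le> 0" if "u \<in> ball 0 1" for u
    using 0(5)[OF that] k(2)[OF that] by simp
  define K where "K = (1 + norm z) / (1 - norm z)"
  have K: "K \<ge> 1" using z by (simp add: K_def divide_simps)
  \<comment> \<open>\<open>Re k\<close> may vanish, so that a small positive constant is added before using Harnack\<close>
  have *: "- Re (k z) \<le> - Re (k 0) * K + e" if "e > 0" for e
  proof -
    define e' where "e' = e / K"
    have e': "e' > 0" using that K by (simp add: e'_def)
    have "Re (e' - k z) \<le> Re (e' - k 0) * K"
      unfolding K_def
    proof (rule Harnack_disc[of "\<lambda>u. complex_of_real e' - k u", OF _ _ z])
      show "(\<lambda>u. complex_of_real e' - k u) holomorphic_on ball 0 1"
        by (intro holomorphic_intros k)
    qed (use le0 e' in \<open>force\<close>)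
    then have "- Re (k z) \<le> - Re (k 0) * K + e' * K" using e' by (simp add: algebra_simps)
    then show ?thesis using K by (simp add: e'_def)
  qed
  then have **: "- Re (k z) \<le> - Re (k 0) * K" by (rule field_le_epsilon) 
  show ?case
  proof (cases "h z = 0")
    case True
    have "0 \<le> - Re (k 0) * K" using le0[of 0] K by (intro mult_nonneg_nonneg) auto
    then show ?thesis using True nf[of 0] by (simp add: K_def)
  next
    case False
    have "ln (norm (h z * f z)) \<le> 0"
      using 0(6)[OF z] False nz[OF z] by (intro ln_le_zero_iff[THEN iffD2]) auto
    then have "ln (norm (h z)) + Re (k z) \<le> 0"
      using False nz[OF z] nf[OF z] by (simp add: norm_mult ln_mult)
    then show ?thesis using ** nf[of 0] by (simp add: K_def)
  qed
next
  case (Suc c)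
  then have "{z \<in> ball 0 1. f z = 0} \<noteq> {}" by (metis card.empty nat.simps(3))
  then obtain a where a: "a \<in> ball 0 1" "f a = 0" by auto
  obtain g n where g: "g holomorphic_on ball 0 1" "0 < n" "g a \<noteq> 0"
    "\<And>z. z \<in> ball 0 1 \<Longrightarrow> f z = (z - a) ^ n * g z"
    by (rule factor_out_zero[of f "ball 0 1" a 0]) (use Suc.prems a in auto)
  define F where "F = (\<lambda>u. (1 - cnj a * u) ^ n * g u)"
  have nz: "1 - cnj a * u \<noteq> 0" if "u \<in> ball 0 1" for u
    using blaschke_denom_nonzero a(1) that by blast
  have fF: "f u = ((u - a) / (1 - cnj a * u)) ^ n * F u" if "u \<in> ball 0 1" for u
    using g(4)[OF that] nz[OF that] by (simp add: F_def power_divide)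
  have holF: "F holomorphic_on ball 0 1"
    unfolding F_def by (intro holomorphic_intros g)
  have zeros: "{u \<in> ball 0 1. f u = 0} = insert a {u \<in> ball 0 1. F u = 0}"
    using a g nz by (auto simp: F_def)
  have a2: "a \<notin> {u \<in> ball 0 1. F u = 0}" using g(3) nz[OF a(1)] by (simp add: F_def)
  have fin: "finite {u \<in> ball 0 1. F u = 0}" using Suc.prems(1) zeros by (metis finite_insert)
  have card: "c = card {u \<in> ball 0 1. F u = 0}"
    using Suc.hyps(2) zeros a2 fin by simp
  have F0: "norm (f 0) \<le> norm (F 0)"
    using fF[of 0] a by (simp add: norm_mult norm_power mult_left_le_one_le power_le_one)
  have F0': "F 0 \<noteq> 0" using F0 Suc.prems(6) by auto
  have "ln (norm (h z)) \<le> - ln (norm (F 0)) * ((1 + norm z) / (1 - norm z))"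
  proof (rule Suc.hyps(1)[OF card fin holF Suc.prems(3) _ _ F0'])
    show "norm (F u) \<le> 1" if "u \<in> ball 0 1" for u
      using blaschke_power_divide_le_one[OF a(1) holF, of n u] fF Suc.prems(4) that by metis
    show "norm (h u * F u) \<le> 1" if "u \<in> ball 0 1" for u
    proof (rule blaschke_power_divide_le_one[OF a(1) _ _ that, of "\<lambda>u. h u * F u" n])
      show "(\<lambda>u. h u * F u) holomorphic_on ball 0 1" by (intro holomorphic_intros holF Suc.prems)
      show "norm (((v - a) / (1 - cnj a * v)) ^ n * (h v * F v)) \<le> 1" if "v \<in> ball 0 1" for v
        using Suc.prems(5)[OF that] fF[OF that] by (simp add: mult.left_commute)
    qed
  qed
  also have "\<dots> \<le> - ln (norm (f 0)) * ((1 + norm z) / (1 - norm z))"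
  proof (rule mult_right_mono)
    show "- ln (norm (F 0)) \<le> - ln (norm (f 0))"
      using F0 F0' Suc.prems(6) by (simp add: ln_le_cancel_iff)
  qed (use z in simp)
  finally show ?case .
qed

text \<open>The zeros of \<open>f\<close> may accumulate at the circle; the dilations \<open>z \<mapsto> t z\<close> with \<open>t < 1\<close> have
  finitely many zeros, and \<open>t\<close> tends to \<open>1\<close>.\<close>

lemma division_disc:
  assumes f: "f holomorphic_on ball 0 1" and h: "h holomorphic_on ball 0 1"
    and f1: "\<And>z. z \<in> ball 0 1 \<Longrightarrow> norm (f z) \<le> 1"
    and hf: "\<And>z. z \<in> ball 0 1 \<Longrightarrow> norm (h z * f z) \<le> 1"
    and f0: "f 0 \<noteq> 0" and z: "z \<in> ball (0::complex) 1"
  shows "ln (norm (h z)) \<le> - ln (norm (f 0)) * ((1 + norm z) / (1 - norm z))"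
proof -
  have main: "ln (norm (h z)) \<le> - ln (norm (f 0)) * ((1 + norm z / t) / (1 - norm z / t))"
    if t: "norm z < t" "t < 1" for t
  proof -
    have t0: "t > 0" using t norm_ge_zero[of z] by linarith
    have sub: "of_real t * u \<in> ball 0 1" if "u \<in> cball 0 1" for u :: complex
    proof -
      have "t * norm u \<le> t * 1" using that t0 by (intro mult_left_mono) auto
      then have "t * norm u < 1" using t by linarith
      then show ?thesis using t0 by (simp add: norm_mult)
    qed
    have zt: "z / of_real t \<in> ball 0 1" using t t0 by (simp add: norm_divide)
    have hol: "(\<lambda>u. F (of_real t * u)) holomorphic_on ball 0 1" if "F holomorphic_on ball 0 1" for F
      using holomorphic_on_compose_gen[of "\<lambda>u. of_real t * u" "ball 0 1" F "ball 0 1"] that sub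
      by (force intro: holomorphic_intros simp: o_def)
    have "finite {u \<in> cball 0 t. f u = 0}" if "\<not> f constant_on ball 0 1"
      using f t that by (intro holomorphic_compact_finite_zeros[of f "ball 0 1"]) auto
    moreover have "{u \<in> cball 0 t. f u = 0} = {}" if "f constant_on ball 0 1"
    proof -
      have "f u \<noteq> 0" if "u \<in> ball 0 1" for u
        using that f0 \<open>f constant_on ball 0 1\<close> unfolding constant_on_def
        by (metis centre_in_ball zero_less_one)
      then show ?thesis using t by auto
    qed
    ultimately have "finite {u \<in> cball 0 t. f u = 0}" by (metis finite.emptyI)
    then have "finite ((\<lambda>u. u / of_real t) ` {u \<in> cball 0 t. f u = 0})" by simp
    moreover have "{u \<in> ball 0 1. f (of_real t * u) = 0} \<subseteq> (\<lambda>u. u / of_real t) ` {u \<in> cball 0 t. f u = 0}"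
    proof
      fix u assume u: "u \<in> {u \<in> ball 0 1. f (of_real t * u) = 0}"
      then have "of_real t * u \<in> {u \<in> cball 0 t. f u = 0}"
        using t0 by (simp add: norm_mult)
      moreover have "u = (of_real t * u) / of_real t" using t0 by simp
      ultimately show "u \<in> (\<lambda>u. u / of_real t) ` {u \<in> cball 0 t. f u = 0}" by blast
    qed
    ultimately have fin: "finite {u \<in> ball 0 1. f (of_real t * u) = 0}"
      by (rule finite_subset[rotated])
    have "ln (norm (h (of_real t * (z / of_real t)))) \<le> - ln (norm (f (of_real t * 0))) *
       ((1 + norm (z / of_real t)) / (1 - norm (z / of_real t)))"
      by (rule division_finite_zeros[OF fin hol[OF f] hol[OF h] f1[OF sub] hf[OF sub] _ zt])
         (use f0 in auto)
    then show ?thesis using t0 by (simp add: norm_divide)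
  qed
  have "((\<lambda>t. - ln (norm (f 0)) * ((1 + norm z / t) / (1 - norm z / t))) \<longlongrightarrow>
       - ln (norm (f 0)) * ((1 + norm z / 1) / (1 - norm z / 1))) (at_left 1)"
    using z by (intro tendsto_intros) auto
  moreover have "\<forall>\<^sub>F t in at_left 1. ln (norm (h z)) \<le> - ln (norm (f 0)) * ((1 + norm z / t) / (1 - norm z / t))"
    using z by (intro eventually_at_leftI[of "norm z"] main) auto
  ultimately show ?thesis
    using tendsto_lowerbound by fastforce
qed

section \<open>Division of analytic functions with a radial majorant\<close>

text \<open>With \<open>w = 1 - z\<close>, this is \<open>w / (w + s)\<close>. On the closed disc its real part lies between \<open>0\<close> and \<open>1\<close>;
  it is at least \<open>1/2\<close> where \<open>\<bar>w\<bar> \<ge> s\<close> and at most \<open>1/2\<close> where \<open>\<bar>w\<bar> \<le> s\<close>. Thus it is a smooth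
  substitute for the harmonic measure of the arc at distance at least \<open>s\<close> from \<open>1\<close>, and
  \<open>1 - barrier s\<close> is one for the complementary arc.\<close>

definition barrier :: "real \<Rightarrow> complex \<Rightarrow> complex" where
  "barrier s z = (1 - z) / (1 - z + of_real s)"

lemma barrier_denom_nonzero:
  fixes z :: complex
  assumes "s > 0" "norm z \<le> 1" shows "1 - z + of_real s \<noteq> 0"
proof -
  have "Re (1 - z + of_real s) > 0" using assms complex_Re_le_cmod[of z] by simp
  then show ?thesis by (metis less_irrefl zero_complex.simps(1))
qed

lemma holomorphic_barrier:
  assumes "s > 0" shows "barrier s holomorphic_on ball 0 1"
  unfolding barrier_def using barrier_denom_nonzero[OF assms]
  by (intro holomorphic_intros) simp_all

lemma Re_barrier:
  "Re (barrier s z) = ((norm (1 - z))\<^sup>2 + s * Re (1 - z)) / ((norm (1 - z))\<^sup>2 + 2 * s * Re (1 - z) + s\<^sup>2)"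
proof -
  have "Re (barrier s z) = Re ((1 - z) * cnj (1 - z + of_real s)) / (norm (1 - z + of_real s))\<^sup>2"
    unfolding barrier_def by (subst complex_div_cnj) (simp add: Re_divide_of_real flip: of_real_power)
  also have "Re ((1 - z) * cnj (1 - z + of_real s)) = (norm (1 - z))\<^sup>2 + s * Re (1 - z)"
    unfolding cmod_power2 by (simp add: power2_eq_square algebra_simps)
  also have "(norm (1 - z + of_real s))\<^sup>2 = (norm (1 - z))\<^sup>2 + 2 * s * Re (1 - z) + s\<^sup>2"
    unfolding cmod_power2 by (simp add: power2_eq_square algebra_simps)
  finally show ?thesis .
qed

lemma Re_barrier_bounds:
  assumes s: "s > 0" and z: "norm z \<le> 1"
  shows "0 \<le> Re (barrier s z)" "Re (barrier s z) \<le> 1"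
    and "s \<le> norm (1 - z) \<Longrightarrow> 1 / 2 \<le> Re (barrier s z)"
    and "norm (1 - z) \<le> s \<Longrightarrow> Re (barrier s z) \<le> 1 / 2"
proof -
  have x: "Re (1 - z) \<ge> 0" using z complex_Re_le_cmod[of z] by simp
  have sx: "s * Re (1 - z) \<ge> 0" using x s by (intro mult_nonneg_nonneg) auto
  have d: "(norm (1 - z))\<^sup>2 + 2 * s * Re (1 - z) + s\<^sup>2 > 0"
    using sx s by (intro add_nonneg_pos) auto
  show "0 \<le> Re (barrier s z)"
    unfolding Re_barrier using sx d by (intro divide_nonneg_pos) auto
  show "Re (barrier s z) \<le> 1"
    unfolding Re_barrier using sx d by (simp add: divide_simps)
  show "1 / 2 \<le> Re (barrier s z)" if "s \<le> norm (1 - z)"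
  proof -
    have "s\<^sup>2 \<le> (norm (1 - z))\<^sup>2" using that s by (intro power_mono) auto
    then show ?thesis unfolding Re_barrier using d by (simp add: divide_simps)
  qed
  show "Re (barrier s z) \<le> 1 / 2" if "norm (1 - z) \<le> s"
  proof -
    have "(norm (1 - z))\<^sup>2 \<le> s\<^sup>2" using that s by (intro power_mono) auto
    then show ?thesis unfolding Re_barrier using d by (simp add: divide_simps)
  qed
qed

lemma barrier_of_real: "barrier s (of_real x) = of_real ((1 - x) / (1 - x + s))"
  by (simp add: barrier_def)

lemma exp_minus_le: 
  assumes "0 \<le> y" "y \<le> (1/2::real)" shows "exp (- (2 * y)) \<le> 1 - y"
proof -
  have "1 \<le> (1 - y) * (1 + 2 * y)" using mult_left_mono[of "2*y" 1 y] assms by (simp add: algebra_simps)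
  also have "\<dots> \<le> (1 - y) * exp (2 * y)" using assms by (intro mult_left_mono exp_ge_add_one_self) auto
  finally show ?thesis by (simp add: exp_minus field_simps)
qed

text \<open>The radii \<open>x k\<close> are thought of as decreasing and the \<open>s k\<close> as increasing, but the proof needs
  neither. Where \<open>\<bar>1 - z\<bar> \<ge> s k\<close>, the term of index \<open>k\<close> in \<open>p\<close> pushes \<open>\<phi> z\<close> into the disc of radius
  \<open>x (Suc k)\<close>. The sum of the quotients \<open>b k / s k\<close> controls how much \<open>\<phi>\<close> moves points of the radius
  that ends at \<open>1\<close>.\<close>

lemma division_step:
  fixes L :: "real \<Rightarrow> real" and x b s :: "nat \<Rightarrow> real"
  assumes f: "f holomorphic_on ball 0 1" and h: "h holomorphic_on ball 0 1"
    and fL: "\<And>z. z \<in> ball 0 1 \<Longrightarrow> norm (f z) \<le> exp (kap + L (norm z))"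
    and hfL: "\<And>z. z \<in> ball 0 1 \<Longrightarrow> norm (h z * f z) \<le> exp (kap + L (norm z))"
    and f0: "f 0 \<noteq> 0"
    and Lmono: "\<And>s t. 0 \<le> s \<Longrightarrow> s \<le> t \<Longrightarrow> t < 1 \<Longrightarrow> L s \<le> L t"
    and L0: "\<And>t. 0 \<le> t \<Longrightarrow> t < 1 \<Longrightarrow> 0 \<le> L t"
    and x: "\<And>k. k \<le> Suc n \<Longrightarrow> 0 < x k \<and> x k < 1" and s: "\<And>k. k \<le> n \<Longrightarrow> s k > 0"
    and b0: "\<And>k. k \<le> n \<Longrightarrow> b k \<ge> 0"
    and b: "\<And>k. k \<le> n \<Longrightarrow> exp (- (b k / 2)) \<le> x (Suc k)"
    and dini: "(\<Sum>k\<le>n. b k / s k) \<le> 1"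
    and lam: "norm \<zeta> < x 0"
  shows "ln (norm (h \<zeta>)) \<le>
    (kap + L (x (Suc n)) + 2 * (\<Sum>k\<le>n. L (x k) * s k) - ln (norm (f 0))) * (4 / (1 - norm \<zeta> / x 0))"
proof -
  define R where "R = x 0"
  have R: "0 < R" "R < 1" using x[of 0] by (auto simp: R_def)
  define p where "p = (\<lambda>z. \<Sum>k\<le>n. of_real (b k) * barrier (s k) z)"
  define u where "u = (if \<zeta> = 0 then 1 else sgn \<zeta>)"
  have u: "norm u = 1" "\<zeta> = u * of_real (norm \<zeta>)"
    by (auto simp: u_def norm_sgn sgn_eq norm_divide)
  define \<phi> where "\<phi> = (\<lambda>z. u * of_real R * z * exp (- p z))"
  define m where "m = (\<lambda>z. of_real (kap + L (x (Suc n))) + 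
      2 * (\<Sum>k\<le>n. of_real (L (x k)) * (1 - barrier (s k) z)))"
  have holp: "p holomorphic_on ball 0 1"
    unfolding p_def using s by (intro holomorphic_intros holomorphic_barrier) auto
  have holphi: "\<phi> holomorphic_on ball 0 1"
    unfolding \<phi>_def by (intro holomorphic_intros holp)
  have holm: "m holomorphic_on ball 0 1"
    unfolding m_def using s by (intro holomorphic_intros holomorphic_barrier) auto
  have Rep: "Re (p z) = (\<Sum>k\<le>n. b k * Re (barrier (s k) z))" for z
    by (simp add: p_def)
  have Rem: "Re (m z) = kap + L (x (Suc n)) + 2 * (\<Sum>k\<le>n. L (x k) * (1 - Re (barrier (s k) z)))" for z
  proof -
    have "Re (\<Sum>k\<le>n. of_real (L (x k)) * (1 - barrier (s k) z)) = (\<Sum>k\<le>n. L (x k) * (1 - Re (barrier (s k) z)))"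
      by simp
    then show ?thesis unfolding m_def by simp
  qed
  have Lx: "L (x k) \<ge> 0" if "k \<le> Suc n" for k using x[OF that] L0 by auto
  have nphi: "norm (\<phi> z) = R * norm z * exp (- Re (p z))" for z
    using u R by (simp add: \<phi>_def norm_mult)
  have Rep0: "Re (p z) \<ge> 0" if "norm z \<le> 1" for z
    unfolding Rep using b0 s Re_barrier_bounds(1)[OF _ that] by (intro sum_nonneg mult_nonneg_nonneg) auto
  have phiR: "norm (\<phi> z) \<le> R" if "norm z \<le> 1" for z
  proof -
    have "R * norm z * exp (- Re (p z)) \<le> R * 1 * 1"
      using that R Rep0[OF that] by (intro mult_mono) auto
    then show ?thesis by (simp add: nphi)
  qed
  \<comment> \<open>\<open>Re m\<close> majorizes \<open>L\<close> along \<open>\<phi>\<close>: take the last \<open>k\<close> with \<open>s k \<le> \<bar>1 - z\<bar>\<close>; the term of index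
    \<open>Suc k\<close>, where \<open>\<bar>1 - z\<bar> < s (Suc k)\<close>, is at least \<open>L (x (Suc k))\<close>\<close>
  have key: "kap + L (norm (\<phi> z)) \<le> Re (m z)" if z: "norm z \<le> 1" for z
  proof -
    have term0: "L (x k) * (1 - Re (barrier (s k) z)) \<ge> 0" if "k \<le> n" for k
      using Lx[of k] Re_barrier_bounds(2)[OF s[OF that] z] that by (intro mult_nonneg_nonneg) auto
    have big: "L (x k) \<le> 2 * (\<Sum>k\<le>n. L (x k) * (1 - Re (barrier (s k) z)))"
      if k: "k \<le> n" "norm (1 - z) \<le> s k" for k
    proof -
      have "L (x k) \<le> 2 * (L (x k) * (1 - Re (barrier (s k) z)))"
        using mult_left_mono[OF Re_barrier_bounds(4)[OF s[OF k(1)] z k(2)] Lx[of k]] k by (simp add: algebra_simps)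
      also have "\<dots> \<le> 2 * (\<Sum>k\<le>n. L (x k) * (1 - Re (barrier (s k) z)))"
        using term0 k by (intro mult_left_mono member_le_sum) auto
      finally show ?thesis .
    qed
    have small: "L (norm (\<phi> z)) \<le> L (x (Suc k))" if k: "k \<le> n" "s k \<le> norm (1 - z)" for k
    proof -
      have "b k / 2 \<le> b k * Re (barrier (s k) z)"
        using mult_left_mono[OF Re_barrier_bounds(3)[OF s[OF k(1)] z k(2)] b0[OF k(1)]] by simp
      also have "\<dots> \<le> Re (p z)" unfolding Rep
        using b0 s Re_barrier_bounds(1)[OF _ z] k by (intro member_le_sum mult_nonneg_nonneg) auto
      finally have "R * norm z * exp (- Re (p z)) \<le> 1 * 1 * exp (- (b k / 2))"
        using R z by (intro mult_mono) auto
      then have "norm (\<phi> z) \<le> x (Suc k)" using b[OF k(1)] by (simp add: nphi)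
      then show ?thesis using x[of "Suc k"] k by (intro Lmono) auto
    qed
    have "L (norm (\<phi> z)) \<le> L (x (Suc n)) + 2 * (\<Sum>k\<le>n. L (x k) * (1 - Re (barrier (s k) z)))"
    proof (cases "\<exists>k\<le>n. s k \<le> norm (1 - z)")
      case False
      then have "norm (1 - z) \<le> s 0" by (force simp: not_le)
      then have "L (x 0) \<le> 2 * (\<Sum>k\<le>n. L (x k) * (1 - Re (barrier (s k) z)))" by (intro big) auto
      moreover have "L (norm (\<phi> z)) \<le> L (x 0)" using phiR[OF z] R by (intro Lmono) (auto simp: R_def)
      ultimately show ?thesis using Lx[of "Suc n"] by linarith
    next
      case True
      define K where "K = {k. k \<le> n \<and> s k \<le> norm (1 - z)}"
      define k where "k = Max K"
      have K: "finite K" "K \<noteq> {}" using True by (auto simp: K_def)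
      have k: "k \<le> n \<and> s k \<le> norm (1 - z)"
        using Max_in[OF K] by (simp add: k_def K_def)
      have kmax: "j \<le> k" if "j \<le> n \<and> s j \<le> norm (1 - z)" for j
        using Max_ge[OF K(1), of j] that by (simp add: k_def K_def)
      have sm: "L (norm (\<phi> z)) \<le> L (x (Suc k))" using small k by blast
      show ?thesis
      proof (cases "k = n")
        case True
        have "0 \<le> (\<Sum>k\<le>n. L (x k) * (1 - Re (barrier (s k) z)))" using term0 by (intro sum_nonneg) auto
        then show ?thesis using sm True by simp
      next
        case False
        then have k2: "Suc k \<le> n" using k by simp
        then have "norm (1 - z) \<le> s (Suc k)" using kmax[of "Suc k"] by force
        then show ?thesis using big[OF k2] sm Lx[of "Suc n"] by linarith
      qed
    qed
    then show ?thesis by (simp add: Rem)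
  qed
  have phiin: "\<phi> z \<in> ball 0 1" if "z \<in> ball 0 1" for z
    using phiR[of z] that R by simp
  have comp: "(\<lambda>z. F (\<phi> z)) holomorphic_on ball 0 1" if "F holomorphic_on ball 0 1" for F
  proof -
    have "\<phi> ` ball 0 1 \<subseteq> ball 0 1" using phiin by blast
    from holomorphic_on_compose_gen[OF holphi that this] show ?thesis by (simp add: o_def)
  qed
  define g where "g = (\<lambda>z. f (\<phi> z) * exp (- m z))"
  have holg: "g holomorphic_on ball 0 1" unfolding g_def by (intro holomorphic_intros comp f holm)
  have g1: "norm (g z) \<le> 1" and hg1: "norm (h (\<phi> z) * g z) \<le> 1" if z: "z \<in> ball 0 1" for z
  proof -
    have k: "exp (kap + L (norm (\<phi> z))) * exp (- Re (m z)) \<le> 1"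
      using key[of z] z unfolding exp_add[symmetric] by simp
    have "norm (g z) = norm (f (\<phi> z)) * exp (- Re (m z))" by (simp add: g_def norm_mult)
    also have "\<dots> \<le> exp (kap + L (norm (\<phi> z))) * exp (- Re (m z))" 
      using fL[OF phiin[OF z]] by (intro mult_right_mono) auto
    finally show "norm (g z) \<le> 1" using k by simp
    have "norm (h (\<phi> z) * g z) = norm (h (\<phi> z) * f (\<phi> z)) * exp (- Re (m z))" by (simp add: g_def norm_mult)
    also have "\<dots> \<le> exp (kap + L (norm (\<phi> z))) * exp (- Re (m z))" 
      using hfL[OF phiin[OF z]] by (intro mult_right_mono) auto
    finally show "norm (h (\<phi> z) * g z) \<le> 1" using k by simp
  qed
  have phi0: "\<phi> 0 = 0" by (simp add: \<phi>_def)
  have g0: "g 0 \<noteq> 0" using f0 by (simp add: g_def phi0)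
  \<comment> \<open>the preimage of \<open>\<zeta>\<close> on the positive radius\<close>
  define P where "P = (\<lambda>t::real. \<Sum>k\<le>n. b k * ((1 - t) / (1 - t + s k)))"
  have pP: "p (of_real t) = of_real (P t)" for t by (simp add: p_def P_def barrier_of_real)
  have tR: "0 \<le> norm \<zeta> / R" "norm \<zeta> / R < 1" using lam R by (auto simp: R_def)
  have "\<exists>t\<ge>0. t \<le> 1 \<and> t * exp (- P t) = norm \<zeta> / R"
  proof (rule IVT)
    have "isCont P t" if "0 \<le> t" "t \<le> 1" for t
      unfolding P_def using that s by (intro continuous_intros) (force simp: add_nonneg_eq_0_iff)
    then show "\<forall>t. 0 \<le> t \<and> t \<le> 1 \<longrightarrow> isCont (\<lambda>t. t * exp (- P t)) t"
      by (auto intro!: continuous_intros)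
    show "norm \<zeta> / R \<le> 1 * exp (- P 1)" using tR by (simp add: P_def)
  qed (use tR in auto)
  then obtain t where t: "0 \<le> t" "t \<le> 1" "t * exp (- P t) = norm \<zeta> / R" by auto
  have t1: "t < 1"
  proof (rule ccontr)
    assume "\<not> t < 1" then have "t = 1" using t by simp
    have "norm \<zeta> / R = t * exp (- P t)" using t(3) by simp
    also have "\<dots> = 1" using \<open>t = 1\<close> by (simp add: P_def)
    finally show False using tR by linarith
  qed
  have Pt: "P t \<le> 1 - t"
  proof -
    have "P t \<le> (\<Sum>k\<le>n. b k / s k * (1 - t))"
      unfolding P_def
    proof (rule sum_mono)
      fix k assume k: "k \<in> {..n}"
      then have "(1 - t) / (1 - t + s k) \<le> (1 - t) / s k"
        using s[of k] t1 by (intro divide_left_mono) auto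
      then show "b k * ((1 - t) / (1 - t + s k)) \<le> b k / s k * (1 - t)"
        using mult_left_mono[OF _ b0[of k]] k by fastforce
    qed
    also have "\<dots> = (\<Sum>k\<le>n. b k / s k) * (1 - t)" by (simp add: sum_distrib_right)
    also have "\<dots> \<le> 1 * (1 - t)" using dini t1 by (intro mult_right_mono) auto
    finally show ?thesis by simp
  qed
  have P0: "P t \<ge> 0" unfolding P_def using b0 s t1 by (intro sum_nonneg mult_nonneg_nonneg divide_nonneg_pos) (auto intro: add_pos_pos)
  have "t * (1 - P t) \<le> norm \<zeta> / R"
    unfolding t(3)[symmetric] using exp_ge_add_one_self[of "- P t"] t by (intro mult_left_mono) auto
  moreover have "t * P t \<le> P t" using t P0 by (simp add: mult_left_le_one_le)
  ultimately have tt: "1 - norm \<zeta> / R \<le> 2 * (1 - t)" using Pt by (simp add: algebra_simps)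
  have phit: "\<phi> (of_real t) = \<zeta>"
  proof -
    have "\<phi> (of_real t) = u * of_real (R * (t * exp (- P t)))"
      by (simp add: \<phi>_def pP flip: exp_of_real)
    also have "\<dots> = \<zeta>" using t(3) R u(2) by simp
    finally show ?thesis .
  qed
  have "ln (norm (h (\<phi> (of_real t)))) \<le> - ln (norm (g 0)) * ((1 + norm (complex_of_real t)) / (1 - norm (complex_of_real t)))"
    using t t1 by (intro division_disc[OF holg comp[OF h] g1 hg1 g0]) auto
  then have A: "ln (norm (h \<zeta>)) \<le> - ln (norm (g 0)) * ((1 + t) / (1 - t))"
    using t by (simp add: phit)
  have B: "(1 + t) / (1 - t) \<le> 4 / (1 - norm \<zeta> / R)"
  proof -
    have "(1 + t) / (1 - t) \<le> 2 / (1 - t)" using t t1 by (simp add: divide_right_mono)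
    also have "\<dots> = 4 / (2 * (1 - t))" using t1 by (simp add: field_simps)
    also have "\<dots> \<le> 4 / (1 - norm \<zeta> / R)" using tt t1 tR by (intro divide_left_mono) auto
    finally show ?thesis .
  qed
  have g0le: "- ln (norm (g 0)) \<ge> 0" using g1[of 0] g0 by simp
  have C: "- ln (norm (g 0)) \<le> kap + L (x (Suc n)) + 2 * (\<Sum>k\<le>n. L (x k) * s k) - ln (norm (f 0))"
  proof -
    have "ln (norm (g 0)) = ln (norm (f 0)) - Re (m 0)"
      using f0 by (simp add: g_def phi0 norm_mult ln_mult)
    moreover have "(\<Sum>k\<le>n. L (x k) * (1 - Re (barrier (s k) 0))) \<le> (\<Sum>k\<le>n. L (x k) * s k)"
    proof (intro sum_mono mult_left_mono)
      fix k assume k: "k \<in> {..n}"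
      have "barrier (s k) 0 = of_real (1 / (1 + s k))" using barrier_of_real[of "s k" 0] by simp
      then have "Re (barrier (s k) 0) = 1 / (1 + s k)" by simp
      moreover have "1 - 1 / (1 + s k) \<le> s k" using s[of k] k by (simp add: field_simps)
      ultimately show "1 - Re (barrier (s k) 0) \<le> s k" by simp
    qed (use Lx in auto)
    ultimately show ?thesis unfolding Rem by linarith
  qed
  have "- ln (norm (g 0)) * ((1 + t) / (1 - t)) \<le> - ln (norm (g 0)) * (4 / (1 - norm \<zeta> / R))"
    using B g0le by (intro mult_left_mono)
  also have "\<dots> \<le> (kap + L (x (Suc n)) + 2 * (\<Sum>k\<le>n. L (x k) * s k) - ln (norm (f 0))) * (4 / (1 - norm \<zeta> / R))"
    using C tR by (intro mult_right_mono) auto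
  finally show ?thesis using A by (simp add: R_def)
qed

text \<open>Bernoulli's inequality for the exponent \<open>a / b\<close>, in the variable \<open>x powr b\<close>.\<close>

lemma one_minus_powr_le:
  fixes x :: real
  assumes x: "0 < x" "x < 1" and ab: "0 < b" "b \<le> a"
  shows "1 - x powr a \<le> a / b * (1 - x powr b)"
proof -
  have "(x powr a) powr (b / a) * 1 powr (1 - b / a) \<le> b / a * x powr a + (1 - b / a) * 1"
    using assms by (intro Youngs_inequality_0) auto
  then have "x powr b \<le> b / a * x powr a + (1 - b / a)"
    using assms by (simp add: powr_powr)
  then have "b / a * (1 - x powr a) \<le> 1 - x powr b" by (simp add: algebra_simps)
  then have "a / b * (b / a * (1 - x powr a)) \<le> a / b * (1 - x powr b)"
    using ab by (intro mult_left_mono) auto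
  then show ?thesis using ab by simp
qed

lemma integral_ge_of_mono:
  fixes w :: "real \<Rightarrow> real"
  assumes "mono_on {a..b} w" "a \<le> b"
  shows "(b - a) * w a \<le> integral {a..b} w"
proof -
  have "integral {a..b} (\<lambda>_. w a) \<le> integral {a..b} w"
    using assms by (intro integral_le integrable_on_mono_on) (auto simp: mono_on_def)
  then show ?thesis using assms by simp
qed

lemma dyadic_bracket:
  fixes d :: real
  assumes "0 < d" "d \<le> 1 / 4"
  obtains n where "2 ^ Suc n * d \<le> 1 / 2" "1 / 2 < 2 ^ Suc (Suc n) * d"
proof -
  obtain m where "1 / 2 / d < 2 ^ m" using real_arch_pow[of 2 "1 / 2 / d"] by auto
  then have ex: "\<exists>m. 1 / 2 < 2 ^ m * d" using assms by (auto simp: field_simps)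
  define m where "m = (LEAST m. 1 / 2 < 2 ^ m * d)"
  have m: "1 / 2 < 2 ^ m * d" unfolding m_def using ex by (rule LeastI_ex)
  have le: "2 ^ k * d \<le> 1 / 2" if "k < m" for k
    using not_less_Least[of k "\<lambda>m. 1 / 2 < 2 ^ m * d"] that by (simp add: m_def)
  have "m \<noteq> 0" by (rule notI) (use m assms in simp)
  moreover have "m \<noteq> Suc 0" by (rule notI) (use m assms in simp)
  ultimately obtain n where "m = Suc (Suc n)" by (metis not0_implies_Suc)
  then show thesis using that m le[of "Suc n"] by auto
qed

text \<open>The point has modulus \<open>R powr (1 + e)\<close>, the map \<open>\<phi>\<close> has values in the disc of the intermediate radius
  \<open>x 0 = R powr (1 + e / 2)\<close>, and the remaining radii \<open>x k\<close> have dyadic distances to \<open>1\<close>. As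
  \<open>w\<close> is increasing, its integral \<open>J k\<close> over the interval that precedes \<open>x k\<close> towards \<open>1\<close> bounds
  \<open>L (x k)\<close>; for \<open>k = 0\<close> that interval is \<open>[x 0, R]\<close>, which costs the factor \<open>(1 + 2 / e)\<^sup>2\<close>.\<close>

lemma division_integral:
  fixes L :: "real \<Rightarrow> real"
  assumes f: "f holomorphic_on ball 0 1" and h: "h holomorphic_on ball 0 1"
    and fL: "\<And>z. z \<in> ball 0 1 \<Longrightarrow> norm (f z) \<le> exp (kap + L (norm z))"
    and hfL: "\<And>z. z \<in> ball 0 1 \<Longrightarrow> norm (h z * f z) \<le> exp (kap + L (norm z))"
    and f0: "f 0 \<noteq> 0"
    and Lmono: "\<And>s t. 0 \<le> s \<Longrightarrow> s \<le> t \<Longrightarrow> t < 1 \<Longrightarrow> L s \<le> L t"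
    and L0: "\<And>t. 0 \<le> t \<Longrightarrow> t < 1 \<Longrightarrow> 0 \<le> L t"
    and e: "e > 0" and R: "1 / 2 \<le> R" "R < 1" "1 - R powr (1 + e / 2) \<le> 1 / 4"
    and z: "norm \<zeta> = R powr (1 + e)"
    and I: "I = integral {0..R} (\<lambda>t. sqrt (L t / (1 - t)))"
  shows "ln (norm (h \<zeta>)) \<le>
    (kap + L (3 / 4) - ln (norm (f 0)) + 64 * (1 + 2 / e)\<^sup>2 * I * (I + 1)) * (4 / (1 - R powr (e / 2)))"
proof -
  define w where "w = (\<lambda>t. sqrt (L t / (1 - t)))"
  define d where "d = 1 - R powr (1 + e / 2)"
  define x where "x = (\<lambda>k::nat. 1 - 2 ^ k * d)"
  define y where "y = (\<lambda>k. case k of 0 \<Rightarrow> R | Suc j \<Rightarrow> x j)"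
  define c where "c = 4 * (1 + 2 / e)\<^sup>2"
  have yS[simp]: "y (Suc k) = x k" and y0[simp]: "y 0 = R" for k by (simp_all add: y_def)
  have wmono: "w s \<le> w t" if "0 \<le> s" "s \<le> t" "t < 1" for s t
    unfolding w_def using that Lmono[OF that] L0[of s] by (intro real_sqrt_le_mono frac_le) auto
  have wm: "mono_on {s..t} w" if "0 \<le> s" "t < 1" for s t
    using wmono that by (auto simp: mono_on_def)
  have w0: "0 \<le> w t" if "0 \<le> t" "t < 1" for t unfolding w_def using L0[OF that] that by simp
  have R0: "R > 0" using R by simp
  have w0R: "0 \<le> w t" if "0 \<le> t" "t \<le> R" for t using w0 that R by simp
  have d0: "0 < d" "d \<le> 1 / 4" using R R0 e powr01_less_one[of R "1 + e/2"] by (auto simp: d_def)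
  obtain n where n: "2 ^ Suc n * d \<le> 1 / 2" "1 / 2 < 2 ^ Suc (Suc n) * d"
    using dyadic_bracket[OF d0] by blast
  have le_half: "2 ^ k * d \<le> 1 / 2" if "k \<le> Suc n" for k
  proof -
    have "(2::real) ^ k * d \<le> 2 ^ Suc n * d" using that d0 by (intro mult_right_mono power_increasing) auto
    then show ?thesis using n by linarith
  qed
  have x: "1 / 2 \<le> x k \<and> x k < 1" if "k \<le> Suc n" for k
    using le_half[OF that] d0 by (simp add: x_def)
  have x0R: "x 0 = R powr (1 + e / 2)" by (simp add: x_def d_def)
  have Rx: "x 0 \<le> R" 
    unfolding x0R using R R0 e powr_mono'[of 1 "1 + e / 2" R] by simp
  have ydec: "y (Suc k) \<le> y k" for k
    using Rx d0 by (cases k) (auto simp: x_def)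
  have y: "0 \<le> y k \<and> y k < 1" if "k \<le> Suc (Suc n)" for k
    using x[of "k - 1"] R that by (cases k) auto
  have wint: "w integrable_on {s..t}" if "0 \<le> s" "t < 1" for s t
    using integrable_on_mono_on[OF wm[OF that]] .
  define J where "J = (\<lambda>k. integral {y (Suc k)..y k} w)"
  have J0: "J k \<ge> 0" if "k \<le> n" for k
    unfolding J_def using y[of "Suc k"] y[of k] that
    by (intro integral_nonneg wint w0) auto
  have sumJ: "(\<Sum>k\<le>m. J k) = integral {y (Suc m)..R} w" if "m \<le> n" for m
    using that
  proof (induction m)
    case 0 then show ?case by (simp add: J_def)
  next
    case (Suc m)
    have "y (Suc m) \<le> R" using Suc.prems ydec
      by (metis le0 lift_Suc_antimono_le y0)
    then have "integral {y (Suc (Suc m))..y (Suc m)} w + integral {y (Suc m)..R} w = integral {y (Suc (Suc m))..R} w"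
      using y[of "Suc (Suc m)"] Suc.prems R ydec[of "Suc m"]
      by (intro Henstock_Kurzweil_Integration.integral_combine wint) auto
    then show ?case using Suc by (simp add: J_def)
  qed
  have I0: "I \<ge> 0" unfolding I w_def[symmetric] using R by (intro integral_nonneg wint w0R) auto
  have sumJ_le: "(\<Sum>k\<le>n. J k) \<le> I"
    unfolding sumJ[OF order_refl] I w_def[symmetric]
    using y[of "Suc n"] R by (intro integral_subset_le wint ballI w0R) auto
  have e2: "R powr (e / 2) < 1" using R R0 e powr01_less_one[of R "e/2"] by auto
  have LJ: "L (x k) * (2 ^ k * d) \<le> c * (J k)\<^sup>2" if k: "k \<le> n" for k
  proof -
    have xk: "0 \<le> x k" "x k < 1" using x[of k] k by auto
    define l where "l = y k - x k"
    have l0: "l \<ge> 0" using ydec[of k] by (simp add: l_def)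
    have "l * w (x k) \<le> J k"
      unfolding J_def l_def using integral_ge_of_mono[OF wm] ydec[of k] y[of k] xk k by simp
    moreover have "w (x k) \<ge> 0" using w0 xk by auto
    ultimately have "(l * w (x k))\<^sup>2 \<le> (J k)\<^sup>2" using l0 by (intro power_mono) auto
    moreover have "(w (x k))\<^sup>2 = L (x k) / (2 ^ k * d)"
      unfolding w_def using L0[of "x k"] xk by (simp add: x_def)
    ultimately have 1: "l\<^sup>2 * L (x k) / (2 ^ k * d) \<le> (J k)\<^sup>2" by (simp add: power_mult_distrib)
    have 2: "(2 ^ k * d)\<^sup>2 \<le> c * l\<^sup>2"
    proof (cases k)
      case 0
      have eq: "l = R * (1 - R powr (e / 2))"
        using 0 R0 by (simp add: l_def x0R powr_add algebra_simps)
      have "d \<le> (1 + e / 2) / (e / 2) * (1 - R powr (e / 2))"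
        unfolding d_def using R R0 e by (intro one_minus_powr_le) auto
      also have "(1 + e / 2) / (e / 2) = 1 + 2 / e" using e by (simp add: field_simps)
      also have "(1 + 2 / e) * (1 - R powr (e / 2)) \<le> (1 + 2 / e) * (2 * l)"
        unfolding eq using e2 R e mult_right_mono[of "1/2" R "1 - R powr (e / 2)"]
        by (intro mult_left_mono) auto
      finally have "d\<^sup>2 \<le> ((1 + 2 / e) * (2 * l))\<^sup>2" using d0 by (intro power_mono) auto
      then show ?thesis using 0 by (simp add: c_def power_mult_distrib)
    next
      case (Suc j)
      have eq: "l = 2 ^ j * d" using Suc by (simp add: l_def x_def)
      have "1 \<le> (1 + 2 / e)\<^sup>2" using e by (intro one_le_power) auto
      then have "4 * l\<^sup>2 \<le> c * l\<^sup>2" unfolding c_def by (intro mult_right_mono) auto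
      then show ?thesis using Suc by (simp add: eq power_mult_distrib)
    qed
    have D: "2 ^ k * d > 0" using d0 by simp
    have "L (x k) * (2 ^ k * d) = L (x k) / (2 ^ k * d) * (2 ^ k * d)\<^sup>2"
      using D by (simp add: power2_eq_square)
    also have "\<dots> \<le> L (x k) / (2 ^ k * d) * (c * l\<^sup>2)"
      using L0[of "x k"] xk D by (intro mult_left_mono[OF 2] divide_nonneg_pos) auto
    also have "\<dots> = c * (l\<^sup>2 * L (x k) / (2 ^ k * d))" by simp
    also have "\<dots> \<le> c * (J k)\<^sup>2" by (intro mult_left_mono[OF 1]) (simp add: c_def)
    finally show ?thesis .
  qed
  \<comment> \<open>up to the summand that keeps \<open>a k\<close> positive, \<open>s k\<close> is proportional to \<open>2 ^ k * d / J k\<close>; then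
    \<open>b k / s k\<close> and \<open>L (x k) * s k\<close> are both controlled by \<open>J k\<close>, whose sum is at most \<open>I\<close>\<close>
  define a where "a = (\<lambda>k. J k + 2 ^ k * d)"
  define A where "A = 8 * (I + 1)"
  have A0: "A > 0" using I0 by (simp add: A_def)
  have a0: "a k > 0" if "k \<le> n" for k using J0[OF that] d0 by (simp add: a_def add_nonneg_pos)
  define s where "s = (\<lambda>k. A * (2 ^ k * d) / a k)"
  define b where "b = (\<lambda>k. 8 * (2 ^ k * d))"
  have suma: "(\<Sum>k\<le>n. a k) \<le> I + 1"
  proof -
    have "(\<Sum>k\<le>n. 2 ^ k * d) = (2 ^ Suc n - 1) * d"
      unfolding sum_distrib_right[symmetric] using sum_gp[of "2::real" 0 n]
      by (simp add: atLeast0AtMost)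
    also have "\<dots> \<le> 1" using n d0 by (simp add: algebra_simps)
    finally show ?thesis using sumJ_le by (simp add: a_def sum.distrib)
  qed
  have "ln (norm (h \<zeta>)) \<le>
    (kap + L (x (Suc n)) + 2 * (\<Sum>k\<le>n. L (x k) * s k) - ln (norm (f 0))) * (4 / (1 - norm \<zeta> / x 0))"
  proof (rule division_step[OF f h fL hfL f0 Lmono L0, where b = b])
    show "0 < x k \<and> x k < 1" if "k \<le> Suc n" for k using x[OF that] by auto
    show "s k > 0" if "k \<le> n" for k using a0[OF that] A0 d0 by (simp add: s_def)
    show "b k \<ge> 0" for k using d0 by (simp add: b_def)
    show "exp (- (b k / 2)) \<le> x (Suc k)" if "k \<le> n" for k
    proof -
      have "exp (- (b k / 2)) = exp (- (2 * (2 ^ Suc k * d)))" by (simp add: b_def)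
      also have "\<dots> \<le> 1 - 2 ^ Suc k * d"
        using le_half[of "Suc k"] that d0 by (intro exp_minus_le) auto
      finally show ?thesis by (simp add: x_def)
    qed
    have "(\<Sum>k\<le>n. b k / s k) = (\<Sum>k\<le>n. 8 / A * a k)"
      using a0 A0 d0 by (intro sum.cong) (auto simp: b_def s_def)
    also have "\<dots> = 8 / A * (\<Sum>k\<le>n. a k)" by (simp add: sum_distrib_left)
    also have "\<dots> \<le> 8 / A * (I + 1)" using A0 suma by (intro mult_left_mono) auto
    also have "\<dots> = 1" using I0 by (simp add: A_def)
    finally show "(\<Sum>k\<le>n. b k / s k) \<le> 1" .
    show "norm \<zeta> < x 0" unfolding z x0R using R R0 e by (intro powr_less_mono') auto
  qed auto
  also have "norm \<zeta> / x 0 = R powr (e / 2)"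
    unfolding z x0R using R0 by (simp flip: powr_diff)
  also have "(kap + L (x (Suc n)) + 2 * (\<Sum>k\<le>n. L (x k) * s k) - ln (norm (f 0))) * (4 / (1 - R powr (e / 2)))
    \<le> (kap + L (3 / 4) - ln (norm (f 0)) + 64 * (1 + 2 / e)\<^sup>2 * I * (I + 1)) * (4 / (1 - R powr (e / 2)))"
  proof (rule mult_right_mono)
    have "x (Suc n) \<le> 3 / 4" using n by (simp add: x_def)
    then have "L (x (Suc n)) \<le> L (3 / 4)" using x[of "Suc n"] by (intro Lmono) auto
    moreover have "(\<Sum>k\<le>n. L (x k) * s k) \<le> (\<Sum>k\<le>n. c * A * J k)"
    proof (rule sum_mono)
      fix k assume "k \<in> {..n}" then have k: "k \<le> n" by simp
      have "L (x k) * s k = A / a k * (L (x k) * (2 ^ k * d))" by (simp add: s_def)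
      also have "\<dots> \<le> A / a k * (c * (J k)\<^sup>2)"
        using A0 a0[OF k] by (intro mult_left_mono[OF LJ[OF k]]) auto
      also have "\<dots> = c * A * J k * (J k / a k)" by (simp add: power2_eq_square)
      also have "\<dots> \<le> c * A * J k * 1"
        using A0 J0[OF k] a0[OF k] d0 by (intro mult_left_mono) (auto simp: a_def c_def)
      finally show "L (x k) * s k \<le> c * A * J k" by simp
    qed
    moreover have "(\<Sum>k\<le>n. c * A * J k) = c * A * (\<Sum>k\<le>n. J k)" by (simp add: sum_distrib_left)
    moreover have "c * A * (\<Sum>k\<le>n. J k) \<le> c * A * I"
      using A0 sumJ_le by (intro mult_left_mono) (auto simp: c_def)
    moreover have "2 * (c * A * I) = 64 * (1 + 2 / e)\<^sup>2 * I * (I + 1)" by (simp add: c_def A_def)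
    ultimately show "kap + L (x (Suc n)) + 2 * (\<Sum>k\<le>n. L (x k) * s k) - ln (norm (f 0))
       \<le> kap + L (3 / 4) - ln (norm (f 0)) + 64 * (1 + 2 / e)\<^sup>2 * I * (I + 1)" by linarith
  qed (use e2 in auto)
  finally show ?thesis .
qed

section \<open>Seminormed spaces and powers of operators\<close>

text \<open>A subspace \<open>E\<close> of a complex vector space with a seminorm \<open>p\<close> on \<open>E\<close>. A seminorm, rather than a norm,
  allows computations in a quotient space to be carried out on representatives.\<close>

locale seminormed_subspace = vector_space scale
  for scale :: "complex \<Rightarrow> 'b \<Rightarrow> 'b::ab_group_add" (infixr "*s" 75) +
  fixes E :: "'b set" and p :: "'b \<Rightarrow> real"
  assumes subspace_E: "subspace E"
    and p_nonneg: "f \<in> E \<Longrightarrow> 0 \<le> p f"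
    and p_scale: "f \<in> E \<Longrightarrow> p (c *s f) = cmod c * p f"
    and p_triangle: "f \<in> E \<Longrightarrow> g \<in> E \<Longrightarrow> p (f + g) \<le> p f + p g"
begin

lemma mem_zero[simp]: "0 \<in> E" and mem_add[simp]: "f \<in> E \<Longrightarrow> g \<in> E \<Longrightarrow> f + g \<in> E"
  and mem_scale[simp]: "f \<in> E \<Longrightarrow> c *s f \<in> E" and mem_diff[simp]: "f \<in> E \<Longrightarrow> g \<in> E \<Longrightarrow> f - g \<in> E"
  and mem_minus[simp]: "f \<in> E \<Longrightarrow> - f \<in> E"
  and mem_sum: "(\<And>i. i \<in> S \<Longrightarrow> F i \<in> E) \<Longrightarrow> (\<Sum>i\<in>S. F i) \<in> E"
  using subspace_E by (auto simp: subspace_0 subspace_add subspace_scale subspace_diff subspace_neg intro: subspace_sum)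

lemma p_zero[simp]: "p 0 = 0"
  using p_scale[of 0 0] by simp

lemma p_minus: "f \<in> E \<Longrightarrow> p (- f) = p f"
  using p_scale[of f "-1"] by simp

lemma p_diff: "f \<in> E \<Longrightarrow> g \<in> E \<Longrightarrow> p (f - g) \<le> p f + p g"
  using p_triangle[of f "- g"] p_minus[of g] by simp

lemma p_sum: "(\<And>i. i \<in> S \<Longrightarrow> F i \<in> E) \<Longrightarrow> p (\<Sum>i\<in>S. F i) \<le> (\<Sum>i\<in>S. p (F i))"
proof (induction S rule: infinite_finite_induct)
  case (insert x S)
  then show ?case using p_triangle[of "F x" "sum F S"] mem_sum[of S F] by force
qed auto

lemma p_eq_of_null: 
  assumes "f \<in> E" "g \<in> E" "p (f - g) = 0" shows "p f = p g"
proof (rule antisym)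
  show "p f \<le> p g" using p_triangle[of "f - g" g] assms by simp
  show "p g \<le> p f" using p_diff[of f "f - g"] assms by simp
qed

text \<open>Real sublinear functionals on \<open>E\<close>.\<close>

definition sublinear :: "('b \<Rightarrow> real) \<Rightarrow> bool" where
  "sublinear q \<longleftrightarrow> (\<forall>f\<in>E. \<forall>g\<in>E. q (f + g) \<le> q f + q g) \<and>
     (\<forall>f\<in>E. \<forall>t\<ge>0. q (of_real t *s f) = t * q f)"

text \<open>The largest sublinear functional below \<open>q\<close> that is linear on the line through \<open>x\<close> with the value \<open>q x\<close>
  at \<open>x\<close>.\<close>

definition lower_at :: "'b \<Rightarrow> ('b \<Rightarrow> real) \<Rightarrow> 'b \<Rightarrow> real" where
  "lower_at x q = (\<lambda>y. INF t\<in>{0..}. q (y + of_real t *s x) - t * q x)"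

lemma sublinearD:
  assumes "sublinear q"
  shows "f \<in> E \<Longrightarrow> g \<in> E \<Longrightarrow> q (f + g) \<le> q f + q g"
    and "f \<in> E \<Longrightarrow> t \<ge> 0 \<Longrightarrow> q (of_real t *s f) = t * q f"
    and "q 0 = 0" and "f \<in> E \<Longrightarrow> - q (- f) \<le> q f"
proof -
  show 1: "f \<in> E \<Longrightarrow> g \<in> E \<Longrightarrow> q (f + g) \<le> q f + q g" for f g
    using assms by (auto simp: sublinear_def)
  show "f \<in> E \<Longrightarrow> t \<ge> 0 \<Longrightarrow> q (of_real t *s f) = t * q f" for f t
    using assms by (auto simp: sublinear_def)
  from this[of 0 0] show "q 0 = 0" by simp
  then show "f \<in> E \<Longrightarrow> - q (- f) \<le> q f" using 1[of f "- f"] by simp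
qed

lemma sublinear_lower_at:
  assumes q: "sublinear q" and x: "x \<in> E"
  shows "sublinear (lower_at x q)"
    and "y \<in> E \<Longrightarrow> lower_at x q y \<le> q y"
    and "lower_at x q (- x) \<le> - q x"
proof -
  let ?F = "\<lambda>y t. q (y + of_real t *s x) - t * q x"
  have lb: "- q (- y) \<le> ?F y t" if "y \<in> E" "t \<ge> 0" for y t
    using sublinearD(1)[OF q, of "y + of_real t *s x" "- y"] sublinearD(2)[OF q x that(2)] that x by simp
  have bdd: "bdd_below (?F y ` {0..})" if "y \<in> E" for y
    using lb[OF that] by (intro bdd_belowI2[of _ "- q (- y)"]) auto
  have le: "lower_at x q y \<le> ?F y t" if "y \<in> E" "t \<ge> 0" for y t
    unfolding lower_at_def using that by (intro cINF_lower bdd) auto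
  have ge: "c \<le> lower_at x q y" if "\<And>t. t \<ge> 0 \<Longrightarrow> c \<le> ?F y t" for c y
    unfolding lower_at_def using that by (intro cINF_greatest) auto
  show "lower_at x q y \<le> q y" if "y \<in> E" using le[OF that, of 0] by simp
  show "lower_at x q (- x) \<le> - q x"
    using le[of "- x" 1] x sublinearD(3)[OF q] by simp
  have hom: "lower_at x q (of_real s *s y) \<le> s * lower_at x q y" if "y \<in> E" "s > 0" for s y
  proof -
    have "lower_at x q (of_real s *s y) / s \<le> lower_at x q y"
    proof (rule ge)
      fix t :: real assume t: "t \<ge> 0"
      have "lower_at x q (of_real s *s y) \<le> ?F (of_real s *s y) (s * t)"
        using that t by (intro le) auto
      also have "of_real s *s y + of_real (s * t) *s x = of_real s *s (y + of_real t *s x)"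
        by (simp add: scale_right_distrib)
      also have "q \<dots> = s * q (y + of_real t *s x)"
        using that x by (intro sublinearD(2)[OF q]) auto
      finally show "lower_at x q (of_real s *s y) / s \<le> ?F y t"
        using that by (simp add: divide_simps algebra_simps)
    qed
    then show ?thesis using that by (simp add: divide_simps mult.commute)
  qed
  show "sublinear (lower_at x q)" unfolding sublinear_def
  proof (intro conjI ballI allI impI)
    fix f g assume fg: "f \<in> E" "g \<in> E"
    have "lower_at x q (f + g) - lower_at x q f \<le> lower_at x q g"
    proof (rule ge)
      fix t :: real assume t: "t \<ge> 0"
      have "lower_at x q (f + g) - ?F g t \<le> lower_at x q f"
      proof (rule ge)
        fix s :: real assume s: "s \<ge> 0"
        have "lower_at x q (f + g) \<le> ?F (f + g) (s + t)"
          using fg s t by (intro le) auto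
        moreover have "f + g + of_real (s + t) *s x = (f + of_real s *s x) + (g + of_real t *s x)"
          by (simp add: scale_left_distrib)
        moreover have "q ((f + of_real s *s x) + (g + of_real t *s x)) \<le> q (f + of_real s *s x) + q (g + of_real t *s x)"
          using fg x by (intro sublinearD(1)[OF q]) auto
        ultimately show "lower_at x q (f + g) - ?F g t \<le> ?F f s"
          by (simp add: algebra_simps)
      qed
      then show "lower_at x q (f + g) - lower_at x q f \<le> ?F g t" by simp
    qed
    then show "lower_at x q (f + g) \<le> lower_at x q f + lower_at x q g" by simp
  next
    fix f and t :: real assume f: "f \<in> E" and t: "0 \<le> t"
    show "lower_at x q (of_real t *s f) = t * lower_at x q f"
    proof (cases "t = 0")
      case True
      have "lower_at x q 0 = 0"
      proof (rule antisym)
        show "lower_at x q 0 \<le> 0" using le[of 0 0] sublinearD(3)[OF q] by simp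
        show "0 \<le> lower_at x q 0" using x sublinearD(2)[OF q x] by (intro ge) simp
      qed
      then show ?thesis using True by simp
    next
      case False
      then have t: "t > 0" using t by simp
      have "lower_at x q (of_real (1 / t) *s (of_real t *s f)) \<le> 1 / t * lower_at x q (of_real t *s f)"
        using f t by (intro hom) auto
      then have "lower_at x q f \<le> 1 / t * lower_at x q (of_real t *s f)" using t by simp
      then show ?thesis using hom[OF f t] t by (simp add: divide_simps mult.commute)
    qed
  qed
qed

lemma sublinear_sum:
  assumes q: "sublinear q"
  shows "(\<And>i. i < k \<Longrightarrow> F i \<in> E) \<Longrightarrow> q (\<Sum>i<k. F i) \<le> (\<Sum>i<(k::nat). q (F i))"
proof (induction k)
  case 0 then show ?case using sublinearD(3)[OF q] by simp
next
  case (Suc k)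
  then show ?case using sublinearD(1)[OF q, of "sum F {..<k}" "F k"] mem_sum[of "{..<k}" F] by force
qed

text \<open>The real Hahn-Banach theorem on the span of a sequence, with the functional given by its values \<open>d\<close>.
  Lowering \<open>p\<close> successively at \<open>x 0\<close>, \<open>x 1\<close>, and so on makes it linear on longer and longer
  initial segments.\<close>

lemma Hahn_Banach_real_sequence:
  fixes x :: "nat \<Rightarrow> 'b"
  assumes x: "\<And>k. x k \<in> E"
  obtains d where "d 0 = p (x 0)"
    "\<And>k t. (\<Sum>i<k. t i * d i) \<le> p (\<Sum>i<k. of_real (t i) *s x i)"
proof -
  define q where "q = rec_nat p (\<lambda>k. lower_at (x k))"
  have q0: "q 0 = p" and qS: "q (Suc k) = lower_at (x k) (q k)" for k by (simp_all add: q_def)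
  have sub: "sublinear (q k)" for k
  proof (induction k)
    case 0
    show ?case unfolding q0 sublinear_def by (auto simp: p_triangle p_scale)
  next
    case (Suc k) then show ?case unfolding qS by (rule sublinear_lower_at(1)[OF _ x])
  qed
  have dec: "q (Suc k) y \<le> q k y" if "y \<in> E" for k y
    unfolding qS by (rule sublinear_lower_at(2)[OF sub x that])
  have dec2: "q k y \<le> q i y" if "y \<in> E" "i \<le> k" for i k y
    using that(2) by (induction k rule: dec_induct) (use dec[OF that(1)] in \<open>auto intro: order_trans\<close>)
  define d where "d = (\<lambda>i. q i (x i))"
  have neg: "q k (- x i) \<le> - d i" if "i < k" for i k
    using dec2[of "- x i" "Suc i" k] sublinear_lower_at(3)[OF sub x, of i i] that x by (simp add: d_def qS)
  have pos: "q k (x i) \<le> d i" if "i < k" for i k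
    using dec2[OF x, of i k] that by (simp add: d_def)
  show thesis
  proof (rule that[of d])
    show "d 0 = p (x 0)" by (simp add: d_def q0)
    fix k :: nat and t
    let ?y = "\<Sum>i<k. of_real (t i) *s x i"
    have y: "?y \<in> E" using x by (intro mem_sum) auto
    have "q k (- ?y) = q k (\<Sum>i<k. of_real (- t i) *s x i)" by (simp add: sum_negf)
    also have "\<dots> \<le> (\<Sum>i<k. q k (of_real (- t i) *s x i))" using x by (intro sublinear_sum sub) auto
    also have "\<dots> \<le> (\<Sum>i<k. - (t i * d i))"
    proof (rule sum_mono)
      fix i assume i: "i \<in> {..<k}"
      show "q k (of_real (- t i) *s x i) \<le> - (t i * d i)"
      proof (cases "t i \<ge> 0")
        case True
        have "q k (of_real (t i) *s (- x i)) = t i * q k (- x i)"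
          using True x by (intro sublinearD(2)[OF sub]) auto
        then show ?thesis using mult_left_mono[OF neg[of i k] True] i by simp
      next
        case False
        then have "q k (of_real (- t i) *s x i) = - t i * q k (x i)"
          using x by (intro sublinearD(2)[OF sub]) auto
        then show ?thesis using mult_left_mono[OF pos[of i k], of "- t i"] i False by simp
      qed
    qed
    finally have "(\<Sum>i<k. t i * d i) \<le> - q k (- ?y)" by (simp add: sum_negf)
    also have "\<dots> \<le> q k ?y" by (rule sublinearD(4)[OF sub y])
    also have "\<dots> \<le> p ?y" using dec2[OF y, of 0 k] by (simp add: q0)
    finally show "(\<Sum>i<k. t i * d i) \<le> p ?y" .
  qed
qed

text \<open>A complex functional on the span of \<open>X\<close> and the \<open>A n\<close>, dominated by \<open>p\<close> and equal to \<open>p X\<close> at \<open>X\<close>.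
  Only real multiples of \<open>X\<close> are needed. The real theorem is used for the sequence
  \<open>X, A 0, \<i> A 0, A 1, \<i> A 1, \<dots>\<close>.\<close>

lemma Hahn_Banach_sequence:
  assumes X: "X \<in> E" and A: "\<And>n. A n \<in> E"
  obtains c where
    "\<And>k z t. Re (\<Sum>n<k. z n * c n) + t * p X \<le> p ((\<Sum>n<(k::nat). z n *s A n) + of_real t *s X)"
proof -
  define x where "x = (\<lambda>i. if i = 0 then X else if odd i then A (i div 2) else \<i> *s A (i div 2 - 1))"
  have xE: "x i \<in> E" for i using X A by (simp add: x_def)
  obtain d where d: "d 0 = p (x 0)"
    "\<And>k t. (\<Sum>i<k. t i * d i) \<le> p (\<Sum>i<k. of_real (t i) *s x i)"
    using Hahn_Banach_real_sequence[of x] xE by blast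
  define c where "c = (\<lambda>n. Complex (d (2 * n + 1)) (- d (2 * n + 2)))"
  show thesis
  proof (rule that[of c])
    fix k :: nat and z :: "nat \<Rightarrow> complex" and t :: real
    define T where "T = (\<lambda>i. if i = 0 then t else if odd i then Re (z (i div 2)) else Im (z (i div 2 - 1)))"
    have 1: "(\<Sum>i<2 * m + 1. T i * d i) = Re (\<Sum>n<m. z n * c n) + t * p X" for m
    proof (induction m)
      case 0 then show ?case by (simp add: T_def d x_def)
    next
      case (Suc m)
      have "(\<Sum>i<2 * Suc m + 1. T i * d i) = (\<Sum>i<2 * m + 1. T i * d i)
          + (T (2 * m + 1) * d (2 * m + 1) + T (2 * m + 2) * d (2 * m + 2))" by simp
      also have "T (2 * m + 1) * d (2 * m + 1) + T (2 * m + 2) * d (2 * m + 2) = Re (z m * c m)"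
        by (simp add: T_def c_def)
      finally show ?case using Suc by (simp add: algebra_simps)
    qed
    have 2: "(\<Sum>i<2 * m + 1. of_real (T i) *s x i) = (\<Sum>n<m. z n *s A n) + of_real t *s X" for m
    proof (induction m)
      case 0 then show ?case by (simp add: T_def x_def)
    next
      case (Suc m)
      have "(\<Sum>i<2 * Suc m + 1. of_real (T i) *s x i) = (\<Sum>i<2 * m + 1. of_real (T i) *s x i)
          + (of_real (T (2 * m + 1)) *s x (2 * m + 1) + of_real (T (2 * m + 2)) *s x (2 * m + 2))"
        by (simp add: add.assoc)
      also have "of_real (T (2 * m + 1)) *s x (2 * m + 1) + of_real (T (2 * m + 2)) *s x (2 * m + 2)
         = (of_real (Re (z m)) + of_real (Im (z m)) * \<i>) *s A m"
        by (simp add: T_def x_def scale_left_distrib)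
      also have "of_real (Re (z m)) + of_real (Im (z m)) * \<i> = z m" by (simp add: complex_eq_iff)
      finally show ?case using Suc by (simp add: algebra_simps)
    qed
    show "Re (\<Sum>n<k. z n * c n) + t * p X \<le> p ((\<Sum>n<k. z n *s A n) + of_real t *s X)"
      using d(2)[of T "2 * k + 1"] unfolding 1 2 .
  qed
qed

end

text \<open>A linear operator on \<open>E\<close> with \<open>p (A f) \<le> K * p f\<close>; the constant \<open>K\<close> need not be nonnegative.\<close>

locale seminormed_operator = seminormed_subspace scale E p
  for scale :: "complex \<Rightarrow> 'b \<Rightarrow> 'b::ab_group_add" (infixr "*s" 75) and E p +
  fixes A :: "'b \<Rightarrow> 'b" and K :: real
  assumes A_mem[simp]: "f \<in> E \<Longrightarrow> A f \<in> E"
    and A_add: "f \<in> E \<Longrightarrow> g \<in> E \<Longrightarrow> A (f + g) = A f + A g"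
    and A_scale: "f \<in> E \<Longrightarrow> A (c *s f) = c *s A f"
    and A_bound: "f \<in> E \<Longrightarrow> p (A f) \<le> K * p f"
begin

lemma A_zero: "A 0 = 0" using A_scale[of 0 0] by simp

lemma A_minus: "f \<in> E \<Longrightarrow> A (- f) = - A f"
  using A_scale[of f "-1"] by simp

lemma A_diff: "f \<in> E \<Longrightarrow> g \<in> E \<Longrightarrow> A (f - g) = A f - A g"
  using A_add[of f "- g"] by (simp add: A_minus)

lemma A_pow_mem[simp]: "f \<in> E \<Longrightarrow> (A ^^ k) f \<in> E"
  by (induction k) auto

lemma A_pow_add: "f \<in> E \<Longrightarrow> g \<in> E \<Longrightarrow> (A ^^ k) (f + g) = (A ^^ k) f + (A ^^ k) g"
  by (induction k) (auto simp: A_add)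

lemma A_pow_diff: "f \<in> E \<Longrightarrow> g \<in> E \<Longrightarrow> (A ^^ k) (f - g) = (A ^^ k) f - (A ^^ k) g"
  by (induction k) (auto simp: A_diff)

lemma A_pow_scale: "f \<in> E \<Longrightarrow> (A ^^ k) (c *s f) = c *s (A ^^ k) f"
  by (induction k) (auto simp: A_scale)

lemma A_pow_zero: "(A ^^ k) 0 = 0"
  by (induction k) (auto simp: A_zero)

lemma A_sum: "(\<And>i. i \<in> S \<Longrightarrow> F i \<in> E) \<Longrightarrow> A (\<Sum>i\<in>S. F i) = (\<Sum>i\<in>S. A (F i))"
  by (induction S rule: infinite_finite_induct) (auto simp: A_zero A_add mem_sum)

lemma A_pow_sum: "(\<And>i. i \<in> S \<Longrightarrow> F i \<in> E) \<Longrightarrow> (A ^^ k) (\<Sum>i\<in>S. F i) = (\<Sum>i\<in>S. (A ^^ k) (F i))"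
  by (induction S rule: infinite_finite_induct) (auto simp: A_pow_zero A_pow_add mem_sum)

lemma A_pow_bound: 
  assumes "f \<in> E" shows "p ((A ^^ k) f) \<le> max K 0 ^ k * p f"
proof (induction k)
  case (Suc k)
  have "p ((A ^^ Suc k) f) \<le> K * p ((A ^^ k) f)" using A_bound assms by simp
  also have "\<dots> \<le> max K 0 * p ((A ^^ k) f)" using assms by (intro mult_right_mono p_nonneg) auto
  also have "\<dots> \<le> max K 0 * (max K 0 ^ k * p f)" by (intro mult_left_mono Suc) auto
  finally show ?case by (simp add: mult.assoc)
qed simp

lemma geometric_telescope:
  assumes y: "y \<in> E"
  shows "(\<Sum>i<k. a ^ i *s (A ^^ i) y) - a *s A (\<Sum>i<k. a ^ i *s (A ^^ i) y) = y - a ^ k *s (A ^^ k) y"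
proof -
  have "a *s A (\<Sum>i<k. a ^ i *s (A ^^ i) y) = (\<Sum>i<k. a ^ Suc i *s (A ^^ Suc i) y)"
    using y by (subst A_sum) (simp_all add: A_scale scale_sum_right)
  then show ?thesis
    using sum_lessThan_telescope'[of "\<lambda>i. a ^ i *s (A ^^ i) y" k]
    by (simp add: sum_subtractf del: power_Suc funpow.simps)
qed

lemma geometric_telescope':
  assumes y: "y \<in> E"
  shows "(\<Sum>i<k. a ^ i *s (A ^^ i) (y - a *s A y)) = y - a ^ k *s (A ^^ k) y"
proof -
  have "a ^ i *s (A ^^ i) (y - a *s A y) = a ^ i *s (A ^^ i) y - a ^ Suc i *s (A ^^ Suc i) y" for i
    using y by (simp add: A_pow_diff A_pow_scale scale_right_diff_distrib funpow_swap1 mult.commute)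
  then show ?thesis
    using sum_lessThan_telescope'[of "\<lambda>i. a ^ i *s (A ^^ i) y" k]
    by (simp del: power_Suc funpow.simps)
qed

lemma sum_root_of_unity_powers:
  assumes "0 < i" "i < k"
  shows "(\<Sum>j<k. cis (2 * pi * real j / real k) ^ i) = 0"
proof -
  define q where "q = cis (2 * pi * real i / real k)"
  have "q \<noteq> 1"
  proof
    assume "q = 1"
    then have "cis (2 * pi * real i / real k) = cis (2 * pi * real 0 / real k)" by (simp add: q_def)
    moreover have "inj_on (\<lambda>j. cis (2 * pi * real j / real k)) {..<k}"
      using Complex.bij_betw_roots_unity[of k] assms by (simp add: bij_betw_def)
    moreover have "i \<in> {..<k}" "0 \<in> {..<k}" using assms by auto
    ultimately have "i = 0" unfolding inj_on_def by blast
    then show False using assms by simp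
  qed
  moreover have "q ^ k = 1"
  proof -
    have "q ^ k = cis (real k * (2 * pi * real i / real k))" unfolding q_def by (rule Complex.DeMoivre)
    also have "real k * (2 * pi * real i / real k) = 2 * pi * real i" using assms by simp
    also have "cis (2 * pi * real i) = 1" by (rule cis_multiple_2pi) simp
    finally show ?thesis .
  qed
  moreover have "cis (2 * pi * real j / real k) ^ i = q ^ j" for j
    unfolding q_def Complex.DeMoivre by (simp add: mult.commute mult.left_commute del: cis_mult)
  ultimately show ?thesis by (simp add: sum_gp_strict)
qed

lemma root_of_unity_average:
  assumes y: "y \<in> E" and k: "k > 0"
  shows "(\<Sum>j<k. \<Sum>i<k. (a * cis (2 * pi * real j / real k)) ^ i *s (A ^^ i) y) = of_nat k *s y"
proof -
  have "(\<Sum>j<k. \<Sum>i<k. (a * cis (2 * pi * real j / real k)) ^ i *s (A ^^ i) y)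
     = (\<Sum>i<k. (a ^ i * (\<Sum>j<k. cis (2 * pi * real j / real k) ^ i)) *s (A ^^ i) y)"
    by (subst sum.swap) (simp add: power_mult_distrib scale_sum_left sum_distrib_left)
  also have "\<dots> = (\<Sum>i<k. if i = 0 then of_nat k *s y else 0)"
    using sum_root_of_unity_powers by (intro sum.cong) auto
  also have "\<dots> = of_nat k *s y" using k by simp
  finally show ?thesis .
qed

text \<open>The operator \<open>1 - a A\<close> is bounded below by \<open>1 / C\<close> (for \<open>C > 0\<close>).\<close>

definition resolvent_bound :: "real \<Rightarrow> complex \<Rightarrow> bool" where
  "resolvent_bound C a \<longleftrightarrow> (\<forall>y\<in>E. p y \<le> C * p (y - a *s A y))"

lemma resolvent_bound_local:
  assumes C: "resolvent_bound C a"
  obtains r where "r > 0" "\<And>b. dist a b < r \<Longrightarrow> resolvent_bound (2 * max C 1) b"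
proof -
  define D where "D = max C 1"
  define r where "r = 1 / (2 * D * max K 1)"
  have D: "D > 0" "max K 1 > 0" by (simp_all add: D_def)
  show thesis
  proof (rule that[of r])
    show "r > 0" using D by (simp add: r_def)
    fix b assume b: "dist a b < r"
    show "resolvent_bound (2 * max C 1) b"
      unfolding resolvent_bound_def
    proof
      fix y assume y: "y \<in> E"
      have "p y \<le> C * p (y - a *s A y)" using C y by (simp add: resolvent_bound_def)
      also have "\<dots> \<le> D * p (y - a *s A y)"
        using y by (intro mult_right_mono p_nonneg) (auto simp: D_def)
      also have "y - a *s A y = (y - b *s A y) + (b - a) *s A y"
        by (simp add: scale_left_diff_distrib)
      also have "D * p ((y - b *s A y) + (b - a) *s A y) \<le> D * (p (y - b *s A y) + p ((b - a) *s A y))"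
        using y D by (intro mult_left_mono p_triangle) auto
      also have "p ((b - a) *s A y) \<le> r * (max K 1 * p y)"
      proof -
        have "p (A y) \<le> max K 1 * p y"
          using A_bound[OF y] p_nonneg[OF y] mult_right_mono[of K "max K 1" "p y"] by linarith
        then show ?thesis
          using b y p_nonneg[of "A y"] mult_mono[of "cmod (a - b)" r "p (A y)" "max K 1 * p y"] D
          by (simp add: p_scale dist_norm norm_minus_commute r_def)
      qed
      also have "D * (p (y - b *s A y) + r * (max K 1 * p y)) = D * p (y - b *s A y) + p y / 2"
        using D by (simp add: r_def field_simps)
      finally show "p y \<le> 2 * max C 1 * p (y - b *s A y)" using D by (simp add: D_def)
    qed
  qed
qed

lemma resolvent_bound_mono:
  assumes "resolvent_bound C a" "C \<le> D" shows "resolvent_bound D a"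
  unfolding resolvent_bound_def
proof
  fix y assume y: "y \<in> E"
  then have "p y \<le> C * p (y - a *s A y)" using assms by (simp add: resolvent_bound_def)
  also have "\<dots> \<le> D * p (y - a *s A y)" using y assms by (intro mult_right_mono p_nonneg) auto
  finally show "p y \<le> D * p (y - a *s A y)" .
qed

lemma resolvent_bound_uniform:
  assumes res: "\<And>a. cmod a < 1 \<Longrightarrow> \<exists>C. resolvent_bound C a" and r: "r < 1"
  obtains C where "C > 0" "\<And>a. cmod a \<le> r \<Longrightarrow> resolvent_bound C a"
proof -
  have "\<exists>s>0. \<exists>C. \<forall>b. dist a b < s \<longrightarrow> resolvent_bound C b" if "a \<in> cball 0 r" for a
    using res[of a] r that resolvent_bound_local[of _ a] by (metis dist_0_norm mem_cball order_le_less_trans)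
  then obtain s C where sC: "\<And>a. a \<in> cball 0 r \<Longrightarrow> s a > 0 \<and> (\<forall>b. dist a b < s a \<longrightarrow> resolvent_bound (C a) b)"
    by metis
  have "compact (cball (0::complex) r)" by simp
  moreover have "\<And>a. a \<in> cball 0 r \<Longrightarrow> open (ball a (s a))" by simp
  moreover have "cball 0 r \<subseteq> (\<Union>a\<in>cball 0 r. ball a (s a))" using sC by force
  ultimately obtain D where D: "D \<subseteq> cball 0 r" "finite D" "cball 0 r \<subseteq> (\<Union>a\<in>D. ball a (s a))"
    by (rule compactE_image)
  show thesis
  proof (rule that[of "Max (insert 1 (C ` D))"])
    show "Max (insert 1 (C ` D)) > 0"
      using D Max_ge[of "insert 1 (C ` D)" 1] by (intro less_le_trans[OF zero_less_one]) auto
    fix a assume "cmod a \<le> r"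
    then obtain b where b: "b \<in> D" "a \<in> ball b (s b)" using D by force
    then have "resolvent_bound (C b) a" using sC[of b] D by auto
    then show "resolvent_bound (Max (insert 1 (C ` D))) a"
      using b D by (intro resolvent_bound_mono[OF _ Max_ge]) auto
  qed
qed

text \<open>The key step of Rickart's argument. Put \<open>h = f - s^k A^k f\<close>. Over the \<open>k\<close>-th roots of unity \<open>w\<close>, the
  solutions of \<open>y - s w A y = h\<close> average to \<open>f\<close>, and the solutions of \<open>y' - t w A y' = h\<close> average
  to a \<open>g\<close> that is close to \<open>h\<close> if \<open>t^k A^k\<close> is small. As \<open>y\<close> and \<open>y'\<close> differ by a
  multiple of \<open>\<bar>s - t\<bar>\<close>, so do \<open>f\<close> and \<open>g\<close>. The equations for \<open>y'\<close> hold up to elements of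
  seminorm zero.\<close>

lemma power_comparison:
  assumes C: "C > 0" "\<And>a. cmod a \<le> r \<Longrightarrow> resolvent_bound C a"
    and surj: "\<And>a h. cmod a \<le> r \<Longrightarrow> h \<in> E \<Longrightarrow> \<exists>y\<in>E. p (y - a *s A y - h) = 0"
    and s: "0 \<le> s" "s \<le> r" and t: "0 \<le> t" "t \<le> r" and k: "k > 0" and e: "e \<ge> 0"
    and small: "\<And>f. f \<in> E \<Longrightarrow> t ^ k * p ((A ^^ k) f) \<le> e * p f"
    and f: "f \<in> E"
  defines "h \<equiv> f - of_real s ^ k *s (A ^^ k) f"
  shows "p (f - h) \<le> (C\<^sup>2 * max K 0 * \<bar>s - t\<bar> + e * C) * p h"
proof -
  define w where "w = (\<lambda>j. cis (2 * pi * real j / real k))"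
  define G where "G = (\<lambda>a y. \<Sum>i<k. a ^ i *s (A ^^ i) y)"
  have GE[simp]: "G a y \<in> E" if "y \<in> E" for a y unfolding G_def using that by (intro mem_sum) auto
  have wk: "w j ^ k = 1" for j
  proof -
    have "w j ^ k = cis (real k * (2 * pi * real j / real k))" unfolding w_def by (rule Complex.DeMoivre)
    also have "real k * (2 * pi * real j / real k) = 2 * pi * real j" using k by simp
    also have "cis (2 * pi * real j) = 1" by (rule cis_multiple_2pi) simp
    finally show ?thesis .
  qed
  have nw: "cmod (w j) = 1" for j by (simp add: w_def)
  have hE[simp]: "h \<in> E" using f by (simp add: h_def)
  define y where "y = (\<lambda>j. G (of_real s * w j) f)"
  have yE[simp]: "y j \<in> E" for j using f by (simp add: y_def)
  have y: "y j - (of_real s * w j) *s A (y j) = h" for j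
    unfolding y_def G_def using geometric_telescope[OF f, where k = k and a = "of_real s * w j"]
    by (simp add: power_mult_distrib wk h_def)
  have sumy: "(\<Sum>j<k. y j) = of_nat k *s f"
    unfolding y_def G_def w_def by (rule root_of_unity_average[OF f k])
  have "\<exists>y\<in>E. p (y - (of_real t * w j) *s A y - h) = 0" for j
    using t by (intro surj) (auto simp: norm_mult nw)
  then obtain y' where y'E[simp]: "\<And>j. y' j \<in> E"
    and y': "\<And>j. p (y' j - (of_real t * w j) *s A (y' j) - h) = 0" by metis
  have py': "p (y' j) \<le> C * p h" for j
  proof -
    have "p (y' j) \<le> C * p (y' j - (of_real t * w j) *s A (y' j))"
      using C(2)[of "of_real t * w j"] t by (simp add: resolvent_bound_def norm_mult nw)
    also have "p (y' j - (of_real t * w j) *s A (y' j)) = p h"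
      using y' by (intro p_eq_of_null) auto
    finally show ?thesis .
  qed
  have diff: "p (y j - y' j) \<le> C * (max K 0 * \<bar>s - t\<bar> * (C * p h))" for j
  proof -
    let ?d = "y j - y' j"
    have "p ?d \<le> C * p (?d - (of_real s * w j) *s A ?d)"
      using C(2)[of "of_real s * w j"] s by (simp add: resolvent_bound_def norm_mult nw)
    also have "?d - (of_real s * w j) *s A ?d
      = (of_real (s - t) * w j) *s A (y' j) - (y' j - (of_real t * w j) *s A (y' j) - h)"
    proof -
      have "?d - (of_real s * w j) *s A ?d
        = (y j - (of_real s * w j) *s A (y j)) - (y' j - (of_real s * w j) *s A (y' j))"
        by (simp add: A_diff scale_right_diff_distrib)
      also have "\<dots> = h - (y' j - (of_real s * w j) *s A (y' j))" by (simp only: y)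
      finally show ?thesis by (simp add: algebra_simps scale_left_diff_distrib)
    qed
    also have "p \<dots> \<le> p ((of_real (s - t) * w j) *s A (y' j)) + p (y' j - (of_real t * w j) *s A (y' j) - h)"
      by (intro p_diff) auto
    also have "\<dots> = \<bar>s - t\<bar> * p (A (y' j))" unfolding y' by (simp only: p_scale A_mem y'E norm_mult nw norm_of_real mult_1_right add_0_right)
    also have "p (A (y' j)) \<le> max K 0 * p (y' j)"
      using A_bound[of "y' j"] p_nonneg[of "y' j"] mult_right_mono[of K "max K 0" "p (y' j)"] by simp
    also have "p (y' j) \<le> C * p h" by (rule py')
    finally show ?thesis using C by (simp add: mult_left_mono mult_right_mono algebra_simps)
  qed
  define g where "g = of_real (1 / k) *s (\<Sum>j<k. y' j)"
  have gE[simp]: "g \<in> E" unfolding g_def by (intro mem_scale mem_sum) auto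
  have avg: "p (of_real (1 / k) *s (\<Sum>j<k. F j)) \<le> B" if "\<And>j. F j \<in> E" "\<And>j. p (F j) \<le> B" for F B
  proof -
    have "p (\<Sum>j<k. F j) \<le> (\<Sum>j<k. p (F j))" using that by (intro p_sum) auto
    also have "\<dots> \<le> real k * B" using sum_bounded_above[of "{..<k}" "\<lambda>j. p (F j)" B] that by simp
    finally have "p (\<Sum>j<k. F j) / k \<le> B" using k by (simp add: divide_simps mult.commute)
    then show ?thesis using that by (subst p_scale) (auto intro!: mem_sum simp: norm_divide)
  qed
  have f_avg: "f = of_real (1 / k) *s (\<Sum>j<k. y j)" unfolding sumy using k by simp
  have 1: "p (f - g) \<le> C * (max K 0 * \<bar>s - t\<bar> * (C * p h))"
  proof -
    have "f - g = of_real (1 / k) *s (\<Sum>j<k. y j - y' j)"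
      by (subst f_avg) (simp add: g_def sum_subtractf scale_right_diff_distrib)
    then show ?thesis using avg[of "\<lambda>j. y j - y' j"] diff by simp
  qed
  have pg: "p g \<le> C * p h" unfolding g_def using avg[of y'] py' by simp
  have 2: "p (g - of_real t ^ k *s (A ^^ k) g - h) = 0"
  proof -
    have h_avg: "h = of_real (1 / k) *s (\<Sum>j<k. G (of_real t * w j) h)"
      using root_of_unity_average[OF hE k, of "of_real t"] k by (simp add: G_def w_def)
    have Gdiff: "G a (u - v) = G a u - G a v" if "u \<in> E" "v \<in> E" for a u v
      using that by (simp add: G_def A_pow_diff scale_right_diff_distrib sum_subtractf)
    have "g - of_real t ^ k *s (A ^^ k) g
       = of_real (1 / k) *s (\<Sum>j<k. y' j - of_real t ^ k *s (A ^^ k) (y' j))"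
      unfolding g_def by (subst A_pow_scale) (auto intro!: mem_sum simp: A_pow_sum sum_subtractf
          scale_sum_right scale_right_diff_distrib mult.commute)
    also have "\<dots> = of_real (1 / k) *s (\<Sum>j<k. G (of_real t * w j) (y' j - (of_real t * w j) *s A (y' j)))"
      unfolding G_def by (subst geometric_telescope') (simp_all add: power_mult_distrib wk)
    finally have "g - of_real t ^ k *s (A ^^ k) g - h
       = of_real (1 / k) *s (\<Sum>j<k. G (of_real t * w j) (y' j - (of_real t * w j) *s A (y' j) - h))"
      by (subst h_avg) (simp add: Gdiff sum_subtractf scale_right_diff_distrib)
    moreover have "p (G a v) \<le> 0" if "v \<in> E" "p v = 0" for a v
    proof -
      have "p (a ^ i *s (A ^^ i) v) \<le> 0" for i
        using A_pow_bound[OF that(1), of i] that p_nonneg[of "(A ^^ i) v"] by (simp add: p_scale)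
      then have "(\<Sum>i<k. p (a ^ i *s (A ^^ i) v)) \<le> 0" by (intro sum_nonpos) auto
      then show ?thesis unfolding G_def using p_sum[of "{..<k}" "\<lambda>i. a ^ i *s (A ^^ i) v"] that by force
    qed
    ultimately have "p (g - of_real t ^ k *s (A ^^ k) g - h) \<le> 0"
      using avg[of "\<lambda>j. G (of_real t * w j) (y' j - (of_real t * w j) *s A (y' j) - h)" 0] y' by simp
    then show ?thesis using p_nonneg[of "g - of_real t ^ k *s (A ^^ k) g - h"] by simp
  qed
  have 3: "p (g - h) \<le> e * (C * p h)"
  proof -
    have "p (g - h) = p (of_real t ^ k *s (A ^^ k) g)"
      using 2 by (intro p_eq_of_null) (simp_all add: algebra_simps)
    also have "\<dots> = t ^ k * p ((A ^^ k) g)"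
      using t by (simp add: p_scale norm_power)
    also have "\<dots> \<le> e * p g" by (intro small) simp
    also have "\<dots> \<le> e * (C * p h)" using e pg by (intro mult_left_mono)
    finally show ?thesis .
  qed
  have "p (f - h) \<le> p (f - g) + p (g - h)"
    using p_triangle[of "f - g" "g - h"] f by simp
  then show ?thesis using 1 3 by (simp add: power2_eq_square algebra_simps)
qed

text \<open>One half of the spectral radius formula. If \<open>t^k A^k\<close> tends to zero, then \<open>power_comparison\<close> bounds
  \<open>u^k A^k\<close> for \<open>\<bar>u - t\<bar> \<le> \<eta>\<close>, and \<open>v^k A^k\<close> tends to zero for all smaller \<open>v \<ge> 0\<close>. As \<open>\<eta>\<close>
  does not depend on \<open>t\<close>, finitely many steps lead from \<open>0\<close> to \<open>s\<close>.\<close>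

lemma power_tends_to_zero:
  assumes res: "\<And>a. cmod a < 1 \<Longrightarrow> \<exists>C. resolvent_bound C a"
    and surj: "\<And>a h. cmod a < 1 \<Longrightarrow> h \<in> E \<Longrightarrow> \<exists>y\<in>E. p (y - a *s A y - h) = 0"
    and s: "0 \<le> s" "s < 1" and e: "e > 0"
  shows "\<forall>\<^sub>F k in sequentially. \<forall>f\<in>E. s ^ k * p ((A ^^ k) f) \<le> e * p f"
proof -
  define P where "P = (\<lambda>s. \<forall>e>0. \<forall>\<^sub>F k in sequentially. \<forall>f\<in>E. s ^ k * p ((A ^^ k) f) \<le> e * p f)"
  define r where "r = (s + 1) / 2"
  have r: "s < r" "r < 1" "0 \<le> r" using s by (auto simp: r_def)
  obtain C where C: "C > 0" "\<And>a. cmod a \<le> r \<Longrightarrow> resolvent_bound C a"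
    using resolvent_bound_uniform[OF res r(2)] by blast
  define \<eta> where "\<eta> = 1 / (4 * C\<^sup>2 * max K 1)"
  have \<eta>: "\<eta> > 0" using C by (simp add: \<eta>_def)
  have bounded: "\<forall>\<^sub>F k in sequentially. \<forall>f\<in>E. u ^ k * p ((A ^^ k) f) \<le> 1 * p f"
    if Pt: "P t" and t: "0 \<le> t" "t \<le> r" and u: "0 \<le> u" "u \<le> r" "\<bar>u - t\<bar> \<le> \<eta>" for t u
  proof -
    have "\<forall>\<^sub>F k in sequentially. \<forall>f\<in>E. t ^ k * p ((A ^^ k) f) \<le> 1 / (4 * C) * p f"
      using Pt[unfolded P_def, rule_format, of "1 / (4 * C)"] C(1) by simp
    then show ?thesis using eventually_gt_at_top[of 0]
    proof eventually_elim
      case (elim k)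
      show ?case
      proof
        fix f assume f: "f \<in> E"
        define h where "h = f - of_real u ^ k *s (A ^^ k) f"
        have hE: "h \<in> E" using f by (simp add: h_def)
        have "p (f - h) \<le> (C\<^sup>2 * max K 0 * \<bar>u - t\<bar> + 1 / (4 * C) * C) * p h"
          unfolding h_def using elim C f r u t
          by (intro power_comparison[where r = r] surj) auto
        also have "\<dots> \<le> (1 / 2) * p h"
        proof (rule mult_right_mono[OF _ p_nonneg[OF hE]])
          have "C\<^sup>2 * max K 0 * \<bar>u - t\<bar> \<le> C\<^sup>2 * max K 1 * \<eta>"
            using u by (intro mult_mono) auto
          also have "\<dots> = 1 / 4" using C by (simp add: \<eta>_def)
          finally show "C\<^sup>2 * max K 0 * \<bar>u - t\<bar> + 1 / (4 * C) * C \<le> 1 / 2" using C by simp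
        qed
        also have "p h \<le> p f + p (f - h)" using p_diff[of f "f - h"] f hE by simp
        finally have "p (f - h) \<le> p f" by simp
        moreover have "f - h = of_real u ^ k *s (A ^^ k) f" by (simp add: h_def)
        ultimately show "u ^ k * p ((A ^^ k) f) \<le> 1 * p f"
          using f u by (simp add: p_scale norm_power)
      qed
    qed
  qed
  have step: "P v" if Pt: "P t" and t: "0 \<le> t" "t \<le> r" and v: "0 \<le> v" "v < t + \<eta>" "v < r" for t v
    unfolding P_def
  proof (intro allI impI)
    fix e :: real assume e: "e > 0"
    define u where "u = max t (min r (t + \<eta>))"
    have u: "v < u" "u \<le> r" "\<bar>u - t\<bar> \<le> \<eta>" "0 < u" using v t \<eta> by (auto simp: u_def)
    have "(\<lambda>k. (v / u) ^ k) \<longlonglongrightarrow> 0" using u v by (intro LIMSEQ_realpow_zero) auto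
    then have "\<forall>\<^sub>F k in sequentially. (v / u) ^ k < e" using e by (rule order_tendstoD)
    moreover have "\<forall>\<^sub>F k in sequentially. \<forall>f\<in>E. u ^ k * p ((A ^^ k) f) \<le> 1 * p f"
      using u t by (intro bounded[OF Pt]) auto
    ultimately show "\<forall>\<^sub>F k in sequentially. \<forall>f\<in>E. v ^ k * p ((A ^^ k) f) \<le> e * p f"
    proof eventually_elim
      case (elim k)
      show ?case
      proof
        fix f assume f: "f \<in> E"
        have "v ^ k * p ((A ^^ k) f) = (v / u) ^ k * (u ^ k * p ((A ^^ k) f))"
          using u by (simp add: power_divide)
        also have "\<dots> \<le> e * (1 * p f)"
          by (rule mult_mono) (use elim f u e p_nonneg[of "(A ^^ k) f"] in auto)
        finally show "v ^ k * p ((A ^^ k) f) \<le> e * p f" by simp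
      qed
    qed
  qed
  have P0: "P 0" unfolding P_def
  proof (intro allI impI)
    fix e :: real assume "e > 0"
    show "\<forall>\<^sub>F k in sequentially. \<forall>f\<in>E. 0 ^ k * p ((A ^^ k) f) \<le> e * p f"
      using eventually_gt_at_top[of 0] by eventually_elim (use \<open>e > 0\<close> p_nonneg in \<open>simp add: zero_power\<close>)
  qed
  have all: "P v" if "0 \<le> v" "v < r" "v \<le> real m * (\<eta> / 2)" for m v
    using that
  proof (induction m arbitrary: v)
    case 0 then show ?case using P0 by simp
  next
    case (Suc m)
    define t where "t = max 0 (v - \<eta> / 2)"
    have "P t" using Suc.prems \<eta> by (intro Suc.IH) (auto simp: t_def max_def algebra_simps)
    then show ?case
      by (rule step) (use Suc.prems \<eta> r in \<open>auto simp: t_def\<close>)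
  qed
  obtain m where "s / (\<eta> / 2) \<le> real m" using real_arch_simple by blast
  then have "s \<le> real m * (\<eta> / 2)" using \<eta> by (simp add: divide_simps)
  then have "P s" using all[of s m] s r by simp
  then show ?thesis using e by (simp add: P_def)
qed
lemma orbit_tendsto_zero:
  assumes ev: "\<And>e. e > 0 \<Longrightarrow> \<forall>\<^sub>F k in sequentially. \<forall>f\<in>E. s ^ k * p ((A ^^ k) f) \<le> e * p f"
    and s: "0 \<le> s" and f: "f \<in> E"
  shows "(\<lambda>k. s ^ k * p ((A ^^ k) f)) \<longlonglongrightarrow> 0"
proof (rule tendstoI)
  fix e :: real assume e: "e > 0"
  define d where "d = e / (2 * (p f + 1))"
  have d: "d > 0" "d * p f < e"
    using e p_nonneg[OF f] by (auto simp: d_def field_simps add_nonneg_pos)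
  from ev[OF d(1)] show "\<forall>\<^sub>F k in sequentially. dist (s ^ k * p ((A ^^ k) f)) 0 < e"
  proof eventually_elim
    case (elim k)
    then have "s ^ k * p ((A ^^ k) f) \<le> d * p f" using f by blast
    then show ?case using d s f p_nonneg[of "(A ^^ k) f"] by (simp add: abs_mult)
  qed
qed

end

section \<open>The space and its backward shift\<close>

lemma vanishes_to_infinite_order:
  assumes f: "f \<in> hol_disc" and a: "a \<in> disc"
    and div: "\<And>n. \<exists>g. g holomorphic_on disc \<and> (\<forall>z\<in>disc. f z = (z - a) ^ n * g z)"
  shows "f = 0"
proof (rule ccontr)
  assume "f \<noteq> 0"
  then obtain b where "f b \<noteq> 0" by (auto simp: fun_eq_iff)
  then have b: "b \<in> disc" "f b \<noteq> 0" using f by (auto simp: hol_disc_def)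
  have hol: "f holomorphic_on disc" using f by (simp add: hol_disc_def)
  obtain h where "\<forall>z\<in>disc. f z = (z - a) ^ Suc 0 * h z" using div by blast
  then have fa: "f a = 0" using a by simp
  obtain g n where g: "g holomorphic_on disc" "g a \<noteq> 0" "\<And>z. z \<in> disc \<Longrightarrow> f z = (z - a) ^ n * g z"
    using factor_out_zero[OF hol _ _ a fa b] by (metis connected_ball open_ball)
  obtain h where h: "h holomorphic_on disc" "\<And>z. z \<in> disc \<Longrightarrow> f z = (z - a) ^ Suc n * h z"
    using div by blast
  have eq: "g z = (z - a) * h z" if "z \<in> disc - {a}" for z
    using g(3)[of z] h(2)[of z] that by simp
  have "isCont g a" "isCont h a"
    using holomorphic_on_imp_continuous_on[OF g(1)] holomorphic_on_imp_continuous_on[OF h(1)] a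
    by (simp_all add: continuous_on_eq_continuous_at)
  then have "(g \<longlongrightarrow> g a) (at a)" "((\<lambda>z. (z - a) * h z) \<longlongrightarrow> (a - a) * h a) (at a)"
    by (auto simp only: isCont_def intro!: tendsto_intros)
  moreover have "\<forall>\<^sub>F z in at a. g z = (z - a) * h z"
    using eventually_at_in_open[OF open_ball a] by eventually_elim (use eq in blast)
  ultimately have "((\<lambda>z. (z - a) * h z) \<longlongrightarrow> g a) (at a)"
    by (simp add: tendsto_cong)
  then have "g a = (a - a) * h a"
    using \<open>((\<lambda>z. (z - a) * h z) \<longlongrightarrow> (a - a) * h a) (at a)\<close> by (rule LIM_unique)
  then show False using g by simp
qed

lemma divide_zero_hol_disc:
  assumes f: "f \<in> hol_disc" and a: "a \<in> disc" and fa: "f a = 0"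
  shows "divide_zero a f \<in> hol_disc" "\<And>z. f z = (z - a) * divide_zero a f z"
proof -
  have "divide_zero a f holomorphic_on disc"
    by (rule pole_theorem_open_0[where g = f and a = a]) (use f fa in \<open>auto simp: divide_zero_def hol_disc_def\<close>)
  then show "divide_zero a f \<in> hol_disc"
    using f a by (auto simp: hol_disc_def divide_zero_def)
  show "f z = (z - a) * divide_zero a f z" for z using fa by (simp add: divide_zero_def)
qed

text \<open>If all elements of \<open>M\<close> vanished at \<open>a\<close>, one could divide \<open>f\<close> by \<open>z - a\<close> again and again.\<close>

lemma exists_nonvanishing:
  assumes M: "M \<subseteq> hol_disc" and a: "a \<in> disc"
    and div: "\<And>g. g \<in> M \<Longrightarrow> g a = 0 \<Longrightarrow> divide_zero a g \<in> M"
    and f: "f \<in> M" "f \<noteq> 0"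
  obtains g where "g \<in> M" "g a \<noteq> 0"
proof (rule ccontr)
  assume "\<not> thesis"
  then have all: "\<forall>g\<in>M. g a = 0" using that by blast
  have "\<exists>g\<in>M. \<forall>z\<in>disc. f z = (z - a) ^ n * g z" for n
  proof (induction n)
    case 0 then show ?case using f by auto
  next
    case (Suc n)
    then obtain g where g: "g \<in> M" "\<forall>z\<in>disc. f z = (z - a) ^ n * g z" by blast
    then have "\<forall>z\<in>disc. f z = (z - a) ^ Suc n * divide_zero a g z"
      using divide_zero_hol_disc(2)[of g a] M a all g(1) by (metis mult.assoc power_Suc2 subsetD)
    then show ?case using div[OF g(1)] all g(1) by blast
  qed
  then have "f = 0"
    using vanishes_to_infinite_order[of f a] M f a by (metis (mono_tags, lifting) hol_disc_def mem_Collect_eq subsetD)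
  then show False using f by simp
qed

lemma hol_discD: "f \<in> hol_disc \<Longrightarrow> f holomorphic_on disc" "f \<in> hol_disc \<Longrightarrow> z \<notin> disc \<Longrightarrow> f z = 0"
  by (auto simp: hol_disc_def)

lemma shift_bshift: "f \<in> hol_disc \<Longrightarrow> shift (bshift f) = f - cscale (f 0) const_one"
  by (auto simp: fun_eq_iff shift_def bshift_eq cscale_def const_one_def hol_disc_def)

lemma hol_disc_deriv:
  assumes "f \<in> hol_disc" shows "f field_differentiable at 0"
  using hol_discD(1)[OF assms] holomorphic_on_imp_differentiable_at[of f disc 0] by simp

lemma hol_disc_add: "f \<in> hol_disc \<Longrightarrow> g \<in> hol_disc \<Longrightarrow> f + g \<in> hol_disc"
  and hol_disc_scale: "f \<in> hol_disc \<Longrightarrow> cscale c f \<in> hol_disc"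
  by (auto simp: hol_disc_def cscale_def plus_fun_def intro!: holomorphic_intros)

lemma cscale_apply: "cscale c f z = c * f z"
  by (simp add: cscale_def)

lemma bshift_add:
  assumes "f \<in> hol_disc" "g \<in> hol_disc" shows "bshift (f + g) = bshift f + bshift g"
proof -
  have "deriv (f + g) 0 = deriv f 0 + deriv g 0"
    unfolding plus_fun_def using assms by (intro deriv_add hol_disc_deriv)
  then show ?thesis
    using assms by (simp add: fun_eq_iff bshift_eq hol_disc_add diff_divide_distrib add_divide_distrib)
qed

lemma bshift_scale:
  assumes "f \<in> hol_disc" shows "bshift (cscale c f) = cscale c (bshift f)"
proof -
  have "deriv (cscale c f) 0 = c * deriv f 0"
    unfolding cscale_def using assms by (intro deriv_cmult hol_disc_deriv)
  then show ?thesis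
    using assms by (simp add: fun_eq_iff bshift_eq hol_disc_scale cscale_apply right_diff_distrib diff_divide_distrib)
qed

lemma shift_scale: "shift (cscale c f) = cscale c (shift f)"
  by (simp add: shift_def cscale_def fun_eq_iff algebra_simps)

lemma seminormed_subspaceI:
  assumes "cfun.subspace E" "norm_on E N"
  shows "seminormed_subspace cscale E N"
  using assms by unfold_locales (auto simp: norm_on_def)

lemma Metric_space_norm_dist:
  assumes "cfun.subspace E" "norm_on E N" shows "Metric_space E (norm_dist E N)"
proof -
  interpret seminormed_subspace cscale E N using assms by (rule seminormed_subspaceI)
  show ?thesis
  proof
    show "0 \<le> norm_dist E N x y" for x y by (simp add: norm_dist_def p_nonneg)
    show "norm_dist E N x y = norm_dist E N y x" for x y
      using p_minus[of "x - y"] by (simp add: norm_dist_def)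
    show "norm_dist E N x y = 0 \<longleftrightarrow> x = y" if "x \<in> E" "y \<in> E" for x y
    proof -
      have "N (x - y) = 0 \<longleftrightarrow> x - y = 0" using assms(2) that by (simp add: norm_on_def)
      then show ?thesis using that by (simp add: norm_dist_def)
    qed
    show "norm_dist E N x z \<le> norm_dist E N x y + norm_dist E N y z"
      if "x \<in> E" "y \<in> E" "z \<in> E" for x y z
      using p_triangle[of "x - y" "y - z"] that by (simp add: norm_dist_def)
  qed
qed

lemma continuous_linear_bounded:
  assumes E: "cfun.subspace E" and N: "norm_on E N"
    and A: "continuous_map (norm_topology E N) (norm_topology E N) A"
    and scale: "\<And>c f. f \<in> E \<Longrightarrow> A (cscale c f) = cscale c (A f)"
  obtains K where "K > 0" "\<And>f. f \<in> E \<Longrightarrow> N (A f) \<le> K * N f"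
proof -
  interpret seminormed_subspace cscale E N using E N by (rule seminormed_subspaceI)
  interpret Metric_space E "norm_dist E N" using E N by (rule Metric_space_norm_dist)
  have AE: "A f \<in> E" if "f \<in> E" for f
    using A that by (auto simp: continuous_map_def)
  have A0: "A 0 = 0" using scale[of 0 0] by simp
  have "\<exists>r>0. \<forall>x. x \<in> E \<and> norm_dist E N 0 x < r \<longrightarrow> A x \<in> mball 0 1"
    using A unfolding continuous_map_from_metric using A0 by (metis centre_in_mball_iff mem_zero openin_mball zero_less_one)
  then obtain r where r: "r > 0" "\<And>x. x \<in> E \<Longrightarrow> norm_dist E N 0 x < r \<Longrightarrow> A x \<in> mball 0 1" by blast
  have small: "N (A x) < 1" if "x \<in> E" "N x < r" for x
    using r(2)[OF that(1)] that AE p_minus[of x] p_minus[of "A x"] by (simp add: norm_dist_def)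
  show thesis
  proof (rule that[of "2 / r"])
    fix f assume f: "f \<in> E"
    show "N (A f) \<le> 2 / r * N f"
    proof (cases "N f = 0")
      case True
      then have "f = 0" using N f by (simp add: norm_on_def)
      then show ?thesis using A0 by simp
    next
      case False
      then have pos: "N f > 0" using p_nonneg[OF f] by simp
      have "N (A (cscale (of_real (r / (2 * N f))) f)) < 1"
        using f pos r by (intro small) (auto simp: p_scale norm_divide norm_mult)
      then have "r / (2 * N f) * N (A f) < 1"
        using f pos r AE by (simp add: scale p_scale norm_divide norm_mult)
      then show ?thesis using pos r by (simp add: field_simps)
    qed
  qed (use r in simp)
qed

text \<open>A space of the class, with the operators \<open>S = shift\<close> and \<open>T = bshift\<close>.\<close>

locale disc_space =
  fixes E :: "(complex \<Rightarrow> complex) set" and N :: "(complex \<Rightarrow> complex) \<Rightarrow> real"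
  assumes class_E: "class_E E N"
begin

lemma E_hol: "f \<in> E \<Longrightarrow> f \<in> hol_disc" and subspace: "cfun.subspace E" and norm_on: "norm_on E N"
  and shift_mem[simp]: "f \<in> E \<Longrightarrow> shift f \<in> E" and bshift_mem[simp]: "f \<in> E \<Longrightarrow> bshift f \<in> E"
  using class_E by (auto simp: class_E_def banach_on_def)

sublocale N: seminormed_subspace cscale E N
  using subspace norm_on by (rule seminormed_subspaceI)

lemma E_nonempty: "E \<noteq> {}"
  using N.mem_zero by blast

lemma N_eq_0: "f \<in> E \<Longrightarrow> N f = 0 \<longleftrightarrow> f = 0"
  using norm_on by (simp add: norm_on_def)

text \<open>Some \<open>g\<close> in \<open>E\<close> has \<open>g 0 \<noteq> 0\<close>, because \<open>T\<close> divides by \<open>z\<close>; and \<open>g - S T g\<close> is the constant \<open>g 0\<close>.\<close>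

lemma const_one_mem[simp]: "const_one \<in> E"
proof -
  have "E \<noteq> {0}" using class_E by (simp add: class_E_def)
  then obtain f where f: "f \<in> E" "f \<noteq> 0" using N.mem_zero by blast
  obtain g where g: "g \<in> E" "g 0 \<noteq> 0"
  proof (rule exists_nonvanishing[of E 0 f])
    show "divide_zero 0 g \<in> E" if "g \<in> E" "g 0 = 0" for g
      using bshift_mem[OF that(1)] that(2) by (simp add: bshift_def)
  qed (use f E_hol in auto)
  have "cscale (1 / g 0) (g - shift (bshift g)) = const_one"
    using g by (simp add: shift_bshift[OF E_hol])
  moreover have "cscale (1 / g 0) (g - shift (bshift g)) \<in> E" using g by simp
  ultimately show ?thesis by simp
qed

lemma N_one_pos: "N const_one > 0"
proof -
  have "const_one \<noteq> 0" by (auto simp: fun_eq_iff const_one_def intro!: exI[of _ 0])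
  then show ?thesis using N_eq_0[of const_one] N.p_nonneg[of const_one] by simp
qed

text \<open>Positive bounds for the operators \<open>T\<close> and \<open>S\<close>, not necessarily their norms.\<close>

definition norm_T :: real where "norm_T = (SOME K. K > 0 \<and> (\<forall>f\<in>E. N (bshift f) \<le> K * N f))"
definition norm_S :: real where "norm_S = (SOME K. K > 0 \<and> (\<forall>f\<in>E. N (shift f) \<le> K * N f))"

lemma norm_T: "norm_T > 0" "f \<in> E \<Longrightarrow> N (bshift f) \<le> norm_T * N f"
proof -
  have "continuous_map (norm_topology E N) (norm_topology E N) bshift" using class_E by (simp add: class_E_def)
  then have "\<exists>K. K > 0 \<and> (\<forall>f\<in>E. N (bshift f) \<le> K * N f)"
    using continuous_linear_bounded[OF subspace norm_on, of bshift] bshift_scale E_hol by metis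
  from someI_ex[OF this] show "norm_T > 0" "f \<in> E \<Longrightarrow> N (bshift f) \<le> norm_T * N f"
    unfolding norm_T_def by auto
qed

lemma norm_S: "norm_S > 0" "f \<in> E \<Longrightarrow> N (shift f) \<le> norm_S * N f"
proof -
  have "continuous_map (norm_topology E N) (norm_topology E N) shift" using class_E by (simp add: class_E_def)
  then have "\<exists>K. K > 0 \<and> (\<forall>f\<in>E. N (shift f) \<le> K * N f)"
    using continuous_linear_bounded[OF subspace norm_on, of shift] shift_scale by metis
  from someI_ex[OF this] show "norm_S > 0" "f \<in> E \<Longrightarrow> N (shift f) \<le> norm_S * N f"
    unfolding norm_S_def by auto
qed

lemma bshift_linear: "f \<in> E \<Longrightarrow> g \<in> E \<Longrightarrow> bshift (f + g) = bshift f + bshift g"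
  "f \<in> E \<Longrightarrow> bshift (cscale c f) = cscale c (bshift f)"
  "f \<in> E \<Longrightarrow> g \<in> E \<Longrightarrow> bshift (f - g) = bshift f - bshift g"
proof -
  show add: "bshift (f + g) = bshift f + bshift g" if "f \<in> E" "g \<in> E" for f g 
    using that E_hol bshift_add by auto
  show sc: "bshift (cscale c f) = cscale c (bshift f)" if "f \<in> E" for c f
    using that E_hol bshift_scale by auto
  show "bshift (f - g) = bshift f - bshift g" if "f \<in> E" "g \<in> E"
    using add[of f "- g"] sc[of g "-1"] that by simp
qed

text \<open>The spectral radius bound, with \<open>a\<close> standing for the inverse of a point outside the closed disc.\<close>

lemma bshift_resolvent:
  assumes a: "cmod a < 1"
  obtains C where "C > 0" "\<And>y. y \<in> E \<Longrightarrow> N y \<le> C * N (y - cscale a (bshift y))"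
    "\<And>h. h \<in> E \<Longrightarrow> \<exists>y\<in>E. y - cscale a (bshift y) = h"
proof (cases "a = 0")
  case True
  then show thesis by (intro that[of 1]) auto
next
  case False
  have "1 / a \<notin> op_spectrum E N bshift"
  proof
    assume "1 / a \<in> op_spectrum E N bshift"
    then have "ereal (cmod (1 / a)) \<le> op_spectral_radius E N bshift"
      unfolding op_spectral_radius_def by (rule SUP_upper)
    also have "\<dots> \<le> 1" using class_E by (simp add: class_E_def)
    finally have "cmod (1 / a) \<le> 1" by simp
    then show False using a False by (simp add: norm_divide divide_simps)
  qed
  then obtain B where B: "cont_linear_on E N B"
    "\<And>f. f \<in> E \<Longrightarrow> B (cscale (1 / a) f - bshift f) = f"
    "\<And>f. f \<in> E \<Longrightarrow> cscale (1 / a) (B f) - bshift (B f) = f"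
    unfolding op_spectrum_def by blast
  have BE: "B f \<in> E" if "f \<in> E" for f using B(1) that by (auto simp: cont_linear_on_def)
  obtain K where K: "K > 0" "\<And>f. f \<in> E \<Longrightarrow> N (B f) \<le> K * N f"
    using continuous_linear_bounded[OF subspace norm_on, of B] B(1) by (metis cont_linear_on_def)
  have eq: "cscale (1 / a) y - bshift y = cscale (1 / a) (y - cscale a (bshift y))" for y
    using False by (simp add: cfun.scale_right_diff_distrib)
  show thesis
  proof (rule that[of "K * cmod (1 / a)"])
    show "K * cmod (1 / a) > 0" using K False by simp
    fix y assume y: "y \<in> E"
    have "N y = N (B (cscale (1 / a) y - bshift y))" using B(2)[OF y] by simp
    also have "\<dots> \<le> K * N (cscale (1 / a) y - bshift y)" using y by (intro K) simp
    also have "\<dots> = K * cmod (1 / a) * N (y - cscale a (bshift y))"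
      unfolding eq using y by (simp add: N.p_scale)
    finally show "N y \<le> K * cmod (1 / a) * N (y - cscale a (bshift y))" .
  next
    fix h assume h: "h \<in> E"
    let ?y = "cscale (1 / a) (B h)"
    have "?y - cscale a (bshift ?y) = h"
      using B(3)[OF h] False BE[OF h] by (simp add: bshift_linear)
    then show "\<exists>y\<in>E. y - cscale a (bshift y) = h" using BE[OF h] by (intro bexI[of _ ?y]) auto
  qed
qed

sublocale T: seminormed_operator cscale E N bshift norm_T
  by unfold_locales (auto simp: bshift_linear norm_T(2))

lemma bshift_power_tends_to_zero:
  assumes s: "0 \<le> s" "s < 1" and e: "e > 0"
  shows "\<forall>\<^sub>F k in sequentially. \<forall>f\<in>E. s ^ k * N ((bshift ^^ k) f) \<le> e * N f"
proof (rule T.power_tends_to_zero)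
  show "\<exists>C. T.resolvent_bound C a" if "cmod a < 1" for a
    using bshift_resolvent[OF that] unfolding T.resolvent_bound_def by metis
  show "\<exists>y\<in>E. N (y - cscale a (bshift y) - h) = 0" if "cmod a < 1" "h \<in> E" for a h
    using bshift_resolvent[OF that(1)] that(2) by (metis N.p_zero diff_self)
qed (use assms in auto)

text \<open>The coefficients of \<open>Delta\<close>.\<close>

abbreviation T_norm :: "nat \<Rightarrow> real" where "T_norm n \<equiv> op_norm E N (bshift ^^ n)"

lemma T_norm_bdd: "bdd_above ((\<lambda>f. N ((bshift ^^ n) f) / N f) ` E)"
proof (rule bdd_aboveI2)
  fix f assume f: "f \<in> E"
  have "N ((bshift ^^ n) f) \<le> max norm_T 0 ^ n * N f"
    by (rule T.A_pow_bound[OF f])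
  then show "N ((bshift ^^ n) f) / N f \<le> max norm_T 0 ^ n"
    using N.p_nonneg[OF f] by (cases "N f = 0") (auto simp: divide_simps)
qed

lemma T_norm: "f \<in> E \<Longrightarrow> N ((bshift ^^ n) f) \<le> T_norm n * N f"
proof (cases "N f = 0")
  case True
  assume f: "f \<in> E"
  then show ?thesis
    using T.A_pow_bound[OF f, of n] True by simp
next
  case False
  assume f: "f \<in> E"
  have "N ((bshift ^^ n) f) / N f \<le> T_norm n"
    unfolding op_norm_def using f by (intro cSUP_upper T_norm_bdd)
  then show ?thesis using False N.p_nonneg[OF f] by (simp add: divide_simps)
qed

lemma T_norm_nonneg: "T_norm n \<ge> 0"
proof -
  have "N ((bshift ^^ n) 0) / N 0 \<le> T_norm n"
    unfolding op_norm_def by (rule cSUP_upper[OF N.mem_zero T_norm_bdd])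
  then show ?thesis by simp
qed

lemma T_norm_0: "T_norm 0 = 1"
proof -
  have "N const_one / N const_one \<le> T_norm 0"
    using cSUP_upper[OF const_one_mem T_norm_bdd, of 0] unfolding op_norm_def by simp
  moreover have "T_norm 0 \<le> 1"
    unfolding op_norm_def by (intro cSUP_least) (use E_nonempty in \<open>auto simp: divide_simps\<close>)
  ultimately show ?thesis using N_one_pos by simp
qed

lemma summable_Delta:
  assumes r: "0 \<le> r" "r < 1" shows "summable (\<lambda>n. r ^ n * T_norm n)"
proof -
  define s where "s = (r + 1) / 2"
  have s: "r < s" "s < 1" "s > 0" using r by (auto simp: s_def)
  have "\<forall>\<^sub>F k in sequentially. \<forall>f\<in>E. s ^ k * N ((bshift ^^ k) f) \<le> 1 * N f"
    using s by (intro bshift_power_tends_to_zero) auto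
  then have ev: "\<forall>\<^sub>F k in sequentially. norm (r ^ k * T_norm k) \<le> (r / s) ^ k"
  proof eventually_elim
    case (elim k)
    have "T_norm k \<le> (1 / s) ^ k"
      unfolding op_norm_def
    proof (rule cSUP_least)
      fix f assume f: "f \<in> E"
      show "N ((bshift ^^ k) f) / N f \<le> (1 / s) ^ k"
        using elim f s N.p_nonneg[OF f] by (cases "N f = 0") (auto simp: field_simps)
    qed (rule E_nonempty)
    then have "r ^ k * T_norm k \<le> r ^ k * (1 / s) ^ k" using r by (intro mult_left_mono) auto
    then show ?case using r T_norm_nonneg[of k] by (simp add: abs_mult power_divide)
  qed
  show ?thesis
    by (rule summable_comparison_test_ev[OF ev]) (use r s in \<open>auto intro!: summable_geometric\<close>)
qed

lemma Delta_ge_1: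
  assumes "0 \<le> r" "r < 1" shows "Delta E N r \<ge> 1"
proof -
  have "(\<Sum>n<1. r ^ n * T_norm n) \<le> Delta E N r"
    unfolding Delta_def using assms T_norm_nonneg by (intro sum_le_suminf summable_Delta) auto
  then show ?thesis by (simp add: T_norm_0 del: funpow.simps)
qed

lemma Delta_mono:
  assumes "0 \<le> r" "r \<le> s" "s < 1" shows "Delta E N r \<le> Delta E N s"
  unfolding Delta_def
  using assms T_norm_nonneg by (intro suminf_le summable_Delta mult_right_mono power_mono) auto

text \<open>The solution \<open>w\<close> is the sum of the Neumann series \<open>\<Sum>i. a^i T^i g\<close>.\<close>

lemma Delta_resolvent:
  assumes a: "a \<in> disc" and g: "g \<in> E"
  obtains w where "w \<in> E" "w - cscale a (bshift w) = g" "N w \<le> Delta E N (cmod a) * N g"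
proof -
  have na: "cmod a < 1" using a by simp
  obtain w where w: "w \<in> E" "w - cscale a (bshift w) = g"
    using bshift_resolvent[OF na] g by metis
  have le: "N w \<le> (\<Sum>i<k. cmod a ^ i * T_norm i) * N g + cmod a ^ k * N ((bshift ^^ k) w)" for k
  proof -
    have "(\<Sum>i<k. cscale (a ^ i) ((bshift ^^ i) g)) = w - cscale (a ^ k) ((bshift ^^ k) w)"
      using T.geometric_telescope'[OF w(1), of a k] unfolding w(2) .
    then have "w = (\<Sum>i<k. cscale (a ^ i) ((bshift ^^ i) g)) + cscale (a ^ k) ((bshift ^^ k) w)" by simp
    then have "N w \<le> N (\<Sum>i<k. cscale (a ^ i) ((bshift ^^ i) g)) + N (cscale (a ^ k) ((bshift ^^ k) w))"
      using g w(1) N.p_triangle[of "\<Sum>i<k. cscale (a ^ i) ((bshift ^^ i) g)" "cscale (a ^ k) ((bshift ^^ k) w)"]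
      by (simp add: N.mem_sum)
    moreover have "N (\<Sum>i<k. cscale (a ^ i) ((bshift ^^ i) g)) \<le> (\<Sum>i<k. N (cscale (a ^ i) ((bshift ^^ i) g)))"
      using g by (intro N.p_sum) auto
    moreover have "(\<Sum>i<k. N (cscale (a ^ i) ((bshift ^^ i) g))) \<le> (\<Sum>i<k. cmod a ^ i * (T_norm i * N g))"
      using g by (intro sum_mono) (auto simp: N.p_scale norm_power intro!: mult_left_mono T_norm)
    ultimately show ?thesis
      using w(1) by (simp add: N.p_scale norm_power sum_distrib_right mult.assoc)
  qed
  have "(\<lambda>k. cmod a ^ k * N ((bshift ^^ k) w)) \<longlonglongrightarrow> 0"
    using na w(1) by (intro T.orbit_tendsto_zero bshift_power_tends_to_zero) auto
  moreover have "(\<lambda>k. \<Sum>i<k. cmod a ^ i * T_norm i) \<longlonglongrightarrow> Delta E N (cmod a)"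
    unfolding Delta_def using na by (intro summable_LIMSEQ summable_Delta) auto
  ultimately have "(\<lambda>k. (\<Sum>i<k. cmod a ^ i * T_norm i) * N g + cmod a ^ k * N ((bshift ^^ k) w))
      \<longlonglongrightarrow> Delta E N (cmod a) * N g + 0"
    by (intro tendsto_intros)
  then have "N w \<le> Delta E N (cmod a) * N g + 0"
    by (rule tendsto_lowerbound) (use le in auto)
  then show thesis using w that by simp
qed

text \<open>In other words, \<open>w\<close> is the function \<open>z \<mapsto> (f z - f a) / (z - a)\<close>.\<close>

lemma resolvent_shift:
  assumes a: "a \<in> disc" and f: "f \<in> E" and w: "w \<in> E" "w - cscale a (bshift w) = bshift f"
  shows "shift w - cscale a w = f - cscale (f a) const_one"
proof -
  have eq: "(z - a) * w z = f z - (f 0 + a * w 0) * const_one z" for z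
  proof -
    have "shift (w - cscale a (bshift w)) z = shift (bshift f) z" by (simp add: w)
    then have "z * w z - a * shift (bshift w) z = shift (bshift f) z"
      by (simp add: shift_def cscale_def algebra_simps)
    then show ?thesis
      unfolding shift_bshift[OF E_hol[OF f]] shift_bshift[OF E_hol[OF w(1)]]
      by (simp add: cscale_def algebra_simps)
  qed
  have "f a = f 0 + a * w 0" using eq[of a] a by (simp add: const_one_def)
  then show ?thesis using eq by (auto simp: fun_eq_iff shift_def cscale_def algebra_simps)
qed

lemma evaluation_bound:
  obtains C where "C > 0" "\<And>a f. a \<in> disc \<Longrightarrow> f \<in> E \<Longrightarrow> cmod (f a) \<le> C * Delta E N (cmod a) * N f"
proof (rule that[of "(1 + (norm_S + 1) * norm_T) / N const_one"])
  show "(1 + (norm_S + 1) * norm_T) / N const_one > 0"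
    using norm_S(1) norm_T(1) N_one_pos by (simp add: add_pos_pos)
next
  fix a f assume a: "a \<in> disc" and f: "f \<in> E"
  let ?D = "Delta E N (cmod a)"
  have D: "?D \<ge> 1" using a by (intro Delta_ge_1) auto
  obtain w where w: "w \<in> E" "w - cscale a (bshift w) = bshift f" "N w \<le> ?D * N (bshift f)"
    using Delta_resolvent[OF a bshift_mem[OF f]] .
  have "cmod (f a) * N const_one = N (cscale (f a) const_one)" by (simp add: N.p_scale)
  also have "cscale (f a) const_one = f - (shift w - cscale a w)"
    by (simp add: resolvent_shift[OF a f w(1,2)])
  also have "N \<dots> \<le> N f + (N (shift w) + N (cscale a w))"
    using N.p_diff[of f "shift w - cscale a w"] N.p_diff[of "shift w" "cscale a w"] f w(1) by simp
  also have "N (cscale a w) \<le> 1 * N w"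
    using a w(1) N.p_nonneg[OF w(1)] by (simp add: N.p_scale mult_left_le_one_le)
  also have "N (shift w) \<le> norm_S * N w" by (rule norm_S(2)[OF w(1)])
  finally have 1: "cmod (f a) * N const_one \<le> N f + (norm_S * N w + 1 * N w)" by simp
  have 2: "(norm_S + 1) * N w \<le> (norm_S + 1) * (?D * (norm_T * N f))"
    using norm_S(1) D norm_T(2)[OF f] by (intro mult_left_mono order_trans[OF w(3)]) auto
  have 3: "N f \<le> ?D * N f" using D N.p_nonneg[OF f] mult_right_mono[of 1 ?D "N f"] by simp
  have "cmod (f a) * N const_one \<le> (1 + (norm_S + 1) * norm_T) * ?D * N f"
    using 1 2 3 by (simp add: algebra_simps)
  then show "cmod (f a) \<le> (1 + (norm_S + 1) * norm_T) / N const_one * ?D * N f"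
    using N_one_pos by (simp add: field_simps)
qed

end

section \<open>The quotient and the lift of U\<close>

lemma bshift_shift:
  assumes "f \<in> hol_disc" shows "bshift (shift f) = f"
proof -
  have hol: "f holomorphic_on disc" using assms by (rule hol_discD)
  have mem: "shift f \<in> hol_disc" using assms by (auto simp: hol_disc_def shift_def intro!: holomorphic_intros)
  have "((\<lambda>z. z * f z) has_field_derivative (1 * f 0 + deriv f 0 * 0)) (at 0)"
    using holomorphic_derivI[OF hol open_ball, of 0 UNIV] by (intro derivative_intros) auto
  then have "deriv (shift f) 0 = f 0" unfolding shift_def by (simp add: DERIV_imp_deriv)
  then show ?thesis
    using mem hol_discD(2)[OF assms] by (auto simp: fun_eq_iff bshift_eq) (simp add: shift_def)
qed

text \<open>The setting of the theorem.\<close>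

locale division_quotient = disc_space E N for E N +
  fixes M :: "(complex \<Rightarrow> complex) set" and U :: "(complex \<Rightarrow> complex) set \<Rightarrow> (complex \<Rightarrow> complex) set"
  assumes M_subspace: "cfun.subspace M" and M_sub: "M \<subseteq> E"
    and M_closed: "closedin (norm_topology E N) M"
    and M_nonzero: "M \<noteq> {0}" and M_div: "division_property M"
    and U_linear: "quot_linear E M U"
    and U_shift: "f \<in> E \<Longrightarrow> U (shift f +o M) = f +o M"
begin

lemma M_E[simp]: "m \<in> M \<Longrightarrow> m \<in> E" using M_sub by auto

lemma M_zero[simp]: "0 \<in> M" and M_add[simp]: "f \<in> M \<Longrightarrow> g \<in> M \<Longrightarrow> f + g \<in> M"
  and M_scale[simp]: "f \<in> M \<Longrightarrow> cscale c f \<in> M" and M_diff[simp]: "f \<in> M \<Longrightarrow> g \<in> M \<Longrightarrow> f - g \<in> M"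
  and M_minus[simp]: "f \<in> M \<Longrightarrow> - f \<in> M"
  using M_subspace by (auto simp: cfun.subspace_0 cfun.subspace_add cfun.subspace_scale cfun.subspace_diff cfun.subspace_neg)

text \<open>The quotient norm, as a seminorm on \<open>E\<close> that vanishes exactly on \<open>M\<close>.\<close>

definition q :: "(complex \<Rightarrow> complex) \<Rightarrow> real" where "q f = quot_norm N (f +o M)"

lemma q_eq: "q f = (INF m\<in>M. N (f + m))"
proof -
  have "f +o M = (\<lambda>m. f + m) ` M" by (auto simp: elt_set_plus_def)
  then show ?thesis by (simp add: q_def quot_norm_def image_image)
qed

lemma q_le: "f \<in> E \<Longrightarrow> m \<in> M \<Longrightarrow> q f \<le> N (f + m)"
  unfolding q_eq by (intro cINF_lower bdd_belowI2[of _ 0]) (auto intro!: N.p_nonneg)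

lemma q_greatest: "(\<And>m. m \<in> M \<Longrightarrow> c \<le> N (f + m)) \<Longrightarrow> c \<le> q f"
  unfolding q_eq by (rule cINF_greatest) (use M_zero in blast)+

lemma q_le_N: "f \<in> E \<Longrightarrow> q f \<le> N f"
  using q_le[of f 0] by simp

sublocale Q: seminormed_subspace cscale E q
proof
  show sub: "cfun.subspace E" by (rule subspace)
  show nonneg: "0 \<le> q f" if "f \<in> E" for f using that by (intro q_greatest N.p_nonneg) auto
  have le: "q (cscale c f) \<le> cmod c * q f" if f: "f \<in> E" and c: "c \<noteq> 0" for c f
  proof -
    have "q (cscale c f) / cmod c \<le> q f"
    proof (rule q_greatest)
      fix m assume m: "m \<in> M"
      have "q (cscale c f) \<le> N (cscale c f + cscale c m)" using f m by (intro q_le) auto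
      also have "\<dots> = cmod c * N (f + m)"
        using f m by (simp add: N.p_scale flip: cfun.scale_right_distrib)
      finally show "q (cscale c f) / cmod c \<le> N (f + m)" using c by (simp add: field_simps)
    qed
    then show ?thesis using c by (simp add: field_simps)
  qed
  show "q (cscale c f) = cmod c * q f" if f: "f \<in> E" for c f
  proof (cases "c = 0")
    case True
    have "q 0 \<le> 0" using q_le[of 0 0] by simp
    then show ?thesis using True nonneg[of 0] by simp
  next
    case False
    have "q (cscale (1 / c) (cscale c f)) \<le> cmod (1 / c) * q (cscale c f)"
      using f False by (intro le) auto
    then have "cmod c * q f \<le> q (cscale c f)" using False by (simp add: norm_divide field_simps)
    then show ?thesis using le[OF f False] by simp
  qed
  show "q (f + g) \<le> q f + q g" if f: "f \<in> E" and g: "g \<in> E" for f g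
  proof -
    have "q (f + g) - q f \<le> q g"
    proof (rule q_greatest)
      fix m assume m: "m \<in> M"
      have "q (f + g) - N (g + m) \<le> q f"
      proof (rule q_greatest)
        fix n assume n: "n \<in> M"
        have "q (f + g) \<le> N ((f + g) + (n + m))" using f g m n by (intro q_le) auto
        also have "(f + g) + (n + m) = (f + n) + (g + m)" by (simp add: algebra_simps)
        also have "N \<dots> \<le> N (f + n) + N (g + m)" using f g m n by (intro N.p_triangle) auto
        finally show "q (f + g) - N (g + m) \<le> N (f + n)" by (simp only: diff_le_eq)
      qed
      then show "q (f + g) - q f \<le> N (g + m)" by (simp only: diff_le_eq add.commute)
    qed
    then show ?thesis by (simp only: diff_le_eq add.commute)
  qed
qed

lemma q_M: "m \<in> M \<Longrightarrow> q m = 0"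
  using q_le[of m "- m"] Q.p_nonneg[of m] by simp

lemma q_eq_0: 
  assumes f: "f \<in> E" shows "q f = 0 \<longleftrightarrow> f \<in> M"
proof
  assume q0: "q f = 0"
  interpret Metric_space E "norm_dist E N" using subspace norm_on by (rule Metric_space_norm_dist)
  show "f \<in> M"
  proof (rule ccontr)
    assume "f \<notin> M"
    then obtain r where r: "r > 0" "disjnt M (mball f r)"
      using M_closed f unfolding closedin_metric by blast
    have "r \<le> q f"
    proof (rule q_greatest)
      fix m assume m: "m \<in> M"
      then have "- m \<notin> mball f r" using r(2) by (auto simp: disjnt_iff)
      then show "r \<le> N (f + m)" using f m by (simp add: norm_dist_def)
    qed
    then show False using q0 r by simp
  qed
qed (rule q_M)

lemma coset_eq: "f +o M = g +o M \<longleftrightarrow> f - g \<in> M"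
proof
  assume "f +o M = g +o M"
  moreover have "f \<in> f +o M" using M_zero by (force simp: elt_set_plus_def)
  ultimately obtain m where "m \<in> M" "f = g + m" by (auto simp: elt_set_plus_def)
  then show "f - g \<in> M" by simp
next
  assume d: "f - g \<in> M"
  have "f + m = g + ((f - g) + m)" "g + m = f + (m - (f - g))" for m by simp_all
  then show "f +o M = g +o M"
    using d M_add M_diff unfolding elt_set_plus_def by blast
qed

lemma M_nonvanishing:
  assumes a: "a \<in> disc" obtains g where "g \<in> M" "g a = 1"
proof -
  obtain f where f: "f \<in> M" "f \<noteq> 0" using M_nonzero M_zero by blast
  obtain g where g: "g \<in> M" "g a \<noteq> 0"
    using exists_nonvanishing[of M a f] M_div a f E_hol unfolding division_property_def by (metis M_E subsetI)
  show thesis using g by (intro that[of "cscale (1 / g a) g"]) (auto simp: cscale_apply)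
qed

text \<open>A fixed element of \<open>M\<close> with the value \<open>1\<close> at \<open>0\<close>.\<close>

definition f0 :: "complex \<Rightarrow> complex" where "f0 = (SOME f. f \<in> M \<and> f 0 = 1)"

lemma f0[simp]: "f0 \<in> M" "f0 0 = 1"
proof -
  have "\<exists>f. f \<in> M \<and> f 0 = 1" using M_nonvanishing[of 0] by auto
  from someI_ex[OF this] show "f0 \<in> M" "f0 0 = 1" unfolding f0_def by auto
qed

text \<open>A linear lift of \<open>U\<close> to \<open>E\<close>: the function \<open>f - f(0) f0\<close> represents the same coset as \<open>f\<close>, vanishes
  at \<open>0\<close>, and is therefore \<open>S\<close> applied to \<open>U_lift f\<close>.\<close>

definition U_lift :: "(complex \<Rightarrow> complex) \<Rightarrow> (complex \<Rightarrow> complex)" where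
  "U_lift f = bshift (f - cscale (f 0) f0)"

lemma U_lift_mem[simp]: "f \<in> E \<Longrightarrow> U_lift f \<in> E" by (simp add: U_lift_def)

lemma U_lift_add: "f \<in> E \<Longrightarrow> g \<in> E \<Longrightarrow> U_lift (f + g) = U_lift f + U_lift g"
proof -
  assume fg: "f \<in> E" "g \<in> E"
  have "f + g - cscale ((f + g) 0) f0 = (f - cscale (f 0) f0) + (g - cscale (g 0) f0)"
    by (simp add: cfun.scale_left_distrib)
  then show ?thesis unfolding U_lift_def using fg by (simp only: bshift_linear N.mem_diff N.mem_scale M_E f0)
qed

lemma U_lift_scale: "f \<in> E \<Longrightarrow> U_lift (cscale c f) = cscale c (U_lift f)"
proof -
  assume f: "f \<in> E"
  have "cscale c f - cscale ((cscale c f) 0) f0 = cscale c (f - cscale (f 0) f0)"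
    by (simp add: cfun.scale_right_diff_distrib cscale_apply)
  then show ?thesis using f by (simp add: U_lift_def bshift_linear)
qed

lemma U_lift_diff: "f \<in> E \<Longrightarrow> g \<in> E \<Longrightarrow> U_lift (f - g) = U_lift f - U_lift g"
  using U_lift_add[of f "- g"] U_lift_scale[of g "-1"] by simp

lemma U_lift_M[simp]: "m \<in> M \<Longrightarrow> U_lift m \<in> M"
proof -
  assume m: "m \<in> M"
  let ?g = "m - cscale (m 0) f0"
  have g: "?g \<in> M" "?g 0 = 0" using m by (auto simp: cscale_apply)
  then have "divide_zero 0 ?g \<in> M" using M_div unfolding division_property_def by force
  then show ?thesis using g(2) by (simp add: U_lift_def bshift_def cscale_apply)
qed

lemma U_lift_shift: "f \<in> E \<Longrightarrow> U_lift (shift f) = f"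
  using bshift_shift[OF E_hol, of f] by (simp add: U_lift_def shift_def)

lemma U_coset:
  assumes f: "f \<in> E" shows "U (f +o M) = U_lift f +o M"
proof -
  let ?g = "f - cscale (f 0) f0"
  have "?g 0 = 0" by (simp add: cscale_apply)
  then have "shift (U_lift f) = ?g"
    using shift_bshift[OF E_hol, of ?g] f by (simp add: U_lift_def)
  moreover have "f +o M = ?g +o M" unfolding coset_eq by simp
  ultimately show ?thesis using U_shift[of "U_lift f"] f by simp
qed

lemma U_pow_coset: "f \<in> E \<Longrightarrow> (U ^^ n) (f +o M) = (U_lift ^^ n) f +o M"
proof (induction n)
  case (Suc n)
  have "(U_lift ^^ n) f \<in> E" using Suc.prems by (induction n) auto
  then show ?case using Suc U_coset by simp
qed simp

lemma U_lift_bounded: "\<exists>K. K > 0 \<and> (\<forall>f\<in>E. q (U_lift f) \<le> K * q f)"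
proof -
  obtain C where C: "C > 0" "\<And>a f. a \<in> disc \<Longrightarrow> f \<in> E \<Longrightarrow> cmod (f a) \<le> C * Delta E N (cmod a) * N f"
    using evaluation_bound by blast
  define K where "K = norm_T * (1 + C * Delta E N 0 * N f0)"
  have D: "Delta E N 0 \<ge> 1" by (rule Delta_ge_1) auto
  have K: "K > 0" unfolding K_def using norm_T(1) C(1) D N.p_nonneg[of f0]
    by (intro mult_pos_pos add_pos_nonneg mult_nonneg_nonneg) auto
  have NU: "N (U_lift f) \<le> K * N f" if f: "f \<in> E" for f
  proof -
    have "N (U_lift f) \<le> norm_T * N (f - cscale (f 0) f0)" unfolding U_lift_def using f by (intro norm_T) simp
    also have "\<dots> \<le> norm_T * (N f + cmod (f 0) * N f0)"
      using norm_T(1) N.p_diff[of f "cscale (f 0) f0"] f by (simp add: N.p_scale)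
    also have "\<dots> \<le> norm_T * (N f + (C * Delta E N 0 * N f) * N f0)"
      using norm_T(1) C(2)[of 0 f] f N.p_nonneg[of f0]
      by (intro mult_left_mono add_left_mono mult_right_mono) auto
    also have "\<dots> = K * N f" by (simp add: K_def algebra_simps)
    finally show ?thesis .
  qed
  have "q (U_lift f) \<le> K * q f" if f: "f \<in> E" for f
  proof -
    have "q (U_lift f) / K \<le> q f"
    proof (rule q_greatest)
      fix m assume m: "m \<in> M"
      have "q (U_lift f) = q (U_lift (f + m))"
        using f m by (intro Q.p_eq_of_null) (auto simp: U_lift_add q_M Q.p_minus)
      also have "\<dots> \<le> K * N (f + m)" using q_le_N[of "U_lift (f + m)"] NU[of "f + m"] f m by simp
      finally show "q (U_lift f) / K \<le> N (f + m)" using K by (simp add: field_simps)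
    qed
    then show ?thesis using K by (simp add: field_simps)
  qed
  then show ?thesis using K by blast
qed

text \<open>A bound for \<open>U_lift\<close> with respect to \<open>q\<close>.\<close>

definition norm_U :: real where "norm_U = (SOME K. K > 0 \<and> (\<forall>f\<in>E. q (U_lift f) \<le> K * q f))"

sublocale UQ: seminormed_operator cscale E q U_lift norm_U
  using someI_ex[OF U_lift_bounded, folded norm_U_def]
  by unfold_locales (auto simp: U_lift_add U_lift_scale)

lemma U_lift_resolvent_eq:
  assumes "w \<in> E" "y \<in> E" "m \<in> M" "shift w - cscale a w = y - m"
  shows "w - cscale a (U_lift w) - U_lift y \<in> M"
proof -
  have "w - cscale a (U_lift w) = U_lift (shift w - cscale a w)"
    using assms(1) by (simp add: U_lift_diff U_lift_scale U_lift_shift)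
  also have "\<dots> = U_lift y - U_lift m" unfolding assms(4) using assms by (simp add: U_lift_diff)
  finally show ?thesis using assms(3) by simp
qed

text \<open>To solve \<open>w - a U w = h\<close> modulo \<open>M\<close>, divide \<open>S h - (S h)(a) g\<close> by \<open>z - a\<close>, where \<open>g\<close> in \<open>M\<close> has the
  value \<open>1\<close> at \<open>a\<close>; note that \<open>U_lift (S h) = h\<close>.\<close>

lemma U_lift_resolvent_surj:
  assumes a: "a \<in> disc"
  obtains C where "C > 0" "\<And>h. h \<in> E \<Longrightarrow> \<exists>w\<in>E. w - cscale a (U_lift w) - h \<in> M \<and> N w \<le> C * N h"
proof -
  obtain g where g: "g \<in> M" "g a = 1" using M_nonvanishing[OF a] .
  let ?D = "Delta E N (cmod a)"
  have D: "?D \<ge> 1" using a by (intro Delta_ge_1) auto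
  obtain C where C: "C > 0" "\<And>f. f \<in> E \<Longrightarrow> cmod (f a) \<le> C * ?D * N f"
    using evaluation_bound a by metis
  define K where "K = ?D * (norm_T * (norm_S + C * ?D * norm_S * N g))"
  have K: "K > 0" unfolding K_def using D norm_T(1) norm_S(1) C(1) N.p_nonneg[of g] g
    by (intro mult_pos_pos add_pos_nonneg mult_nonneg_nonneg) auto
  show thesis
  proof (rule that[OF K])
    fix h assume h: "h \<in> E"
    define f where "f = shift h - cscale (shift h a) g"
    have f: "f \<in> E" "f a = 0" using h g by (auto simp: f_def cscale_apply)
    obtain w where w: "w \<in> E" "w - cscale a (bshift w) = bshift f" "N w \<le> ?D * N (bshift f)"
      using Delta_resolvent[OF a bshift_mem[OF f(1)]] .
    have eq: "shift w - cscale a w = shift h - cscale (shift h a) g"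
      using resolvent_shift[OF a f(1) w(1,2)] f(2) by (simp add: f_def)
    have "w - cscale a (U_lift w) - h \<in> M"
      using U_lift_resolvent_eq[OF w(1) shift_mem[OF h] M_scale[OF g(1)] eq] unfolding U_lift_shift[OF h] .
    moreover have "N w \<le> K * N h"
    proof -
      have "N (shift h) \<le> norm_S * N h" by (rule norm_S(2)[OF h])
      moreover have "cmod (shift h a) * N g \<le> (C * ?D * (norm_S * N h)) * N g"
        using C D g N.p_nonneg[of g] norm_S(2)[OF h] h
        by (intro mult_right_mono order_trans[OF C(2)] mult_left_mono) auto
      moreover have "N f \<le> N (shift h) + cmod (shift h a) * N g"
        unfolding f_def using N.p_diff[of "shift h" "cscale (shift h a) g"] h g by (simp add: N.p_scale)
      ultimately have "N f \<le> (norm_S + C * ?D * norm_S * N g) * N h" by (simp add: algebra_simps)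
      then have "norm_T * N f \<le> norm_T * ((norm_S + C * ?D * norm_S * N g) * N h)"
        using norm_T(1) by (intro mult_left_mono) auto
      then have "N (bshift f) \<le> norm_T * ((norm_S + C * ?D * norm_S * N g) * N h)"
        using norm_T(2)[OF f(1)] by linarith
      then have "?D * N (bshift f) \<le> ?D * (norm_T * ((norm_S + C * ?D * norm_S * N g) * N h))"
        using D by (intro mult_left_mono) auto
      then show ?thesis using w(3) by (simp add: K_def mult.assoc)
    qed
    ultimately show "\<exists>w\<in>E. w - cscale a (U_lift w) - h \<in> M \<and> N w \<le> K * N h" using w(1) by blast
  qed
qed

text \<open>\<open>M\<close> need not be invariant under \<open>S\<close>, so that \<open>U\<close> itself need not be injective. With
  \<open>m = v - a U_lift v\<close>, the identity \<open>(z - a) (v - m) = a (m - v(0) f0)\<close> exhibits \<open>v - m\<close> as the quotient by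
  \<open>z - a\<close> of an element of \<open>M\<close> that vanishes at \<open>a\<close>.\<close>

lemma U_lift_resolvent_inj:
  assumes a: "a \<in> disc" and v: "v \<in> E" and M: "v - cscale a (U_lift v) \<in> M"
  shows "v \<in> M"
proof (cases "a = 0")
  case True then show ?thesis using M by simp
next
  case False
  define m where "m = v - cscale a (U_lift v)"
  define n where "n = cscale a (m - cscale (v 0) f0)"
  have n: "n \<in> M" using M by (simp add: n_def m_def)
  let ?g = "v - cscale (v 0) f0"
  have sh: "shift (U_lift v) = ?g"
    using shift_bshift[OF E_hol, of ?g] v by (simp add: U_lift_def cscale_apply)
  have eq: "(z - a) * (v z - m z) = n z" for z
  proof -
    have "a * (z * U_lift v z) = a * (v z - v 0 * f0 z)" 
      using fun_cong[OF sh, of z] by (simp add: shift_def cscale_apply)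
    then show ?thesis by (simp add: n_def m_def cscale_apply algebra_simps)
  qed
  have na: "n a = 0" using eq[of a] by simp
  have dz: "divide_zero a n \<in> M" using M_div n a na unfolding division_property_def by blast
  have "v - m = divide_zero a n"
  proof -
    have vm: "v - m \<in> hol_disc" "divide_zero a n \<in> hol_disc" using E_hol v M dz by (auto simp: m_def)
    have off: "(v - m) z = divide_zero a n z" if "z \<noteq> a" for z
      using eq[of z] that by (simp add: divide_zero_def field_simps)
    have cont: "isCont (v - m) a" "isCont (divide_zero a n) a"
      using vm[THEN hol_discD(1), THEN holomorphic_on_imp_continuous_on] a
        continuous_on_eq_continuous_at[OF open_ball] by blast+
    have "((v - m) \<longlongrightarrow> divide_zero a n a) (at a)"
      using cont(2) unfolding isCont_def
      by (rule Lim_transform_eventually) (unfold eventually_at_filter, intro always_eventually allI impI, metis off)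
    then have "(v - m) a = divide_zero a n a"
      using cont(1) unfolding isCont_def using LIM_unique by blast
    then show ?thesis using off by (metis ext)
  qed
  then have "v = m + divide_zero a n" by (simp add: algebra_simps)
  then show "v \<in> M" using M_add[OF M[folded m_def] dz] by metis
qed

lemma U_lift_resolvent_bound:
  assumes a: "a \<in> disc" shows "\<exists>C. UQ.resolvent_bound C a"
proof -
  obtain C where C: "C > 0" "\<And>h. h \<in> E \<Longrightarrow> \<exists>w\<in>E. w - cscale a (U_lift w) - h \<in> M \<and> N w \<le> C * N h"
    using U_lift_resolvent_surj[OF a] by blast
  have "q y \<le> C * q (y - cscale a (U_lift y))" if y: "y \<in> E" for y
  proof -
    define h where "h = y - cscale a (U_lift y)"
    have "q y / C \<le> q h"
    proof (rule q_greatest)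
      fix m assume m: "m \<in> M"
      have hE: "h + m \<in> E" using y m by (simp add: h_def)
      obtain w where w: "w \<in> E" "w - cscale a (U_lift w) - (h + m) \<in> M" "N w \<le> C * N (h + m)"
        using C(2)[OF hE] by blast
      have "(y - w) - cscale a (U_lift (y - w)) = - ((w - cscale a (U_lift w) - (h + m)) + m)"
        using y w(1) by (simp add: h_def U_lift_diff cfun.scale_right_diff_distrib)
      also have "\<dots> \<in> M" using w(2) m by (intro M_minus M_add)
      finally have "y - w \<in> M" using U_lift_resolvent_inj[OF a N.mem_diff[OF y w(1)]] by blast
      then have "q y = q w" using y w(1) q_M Q.p_eq_of_null by blast
      also have "\<dots> \<le> C * N (h + m)" using q_le_N[OF w(1)] w(3) by linarith
      finally show "q y / C \<le> N (h + m)" using C(1) by (simp add: field_simps)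
    qed
    then show ?thesis using C(1) by (simp add: field_simps h_def)
  qed
  then show ?thesis unfolding UQ.resolvent_bound_def by blast
qed

lemma U_lift_power_tends_to_zero:
  assumes "0 \<le> s" "s < 1" "e > 0"
  shows "\<forall>\<^sub>F k in sequentially. \<forall>f\<in>E. s ^ k * q ((U_lift ^^ k) f) \<le> e * q f"
proof (rule UQ.power_tends_to_zero)
  show "\<exists>C. UQ.resolvent_bound C a" if "cmod a < 1" for a
    using U_lift_resolvent_bound that by simp
  show "\<exists>y\<in>E. q (y - cscale a (U_lift y) - h) = 0" if "cmod a < 1" "h \<in> E" for a h
  proof -
    have "a \<in> disc" using that by simp
    then obtain C where "\<And>h. h \<in> E \<Longrightarrow> \<exists>w\<in>E. w - cscale a (U_lift w) - h \<in> M \<and> N w \<le> C * N h"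
      using U_lift_resolvent_surj by blast
    then show ?thesis using that(2) q_M by blast
  qed
qed (use assms in auto)

end

section \<open>The resolvent series\<close>

text \<open>For a subspace \<open>M\<close>, operations on cosets are operations on representatives.\<close>

lemma coset_add:
  assumes M: "cfun.subspace M"
  shows "(f +o M) + (g +o M) = (f + g) +o (M :: (complex \<Rightarrow> complex) set)"
proof -
  have "M + M = M"
  proof
    show "M + M \<subseteq> M" using cfun.subspace_add[OF M] by (auto simp: set_plus_def)
    show "M \<subseteq> M + M"
    proof
      fix m assume "m \<in> M"
      then have "m + 0 \<in> M + M" using cfun.subspace_0[OF M] by (intro set_plus_intro)
      then show "m \<in> M + M" by simp
    qed
  qed
  then show ?thesis by (simp add: set_plus_rearrange)
qed

lemma quot_scale_coset:
  assumes M: "cfun.subspace M"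
  shows "quot_scale M c (f +o M) = cscale c f +o M"
proof -
  have "cscale c ` (f +o M) + M = cscale c f +o (cscale c ` M + M)"
    unfolding elt_set_plus_def set_plus_def by (force simp: cfun.scale_right_distrib add.assoc)
  moreover have "cscale c ` M + M = M"
  proof
    show "cscale c ` M + M \<subseteq> M"
      using cfun.subspace_add[OF M] cfun.subspace_scale[OF M] by (auto simp: set_plus_def)
    show "M \<subseteq> cscale c ` M + M"
    proof
      fix m assume "m \<in> M"
      then have "cscale c 0 + m \<in> cscale c ` M + M" using cfun.subspace_0[OF M] by (intro set_plus_intro) auto
      then show "m \<in> cscale c ` M + M" by simp
    qed
  qed
  ultimately show ?thesis by (simp add: quot_scale_def)
qed

context division_quotient
begin

text \<open>A representative of \<open>U^(n+1) \<pi>(1)\<close>.\<close>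

definition orbit_vec :: "nat \<Rightarrow> complex \<Rightarrow> complex" where "orbit_vec n = (U_lift ^^ Suc n) const_one"

lemma orbit_vec_mem[simp]: "orbit_vec n \<in> E" unfolding orbit_vec_def by (rule UQ.A_pow_mem) simp

lemma orbit_vec_pow: "orbit_vec n = (U_lift ^^ n) (orbit_vec 0)"
  by (simp add: orbit_vec_def funpow_swap1)

lemma U_pow_one: "(U ^^ Suc n) (const_one +o M) = orbit_vec n +o M"
  unfolding orbit_vec_def by (rule U_pow_coset) simp

lemma U_term_eq: "U_term M U l n = cscale (l ^ n) (orbit_vec n) +o M"
  unfolding U_term_def U_pow_one by (rule quot_scale_coset[OF M_subspace])

lemma sum_U_term: "(\<Sum>n\<le>k. U_term M U l n) = (\<Sum>n<Suc k. cscale (l ^ n) (orbit_vec n)) +o M"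
proof (induction k)
  case (Suc k)
  have "(\<Sum>n\<le>Suc k. U_term M U l n) = (\<Sum>n\<le>k. U_term M U l n) + U_term M U l (Suc k)" by simp
  also have "\<dots> = ((\<Sum>n<Suc k. cscale (l ^ n) (orbit_vec n)) + cscale (l ^ Suc k) (orbit_vec (Suc k))) +o M"
    unfolding Suc by (unfold U_term_eq, rule coset_add[OF M_subspace])
  also have "(\<Sum>n<Suc k. cscale (l ^ n) (orbit_vec n)) + cscale (l ^ Suc k) (orbit_vec (Suc k)) = (\<Sum>n<Suc (Suc k). cscale (l ^ n) (orbit_vec n))"
    by simp
  finally show ?case .
qed (simp add: U_term_eq)

lemma quot_dist_coset:
  assumes "f \<in> E" "g \<in> E"
  shows "quot_dist E N M (f +o M) (g +o M) = q (f - g)"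
proof -
  have "(f +o M) + quot_scale M (- 1) (g +o M) = (f - g) +o M"
    by (simp add: quot_scale_coset[OF M_subspace] coset_add[OF M_subspace])
  then show ?thesis using assms by (simp add: quot_dist_def q_def quot_def)
qed

lemma Metric_space_quot: "Metric_space (quot E M) (quot_dist E N M)"
proof
  have q0: "0 \<le> q f" "q (- f) = q f" if "f \<in> E" for f
    using that Q.p_nonneg Q.p_minus by auto
  show "0 \<le> quot_dist E N M x y" for x y
  proof (cases "x \<in> quot E M \<and> y \<in> quot E M")
    case True
    then show ?thesis using Q.p_nonneg by (auto simp: quot_def quot_dist_coset)
  qed (auto simp: quot_dist_def)
  show "quot_dist E N M x y = quot_dist E N M y x" for x y
  proof (cases "x \<in> quot E M \<and> y \<in> quot E M")
    case True
    then obtain f g where "x = f +o M" "y = g +o M" "f \<in> E" "g \<in> E" by (auto simp: quot_def)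
    then show ?thesis using Q.p_minus[of "f - g"] by (simp add: quot_dist_coset)
  qed (auto simp: quot_dist_def)
  fix x y z assume "x \<in> quot E M" "y \<in> quot E M"
  then obtain f g where fg: "x = f +o M" "y = g +o M" "f \<in> E" "g \<in> E" by (auto simp: quot_def)
  then show "quot_dist E N M x y = 0 \<longleftrightarrow> x = y" by (simp add: quot_dist_coset q_eq_0 coset_eq)
  assume "z \<in> quot E M"
  then obtain h where h: "z = h +o M" "h \<in> E" by (auto simp: quot_def)
  show "quot_dist E N M x z \<le> quot_dist E N M x y + quot_dist E N M y z"
    using fg h Q.p_triangle[of "f - g" "g - h"] by (simp add: quot_dist_coset)
qed

text \<open>A representative \<open>X\<close> of the sum of the resolvent series at \<open>l\<close>. The last conjunct is the basic estimate
  \<open>\<bar>f l\<bar> \<parallel>F l\<parallel> \<le> \<Delta>(\<bar>l\<bar>) \<parallel>T f\<parallel>\<close>.\<close>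

lemma resolvent_vector_exists:
  assumes l: "l \<in> disc"
  shows "\<exists>X. X \<in> E \<and> (\<lambda>k. q ((\<Sum>n<k. cscale (l ^ n) (orbit_vec n)) - X)) \<longlonglongrightarrow> 0 \<and>
    (\<forall>f\<in>M. cmod (f l) * q X \<le> Delta E N (cmod l) * N (bshift f))"
proof -
  obtain X where X: "X \<in> E" "X - cscale l (U_lift X) - orbit_vec 0 \<in> M"
    using U_lift_resolvent_surj[OF l] orbit_vec_mem[of 0] by metis
  have eq: "q ((\<Sum>n<k. cscale (l ^ n) (orbit_vec n)) - X) = cmod l ^ k * q ((U_lift ^^ k) X)" for k
  proof -
    let ?r = "X - cscale l (U_lift X)"
    have rE: "?r \<in> E" using X(1) by simp
    have pow: "(U_lift ^^ n) m \<in> M" if "m \<in> M" for m n using that by (induction n) auto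
    have G: "(\<Sum>n<k. cscale (l ^ n) ((U_lift ^^ n) ?r)) = X - cscale (l ^ k) ((U_lift ^^ k) X)"
      by (rule UQ.geometric_telescope'[OF X(1)])
    have SG: "(\<Sum>n<k. cscale (l ^ n) (orbit_vec n)) - (\<Sum>n<k. cscale (l ^ n) ((U_lift ^^ n) ?r))
       = - (\<Sum>n<k. cscale (l ^ n) ((U_lift ^^ n) (?r - orbit_vec 0)))"
    proof -
      have e: "cscale (l ^ n) (orbit_vec n) - cscale (l ^ n) ((U_lift ^^ n) ?r) = - cscale (l ^ n) ((U_lift ^^ n) (?r - orbit_vec 0))" for n
      proof -
        have "(U_lift ^^ n) (?r - orbit_vec 0) = (U_lift ^^ n) ?r - (U_lift ^^ n) (orbit_vec 0)" by (rule UQ.A_pow_diff[OF rE orbit_vec_mem])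
        also have "(U_lift ^^ n) (orbit_vec 0) = orbit_vec n" by (rule orbit_vec_pow[symmetric])
        finally have eq: "(U_lift ^^ n) (?r - orbit_vec 0) = (U_lift ^^ n) ?r - orbit_vec n" .
        show ?thesis unfolding eq cfun.scale_right_diff_distrib by (rule minus_diff_eq[symmetric])
      qed
      have "(\<Sum>n<k. cscale (l ^ n) (orbit_vec n)) - (\<Sum>n<k. cscale (l ^ n) ((U_lift ^^ n) ?r))
        = (\<Sum>n<k. cscale (l ^ n) (orbit_vec n) - cscale (l ^ n) ((U_lift ^^ n) ?r))"
        by (rule sum_subtractf[symmetric])
      also have "\<dots> = (\<Sum>n<k. - cscale (l ^ n) ((U_lift ^^ n) (?r - orbit_vec 0)))" by (rule sum.cong[OF refl e])
      also have "\<dots> = - (\<Sum>n<k. cscale (l ^ n) ((U_lift ^^ n) (?r - orbit_vec 0)))" by (rule sum_negf)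
      finally show ?thesis .
    qed
    have D: "(\<Sum>n<k. cscale (l ^ n) ((U_lift ^^ n) (?r - orbit_vec 0))) \<in> M"
      using pow X(2) by (intro cfun.subspace_sum[OF M_subspace] M_scale) auto
    have alg: "s - x - (- b) = s - (x - b)" for s x b :: "complex \<Rightarrow> complex" by simp
    have "((\<Sum>n<k. cscale (l ^ n) (orbit_vec n)) - X) - (- cscale (l ^ k) ((U_lift ^^ k) X))
      = (\<Sum>n<k. cscale (l ^ n) (orbit_vec n)) - (\<Sum>n<k. cscale (l ^ n) ((U_lift ^^ n) ?r))"
      unfolding G by (rule alg)
    then have "((\<Sum>n<k. cscale (l ^ n) (orbit_vec n)) - X) - (- cscale (l ^ k) ((U_lift ^^ k) X)) \<in> M"
      unfolding SG using M_minus[OF D] by (simp only:)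
    then have "q ((\<Sum>n<k. cscale (l ^ n) (orbit_vec n)) - X) = q (- cscale (l ^ k) ((U_lift ^^ k) X))"
      using X(1) by (intro Q.p_eq_of_null q_M) (auto intro!: Q.mem_sum N.mem_diff)
    then show ?thesis using X(1) by (simp add: Q.p_minus Q.p_scale norm_power)
  qed
  have "(\<lambda>k. cmod l ^ k * q ((U_lift ^^ k) X)) \<longlonglongrightarrow> 0"
    using l X(1) by (intro UQ.orbit_tendsto_zero U_lift_power_tends_to_zero) auto
  then have lim: "(\<lambda>k. q ((\<Sum>n<k. cscale (l ^ n) (orbit_vec n)) - X)) \<longlonglongrightarrow> 0"
    unfolding eq .
  have "cmod (f l) * q X \<le> Delta E N (cmod l) * N (bshift f)" if f: "f \<in> M" for f
  proof -
    have fE: "f \<in> E" using f by simp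
    obtain w where w: "w \<in> E" "w - cscale l (bshift w) = bshift f" "N w \<le> Delta E N (cmod l) * N (bshift f)"
      using Delta_resolvent[OF l bshift_mem[OF fE]] .
    have "shift w - cscale l w = - cscale (f l) const_one - (- f)"
      unfolding resolvent_shift[OF l fE w(1,2)] by simp
    from U_lift_resolvent_eq[OF w(1) _ _ this]
    have 1: "w - cscale l (U_lift w) - U_lift (- cscale (f l) const_one) \<in> M" using f by simp
    have A0: "orbit_vec 0 = U_lift const_one" by (simp add: orbit_vec_def)
    have 2: "U_lift (- cscale (f l) const_one) = - cscale (f l) (orbit_vec 0)"
      unfolding A0 using UQ.A_minus[of "cscale (f l) const_one"] U_lift_scale by simp
    let ?v = "w + cscale (f l) X"
    have 3: "?v - cscale l (U_lift ?v) = (w - cscale l (U_lift w) - U_lift (- cscale (f l) const_one))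
       + cscale (f l) (X - cscale l (U_lift X) - orbit_vec 0)"
      unfolding 2 using w(1) X(1)
      by (simp add: U_lift_add U_lift_scale cfun.scale_right_distrib cfun.scale_right_diff_distrib mult.commute)
    have "?v - cscale l (U_lift ?v) \<in> M" unfolding 3 by (intro M_add M_scale 1 X(2))
    then have "?v \<in> M" by (rule U_lift_resolvent_inj[OF l N.mem_add[OF w(1) N.mem_scale[OF X(1)]]])
    then have "q w = q (- cscale (f l) X)"
      using w(1) X(1) by (intro Q.p_eq_of_null q_M) auto
    then have "cmod (f l) * q X = q w" using X(1) by (simp add: Q.p_minus Q.p_scale)
    also have "\<dots> \<le> N w" using w(1) by (rule q_le_N)
    finally show ?thesis using w(3) by simp
  qed
  then show ?thesis using X(1) lim by blast
qed

text \<open>A choice of such a representative.\<close>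

definition resolvent_vec :: "complex \<Rightarrow> complex \<Rightarrow> complex" where
  "resolvent_vec l = (SOME X. X \<in> E \<and> (\<lambda>k. q ((\<Sum>n<k. cscale (l ^ n) (orbit_vec n)) - X)) \<longlonglongrightarrow> 0 \<and>
    (\<forall>f\<in>M. cmod (f l) * q X \<le> Delta E N (cmod l) * N (bshift f)))"

lemma resolvent_vec:
  assumes "l \<in> disc"
  shows "resolvent_vec l \<in> E" "(\<lambda>k. q ((\<Sum>n<k. cscale (l ^ n) (orbit_vec n)) - resolvent_vec l)) \<longlonglongrightarrow> 0"
    "f \<in> M \<Longrightarrow> cmod (f l) * q (resolvent_vec l) \<le> Delta E N (cmod l) * N (bshift f)"
  using someI_ex[OF resolvent_vector_exists[OF assms]] unfolding resolvent_vec_def[symmetric] by auto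

lemma partial_sum_mem[simp]: "(\<Sum>n<k. cscale (z n) (orbit_vec n)) \<in> E"
  by (intro Q.mem_sum) auto

lemma quot_sums_resolvent_vec:
  assumes l: "l \<in> disc" shows "quot_sums E N M (U_term M U l) (resolvent_vec l +o M)"
proof -
  interpret QM: Metric_space "quot E M" "quot_dist E N M" by (rule Metric_space_quot)
  have "(\<lambda>k. q ((\<Sum>n<Suc k. cscale (l ^ n) (orbit_vec n)) - resolvent_vec l)) \<longlonglongrightarrow> 0"
    using resolvent_vec(2)[OF l] by (rule LIMSEQ_Suc)
  then show ?thesis
    unfolding quot_sums_def QM.limitin_metric_dist_null sum_U_term
    using resolvent_vec(1)[OF l] partial_sum_mem[of "\<lambda>n. l ^ n"] by (auto simp: quot_def quot_dist_coset simp del: sum.lessThan_Suc)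
qed

lemma quot_suminf_resolvent_vec:
  assumes l: "l \<in> disc" shows "quot_norm N (quot_suminf E N M (U_term M U l)) = q (resolvent_vec l)"
proof -
  interpret QM: Metric_space "quot E M" "quot_dist E N M" by (rule Metric_space_quot)
  have "quot_suminf E N M (U_term M U l) = resolvent_vec l +o M"
    unfolding quot_suminf_def
  proof (rule the_equality)
    show "quot_sums E N M (U_term M U l) (resolvent_vec l +o M)" by (rule quot_sums_resolvent_vec[OF l])
    show "x = resolvent_vec l +o M" if "quot_sums E N M (U_term M U l) x" for x
      using that quot_sums_resolvent_vec[OF l] unfolding quot_sums_def
      by (metis QM.limitin_metric_unique sequentially_bot)
  qed
  then show ?thesis by (simp add: q_def)
qed

text \<open>A functional of norm at most \<open>1\<close> that is \<open>q Y\<close> at \<open>Y\<close>, applied to the resolvent series; \<open>c n\<close> is its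
  value at \<open>orbit_vec n\<close>. The last property says that it is almost \<open>q Y\<close> at finite sums near \<open>Y\<close>.\<close>

lemma scalarization:
  assumes Y: "Y \<in> E"
  obtains c \<Phi> where "\<Phi> holomorphic_on disc" "\<And>l. l \<in> disc \<Longrightarrow> (\<lambda>n. c n * l ^ n) sums \<Phi> l"
    "\<And>l. l \<in> disc \<Longrightarrow> cmod (\<Phi> l) \<le> q (resolvent_vec l)"
    "\<And>k z. q Y - q ((\<Sum>n<k. cscale (z n) (orbit_vec n)) - Y) \<le> Re (\<Sum>n<(k::nat). z n * c n)"
proof -
  obtain c where c: "\<And>k z t. Re (\<Sum>n<k. z n * c n) + t * q Y \<le> q ((\<Sum>n<(k::nat). cscale (z n) (orbit_vec n)) + cscale (of_real t) Y)"
    using Q.Hahn_Banach_sequence[OF Y, of orbit_vec] by (metis orbit_vec_mem)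
  have norm_le: "cmod (\<Sum>n<k. z n * c n) \<le> q (\<Sum>n<k. cscale (z n) (orbit_vec n))" for k z
  proof -
    define s where "s = (\<Sum>n<k. z n * c n)"
    define u where "u = (if s = 0 then 1 else cnj s / of_real (cmod s))"
    have us: "u * s = of_real (cmod s)"
      by (simp add: u_def complex_norm_square[symmetric] power2_eq_square field_simps)
    have nu: "cmod u = 1" by (simp add: u_def norm_divide)
    have "(\<Sum>n<k. (u * z n) * c n) = u * s" by (simp add: s_def sum_distrib_left mult.assoc)
    then have "cmod s \<le> q (\<Sum>n<k. cscale (u * z n) (orbit_vec n))"
      using c[where z = "\<lambda>n. u * z n" and k = k and t = 0] us by simp
    also have "(\<Sum>n<k. cscale (u * z n) (orbit_vec n)) = cscale u (\<Sum>n<k. cscale (z n) (orbit_vec n))"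
      by (simp add: cfun.scale_sum_right)
    also have "q \<dots> = q (\<Sum>n<k. cscale (z n) (orbit_vec n))" by (simp add: Q.p_scale nu)
    finally show ?thesis by (simp add: s_def)
  qed
  have cA: "cmod (c n) \<le> q (orbit_vec n)" for n
  proof -
    define z where "z = (\<lambda>i. if i = n then 1 else (0::complex))"
    have 1: "(\<Sum>i<Suc n. z i * c i) = c n" by (simp add: z_def)
    have 2: "(\<Sum>i<Suc n. cscale (z i) (orbit_vec i)) = orbit_vec n" by (simp add: z_def)
    show ?thesis using norm_le[where z = z and k = "Suc n"] unfolding 1 2 .
  qed
  have summ: "summable (\<lambda>n. c n * l ^ n)" if l: "l \<in> disc" for l
  proof -
    define s where "s = (cmod l + 1) / 2"
    have s: "cmod l < s" "s < 1" "0 < s" using l norm_ge_zero[of l] unfolding s_def by (auto simp del: norm_ge_zero)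
    have "\<forall>\<^sub>F k in sequentially. \<forall>f\<in>E. s ^ k * q ((U_lift ^^ k) f) \<le> 1 * q f"
      using s by (intro U_lift_power_tends_to_zero) auto
    then have ev: "\<forall>\<^sub>F k in sequentially. norm (c k * l ^ k) \<le> q (orbit_vec 0) * (cmod l / s) ^ k"
    proof eventually_elim
      case (elim k)
      have "norm (c k * l ^ k) = cmod (c k) * cmod l ^ k" by (simp add: norm_mult norm_power)
      also have "\<dots> \<le> q (orbit_vec k) * cmod l ^ k" using cA by (intro mult_right_mono) auto
      also have "\<dots> = (s ^ k * q (orbit_vec k)) * (cmod l / s) ^ k" using s by (simp add: power_divide)
      also have "\<dots> \<le> q (orbit_vec 0) * (cmod l / s) ^ k"
        using elim orbit_vec_mem[of 0] orbit_vec_pow[of k] s by (intro mult_right_mono) auto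
      finally show ?case .
    qed
    show ?thesis
      by (rule summable_comparison_test_ev[OF ev]) (use s in \<open>auto intro!: summable_mult summable_geometric\<close>)
  qed
  define \<Phi> where "\<Phi> = (\<lambda>l. \<Sum>n. c n * l ^ n)"
  have sums: "(\<lambda>n. c n * l ^ n) sums \<Phi> l" if "l \<in> disc" for l
    unfolding \<Phi>_def using summ[OF that] by (rule summable_sums)
  show thesis
  proof (rule that[of \<Phi> c])
    show "\<Phi> holomorphic_on disc"
      by (rule power_series_holomorphic[of 0 1 c]) (use sums in auto)
    show "(\<lambda>n. c n * l ^ n) sums \<Phi> l" if "l \<in> disc" for l using sums[OF that] .
    show "cmod (\<Phi> l) \<le> q (resolvent_vec l)" if l: "l \<in> disc" for l
    proof -
      have le: "cmod (\<Sum>n<k. c n * l ^ n) \<le> q (resolvent_vec l) + q ((\<Sum>n<k. cscale (l ^ n) (orbit_vec n)) - resolvent_vec l)" for k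
      proof -
        have "cmod (\<Sum>n<k. c n * l ^ n) \<le> q (\<Sum>n<k. cscale (l ^ n) (orbit_vec n))"
          using norm_le[where z = "\<lambda>n. l ^ n" and k = k] by (simp add: mult.commute)
        also have "\<dots> = q (resolvent_vec l + ((\<Sum>n<k. cscale (l ^ n) (orbit_vec n)) - resolvent_vec l))" by simp
        also have "\<dots> \<le> q (resolvent_vec l) + q ((\<Sum>n<k. cscale (l ^ n) (orbit_vec n)) - resolvent_vec l)"
          using resolvent_vec(1)[OF l] by (intro Q.p_triangle) auto
        finally show ?thesis .
      qed
      have "(\<lambda>k. cmod (\<Sum>n<k. c n * l ^ n)) \<longlonglongrightarrow> cmod (\<Phi> l)"
        using sums[OF l] by (intro tendsto_norm) (simp add: sums_def)
      moreover have "(\<lambda>k. q (resolvent_vec l) + q ((\<Sum>n<k. cscale (l ^ n) (orbit_vec n)) - resolvent_vec l)) \<longlonglongrightarrow> q (resolvent_vec l) + 0"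
        by (intro tendsto_intros resolvent_vec(2)[OF l])
      ultimately have "cmod (\<Phi> l) \<le> q (resolvent_vec l) + 0"
        by (rule LIMSEQ_le) (use le in blast)
      then show ?thesis by simp
    qed
    fix k :: nat and z :: "nat \<Rightarrow> complex"
    have "Re (\<Sum>n<k. (- z n) * c n) + 1 * q Y \<le> q ((\<Sum>n<k. cscale (- z n) (orbit_vec n)) + cscale (of_real 1) Y)"
      by (rule c)
    also have "(\<Sum>n<k. cscale (- z n) (orbit_vec n)) + cscale (of_real 1) Y = - ((\<Sum>n<k. cscale (z n) (orbit_vec n)) - Y)"
      by (simp add: sum_negf)
    also have "q \<dots> = q ((\<Sum>n<k. cscale (z n) (orbit_vec n)) - Y)" using Y by (intro Q.p_minus) simp
    finally show "q Y - q ((\<Sum>n<k. cscale (z n) (orbit_vec n)) - Y) \<le> Re (\<Sum>n<k. z n * c n)"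
      by (simp add: sum_negf)
  qed
qed

lemma scalarization_at:
  assumes l: "l \<in> disc"
  obtains \<Phi> where "\<Phi> holomorphic_on disc" "\<And>l. l \<in> disc \<Longrightarrow> cmod (\<Phi> l) \<le> q (resolvent_vec l)" "q (resolvent_vec l) \<le> cmod (\<Phi> l)"
proof -
  obtain c \<Phi> where \<Phi>: "\<Phi> holomorphic_on disc" "\<And>l. l \<in> disc \<Longrightarrow> (\<lambda>n. c n * l ^ n) sums \<Phi> l"
    "\<And>l. l \<in> disc \<Longrightarrow> cmod (\<Phi> l) \<le> q (resolvent_vec l)"
    "\<And>k z. q (resolvent_vec l) - q ((\<Sum>n<k. cscale (z n) (orbit_vec n)) - resolvent_vec l) \<le> Re (\<Sum>n<(k::nat). z n * c n)"
    by (rule scalarization[OF resolvent_vec(1)[OF l]]) (rule that, assumption+)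
  have "(\<lambda>k. q (resolvent_vec l) - q ((\<Sum>n<k. cscale (l ^ n) (orbit_vec n)) - resolvent_vec l)) \<longlonglongrightarrow> q (resolvent_vec l) - 0"
    by (intro tendsto_intros resolvent_vec(2)[OF l])
  moreover have "(\<lambda>k. Re (\<Sum>n<k. l ^ n * c n)) \<longlonglongrightarrow> Re (\<Phi> l)"
    using \<Phi>(2)[OF l] by (intro tendsto_Re) (simp add: sums_def mult.commute)
  ultimately have "q (resolvent_vec l) - 0 \<le> Re (\<Phi> l)"
    by (rule LIMSEQ_le) (use \<Phi>(4)[where z = "\<lambda>n. l ^ n"] in blast)
  then have "q (resolvent_vec l) \<le> cmod (\<Phi> l)" using complex_Re_le_cmod[of "\<Phi> l"] by linarith
  then show thesis using \<Phi> that by blast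
qed

text \<open>Cauchy's estimate for the vector-valued function \<open>resolvent_vec\<close>, through a functional that attains \<open>q (orbit_vec n)\<close>.\<close>

lemma coefficient_bound:
  assumes r: "0 < r" "r < 1" and B: "\<And>l. cmod l = r \<Longrightarrow> q (resolvent_vec l) \<le> B"
  shows "q (orbit_vec n) \<le> B / r ^ n"
proof -
  obtain c \<Phi> where \<Phi>: "\<Phi> holomorphic_on disc" "\<And>l. l \<in> disc \<Longrightarrow> (\<lambda>n. c n * l ^ n) sums \<Phi> l"
    "\<And>l. l \<in> disc \<Longrightarrow> cmod (\<Phi> l) \<le> q (resolvent_vec l)"
    "\<And>k z. q (orbit_vec n) - q ((\<Sum>n<k. cscale (z n) (orbit_vec n)) - orbit_vec n) \<le> Re (\<Sum>n<(k::nat). z n * c n)"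
    by (rule scalarization[OF orbit_vec_mem[of n]]) (rule that, assumption+)
  define z where "z = (\<lambda>i. if i = n then 1 else (0::complex))"
  have 1: "(\<Sum>i<Suc n. z i * c i) = c n" by (simp add: z_def)
  have 2: "(\<Sum>i<Suc n. cscale (z i) (orbit_vec i)) = orbit_vec n" by (simp add: z_def)
  have "q (orbit_vec n) \<le> Re (c n)" using \<Phi>(4)[where k = "Suc n" and z = z] unfolding 1 2 by simp
  also have "\<dots> \<le> cmod (c n)" by (rule complex_Re_le_cmod)
  finally have qc: "q (orbit_vec n) \<le> cmod (c n)" .
  have "\<Phi> has_fps_expansion Abs_fps c"
  proof (rule has_fps_expansionI)
    have "\<forall>\<^sub>F u in nhds 0. u \<in> disc" by (intro eventually_nhds_in_open) auto
    then show "\<forall>\<^sub>F u in nhds 0. (\<lambda>n. fps_nth (Abs_fps c) n * u ^ n) sums \<Phi> u"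
      by eventually_elim (simp add: \<Phi>(2))
  qed
  from fps_nth_fps_expansion[OF this, of n] have cn: "c n = (deriv ^^ n) \<Phi> 0 / fact n" by simp
  have "cmod ((deriv ^^ n) \<Phi> 0) \<le> fact n * B / r ^ n"
  proof (rule Cauchy_inequality)
    show "\<Phi> holomorphic_on ball 0 r" using \<Phi>(1) by (rule holomorphic_on_subset) (use r in auto)
    show "continuous_on (cball 0 r) \<Phi>"
      by (rule continuous_on_subset[OF holomorphic_on_imp_continuous_on[OF \<Phi>(1)]]) (use r in auto)
    show "cmod (\<Phi> x) \<le> B" if "cmod (0 - x) = r" for x
      using \<Phi>(3)[of x] B[of x] that r by simp
  qed (use r in auto)
  then have "cmod (c n) \<le> B / r ^ n"
    unfolding cn norm_divide using divide_right_mono[of _ "fact n * B / r ^ n" "fact n :: real"] by force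
  then show ?thesis using qc by linarith
qed

text \<open>The division theorem for \<open>f0\<close> and the scalarized resolvent series.\<close>

lemma resolvent_growth:
  obtains \<kappa> where "\<kappa> \<ge> 0" "\<And>e l R. e > 0 \<Longrightarrow> 0 < cmod l \<Longrightarrow> cmod l < 1 \<Longrightarrow>
     R = cmod l powr (1 / (1 + e)) \<Longrightarrow> 1 / 2 \<le> R \<Longrightarrow> 1 - R powr (1 + e / 2) \<le> 1 / 4 \<Longrightarrow>
     q (resolvent_vec l) \<le> exp (8 * (1 + 1 / e) * (\<kappa> + 64 * (1 + 2 / e)\<^sup>2 *
        weight_integral E N e (cmod l) * (weight_integral E N e (cmod l) + 1)) / (1 - cmod l))"
proof -
  obtain C where C: "C > 0" "\<And>a f. a \<in> disc \<Longrightarrow> f \<in> E \<Longrightarrow> cmod (f a) \<le> C * Delta E N (cmod a) * N f"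
    using evaluation_bound by blast
  define C' where "C' = max 1 (max (C * N f0) (N (bshift f0)))"
  define L where "L = (\<lambda>t. ln (Delta E N t))"
  define \<kappa> where "\<kappa> = ln C' + L (3 / 4)"
  have C': "C' \<ge> 1" "C * N f0 \<le> C'" "N (bshift f0) \<le> C'" by (auto simp: C'_def)
  have L0: "0 \<le> L t" if "0 \<le> t" "t < 1" for t using Delta_ge_1[OF that] by (simp add: L_def)
  have Lmono: "L s \<le> L t" if "0 \<le> s" "s \<le> t" "t < 1" for s t
    using Delta_mono[OF that] Delta_ge_1[of s] that by (simp add: L_def)
  have \<kappa>: "\<kappa> \<ge> 0" using C' L0[of "3/4"] by (simp add: \<kappa>_def)
  have expL: "exp (ln C' + L t) = C' * Delta E N t" if "0 \<le> t" "t < 1" for t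
    using Delta_ge_1[OF that] C' by (simp add: exp_add L_def)
  have "q (resolvent_vec l) \<le> exp (8 * (1 + 1 / e) * (\<kappa> + 64 * (1 + 2 / e)\<^sup>2 *
        weight_integral E N e (cmod l) * (weight_integral E N e (cmod l) + 1)) / (1 - cmod l))"
    if e: "e > 0" and l: "0 < cmod l" "cmod l < 1" and R: "R = cmod l powr (1 / (1 + e))" "1 / 2 \<le> R"
      "1 - R powr (1 + e / 2) \<le> 1 / 4" for e l R
  proof (cases "q (resolvent_vec l) = 0")
    case True then show ?thesis by simp
  next
    case False
    have ld: "l \<in> disc" using l by simp
    have qpos: "q (resolvent_vec l) > 0" using False Q.p_nonneg[OF resolvent_vec(1)[OF ld]] by simp
    obtain \<Phi> where \<Phi>: "\<Phi> holomorphic_on disc" "\<And>l. l \<in> disc \<Longrightarrow> cmod (\<Phi> l) \<le> q (resolvent_vec l)" "q (resolvent_vec l) \<le> cmod (\<Phi> l)"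
      using scalarization_at[OF ld] by blast
    define I where "I = weight_integral E N e (cmod l)"
    have I: "I = integral {0..R} (\<lambda>t. sqrt (L t / (1 - t)))"
      unfolding I_def weight_integral_def R(1) weight_def L_def ..
    have R1: "R < 1" unfolding R(1) using l e powr01_less_one[of "cmod l" "1 / (1 + e)"] by simp
    have lR: "cmod l = R powr (1 + e)" unfolding R(1) using l e by (simp add: powr_powr)
    have f0_bound: "cmod (f0 z) \<le> exp (ln C' + L (cmod z))" if z: "z \<in> disc" for z
    proof -
      have D: "Delta E N (cmod z) \<ge> 1" using z by (intro Delta_ge_1) auto
      have "cmod (f0 z) \<le> C * N f0 * Delta E N (cmod z)" using C(2)[OF z, of f0] by (simp add: mult.commute mult.left_commute)
      also have "\<dots> \<le> C' * Delta E N (cmod z)" using C'(2) D by (intro mult_right_mono) auto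
      finally show ?thesis using z by (subst expL) auto
    qed
    have \<Phi>_bound: "cmod (\<Phi> z * f0 z) \<le> exp (ln C' + L (cmod z))" if z: "z \<in> disc" for z
    proof -
      have D: "Delta E N (cmod z) \<ge> 1" using z by (intro Delta_ge_1) auto
      have "cmod (\<Phi> z * f0 z) \<le> q (resolvent_vec z) * cmod (f0 z)"
        unfolding norm_mult using \<Phi>(2)[OF z] by (intro mult_right_mono) auto
      also have "\<dots> \<le> Delta E N (cmod z) * N (bshift f0)"
        using resolvent_vec(3)[OF z, of f0] by (simp add: mult.commute)
      also have "\<dots> \<le> Delta E N (cmod z) * C'" using C'(3) D by (intro mult_left_mono) auto
      finally show ?thesis using z by (subst expL) (auto simp: mult.commute)
    qed
    have f0h: "f0 holomorphic_on disc" using hol_discD(1)[OF E_hol, of f0] by simp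
    have "ln (cmod (\<Phi> l)) \<le> (ln C' + L (3 / 4) - ln (cmod (f0 0)) + 64 * (1 + 2 / e)\<^sup>2 * I * (I + 1)) * (4 / (1 - R powr (e / 2)))"
      by (rule division_integral[OF f0h \<Phi>(1) f0_bound \<Phi>_bound _ Lmono L0 e R(2) R1 R(3) lR I]) auto
    then have 1: "ln (q (resolvent_vec l)) \<le> (\<kappa> + 64 * (1 + 2 / e)\<^sup>2 * I * (I + 1)) * (4 / (1 - R powr (e / 2)))"
    proof -
      have "ln (q (resolvent_vec l)) \<le> ln (cmod (\<Phi> l))" using \<Phi>(3) qpos by (intro ln_mono) auto
      moreover have "ln (cmod (f0 0)) = 0" by simp
      ultimately show ?thesis using \<open>ln (cmod (\<Phi> l)) \<le> _\<close> unfolding \<kappa>_def by simp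
    qed
    have wI: "I \<ge> 0" unfolding I
    proof (rule integral_nonneg)
      show "(\<lambda>t. sqrt (L t / (1 - t))) integrable_on {0..R}"
        using R1 by (intro integrable_on_mono_on) 
          (auto simp: mono_on_def intro!: real_sqrt_le_mono frac_le Lmono L0)
    qed (use R1 L0 in auto)
    have c: "4 / (1 - R powr (e / 2)) \<le> 8 * (1 + 1 / e) / (1 - cmod l)"
    proof -
      have e2: "R powr (e / 2) < 1" using R(2) R1 e powr01_less_one[of R "e / 2"] by auto
      have "1 - cmod l \<le> (1 + e) / (e / 2) * (1 - R powr (e / 2))"
        unfolding lR using R(2) R1 e by (intro one_minus_powr_le) auto
      also have "(1 + e) / (e / 2) = 2 * (1 + 1 / e)" using e by (simp add: field_simps)
      finally have "4 * (1 - cmod l) \<le> 4 * (2 * (1 + 1 / e) * (1 - R powr (e / 2)))"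
        by (rule mult_left_mono) simp
      then have "4 * (1 - cmod l) \<le> 8 * (1 + 1 / e) * (1 - R powr (e / 2))"
        by (simp only: mult.assoc[symmetric]) 
      then show ?thesis using l e2 by (simp add: pos_divide_le_eq pos_le_divide_eq)
    qed
    have "(\<kappa> + 64 * (1 + 2 / e)\<^sup>2 * I * (I + 1)) * (4 / (1 - R powr (e / 2)))
       \<le> (\<kappa> + 64 * (1 + 2 / e)\<^sup>2 * I * (I + 1)) * (8 * (1 + 1 / e) / (1 - cmod l))"
      using \<kappa> wI by (intro mult_left_mono[OF c] add_nonneg_nonneg mult_nonneg_nonneg) auto
    then have "ln (q (resolvent_vec l)) \<le> 8 * (1 + 1 / e) * (\<kappa> + 64 * (1 + 2 / e)\<^sup>2 * I * (I + 1)) / (1 - cmod l)"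
      using 1 by (simp add: mult.commute)
    then have "exp (ln (q (resolvent_vec l))) \<le> exp (8 * (1 + 1 / e) * (\<kappa> + 64 * (1 + 2 / e)\<^sup>2 * I * (I + 1)) / (1 - cmod l))"
      by (simp only: exp_le_cancel_iff)
    then show ?thesis using qpos by (simp only: exp_ln I_def)
  qed
  then show thesis using that \<kappa> by blast
qed

end

section \<open>Growth of the resolvent series and of the powers\<close>

context disc_space
begin

lemma weight_nonneg: "0 \<le> t \<Longrightarrow> t < 1 \<Longrightarrow> 0 \<le> weight E N t"
  using Delta_ge_1[of t] by (simp add: weight_def)

lemma weight_mono: "0 \<le> s \<Longrightarrow> s \<le> t \<Longrightarrow> t < 1 \<Longrightarrow> weight E N s \<le> weight E N t"
  unfolding weight_def using Delta_ge_1[of s] Delta_mono[of s t]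
  by (intro real_sqrt_le_mono frac_le) auto

lemma weight_integrable: "R < 1 \<Longrightarrow> weight E N integrable_on {0..R}"
  by (rule integrable_on_mono_on) (auto simp: mono_on_def intro: weight_mono)

lemma nn_integral_weight:
  assumes "R < 1"
  shows "(\<integral>\<^sup>+t\<in>{0..R}. ennreal (weight E N t) \<partial>lborel) = ennreal (integral {0..R} (weight E N))"
proof -
  have "(\<integral>\<^sup>+t. ennreal (indicator {0..R} t * weight E N t) \<partial>lborel) = ennreal (integral {0..R} (weight E N))"
    using assms by (intro nn_integral_has_integral_lebesgue integrable_integral weight_integrable weight_nonneg) auto
  moreover have "ennreal (indicator {0..R} t * weight E N t) = ennreal (weight E N t) * indicator {0..R} t" for t
    by (simp split: split_indicator)
  ultimately show ?thesis by simp
qed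

lemma integral_weight_nonneg: "R < 1 \<Longrightarrow> 0 \<le> integral {0..R} (weight E N)"
  by (intro integral_nonneg weight_integrable weight_nonneg) auto

lemma integral_weight_mono:
  "0 \<le> R \<Longrightarrow> R \<le> R' \<Longrightarrow> R' < 1 \<Longrightarrow> integral {0..R} (weight E N) \<le> integral {0..R'} (weight E N)"
  by (intro integral_subset_le weight_integrable ballI weight_nonneg) auto

lemma integral_weight_bounded:
  assumes "(\<integral>\<^sup>+t\<in>{0..<1}. ennreal (weight E N t) \<partial>lborel) < \<infinity>"
  obtains B where "0 \<le> B" "\<And>R. R < 1 \<Longrightarrow> integral {0..R} (weight E N) \<le> B"
proof -
  obtain B where B: "0 \<le> B" "(\<integral>\<^sup>+t\<in>{0..<1}. ennreal (weight E N t) \<partial>lborel) = ennreal B"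
    using assms by (cases "\<integral>\<^sup>+t\<in>{0..<1}. ennreal (weight E N t) \<partial>lborel") auto
  have "integral {0..R} (weight E N) \<le> B" if R: "R < 1" for R
  proof -
    have "ennreal (integral {0..R} (weight E N)) \<le> ennreal B"
      unfolding nn_integral_weight[OF R, symmetric] B(2)[symmetric]
      using R by (intro nn_integral_mono) (auto split: split_indicator)
    then show ?thesis using B(1) by (simp add: ennreal_le_iff)
  qed
  then show thesis using that B(1) by blast
qed

lemma integral_weight_unbounded:
  assumes inf: "(\<integral>\<^sup>+t\<in>{0..<1}. ennreal (weight E N t) \<partial>lborel) = \<infinity>"
  obtains R0 where "0 \<le> R0" "R0 < 1" "\<And>R. R0 \<le> R \<Longrightarrow> R < 1 \<Longrightarrow> B \<le> integral {0..R} (weight E N)"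
proof -
  have "\<exists>R0. 0 \<le> R0 \<and> R0 < 1 \<and> B \<le> integral {0..R0} (weight E N)"
  proof (rule ccontr)
    assume "\<not> ?thesis"
    then have lt: "integral {0..R} (weight E N) \<le> B" if "0 \<le> R" "R < 1" for R
      using that by force
    define a where "a = (\<lambda>n. 1 - inverse (real (Suc n)))"
    have a: "0 \<le> a n" "a n < 1" for n by (auto simp: a_def field_simps)
    have a_mono: "a m \<le> a n" if "m \<le> n" for m n using that by (simp add: a_def frac_le inverse_eq_divide)
    define F where "F = (\<lambda>n t. ennreal (weight E N t) * indicator {0..a n} t)"
    have meas: "F n \<in> borel_measurable lborel" for n
    proof -
      have "mono_on {0..a n} (weight E N)" using a by (auto simp: mono_on_def intro!: weight_mono intro: le_less_trans)
      then have "weight E N \<in> borel_measurable (restrict_space borel {0..a n})"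
        by (rule borel_measurable_mono_on_fnc)
      then have "(\<lambda>t. ennreal (weight E N t)) \<in> borel_measurable (restrict_space borel {0..a n})" by simp
      then show ?thesis unfolding F_def
        by (subst (asm) borel_measurable_restrict_space_iff_ennreal) auto
    qed
    have incF: "incseq F"
      unfolding incseq_def le_fun_def F_def using a_mono
      by (auto split: split_indicator intro: order_trans)
    have sup: "(SUP n. F n t) = ennreal (weight E N t) * indicator {0..<1} t" for t
    proof (rule antisym)
      show "(SUP n. F n t) \<le> ennreal (weight E N t) * indicator {0..<1} t"
        unfolding F_def using a(2) by (intro SUP_least) (auto split: split_indicator intro: le_less_trans)
      show "ennreal (weight E N t) * indicator {0..<1} t \<le> (SUP n. F n t)"
      proof (cases "t \<in> {0..<1}")
        case True
        have "a \<longlonglongrightarrow> 1 - 0"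
          unfolding a_def by (intro tendsto_diff tendsto_const LIMSEQ_inverse_real_of_nat)
        then have "\<forall>\<^sub>F n in sequentially. t < a n" using True by (intro order_tendstoD) auto
        then obtain n where "t < a n" by (auto simp: eventually_sequentially)
        then have "ennreal (weight E N t) * indicator {0..<1} t \<le> F n t" using True by (auto simp: F_def)
        also have "\<dots> \<le> (SUP n. F n t)" by (rule SUP_upper) simp
        finally show ?thesis .
      qed auto
    qed
    have "(\<integral>\<^sup>+t\<in>{0..<1}. ennreal (weight E N t) \<partial>lborel) = (SUP n. \<integral>\<^sup>+t. F n t \<partial>lborel)"
      unfolding sup[symmetric] by (rule nn_integral_monotone_convergence_SUP[OF incF meas])
    also have "\<dots> \<le> ennreal B"
    proof (rule SUP_least)
      fix n
      show "(\<integral>\<^sup>+t. F n t \<partial>lborel) \<le> ennreal B"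
        unfolding F_def nn_integral_weight[OF a(2)] using lt[OF a] by (rule ennreal_leI)
    qed
    finally show False using inf by (simp add: top_unique)
  qed
  then obtain R0 where "0 \<le> R0" "R0 < 1" "B \<le> integral {0..R0} (weight E N)" by blast
  then show thesis using integral_weight_mono by (intro that[of R0]) (auto intro: order_trans)
qed

end

lemma log_plus_eq: "log_plus x = (if x > 0 then max (ln x) 0 else 0)"
  by (auto simp: log_plus_def elog_def max_def zero_ereal_def)

lemma log_plus_le:
  assumes "x \<le> exp y" "0 \<le> y" shows "0 \<le> log_plus x" "log_plus x \<le> y"
proof -
  show "0 \<le> log_plus x" by (simp add: log_plus_eq)
  show "log_plus x \<le> y"
  proof (cases "x > 0")
    case True
    then have "ln x \<le> y" using assms by (metis ln_exp ln_mono)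
    then show ?thesis using True assms by (simp add: log_plus_eq)
  qed (use assms in \<open>simp add: log_plus_eq\<close>)
qed

lemma eventually_to_circleI:
  assumes "t < 1" "\<And>l. t < cmod l \<Longrightarrow> cmod l < 1 \<Longrightarrow> P l"
  shows "\<forall>\<^sub>F l in to_circle. P l"
proof -
  have "\<forall>\<^sub>F s in at_left (1::real). t < s \<and> s < 1"
    using assms(1) by (intro eventually_conj eventually_at_left_1 eventually_at_leftI[of t]) auto
  then show ?thesis unfolding to_circle_def eventually_filtercomap using assms(2) by blast
qed

text \<open>The left-hand side is the constant that results from \<open>resolvent_growth\<close> once the weight integral exceeds
  \<open>1\<close> and \<open>\<kappa>\<close>.\<close>

lemma C_const_lower:
  assumes e: "e > 0" shows "1032 * (1 + 1 / e) * (1 + 2 / e)\<^sup>2 \<le> C_const e"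
proof -
  define x where "x = (26 * pi + 3 / 2) * (2 + 1 / e)"
  have "(78::real) * 2 \<le> x" unfolding x_def
    using pi_gt3 e by (intro mult_mono) auto
  then have ex: "157 \<le> exp x" using exp_ge_add_one_self[of x] by linarith
  have "54 / pi \<ge> (54::real) / 4" using pi_less_4 pi_gt_zero by (intro divide_left_mono) auto
  then have "54 / 4 * (1 + 44 / 5 * 157) \<le> 54 / pi * (1 + 44 / 5 * exp x)"
    using ex by (intro mult_mono) auto
  moreover have "(4128::real) \<le> 54 / 4 * (1 + 44 / 5 * 157)" by simp
  ultimately have c: "4128 \<le> 54 / pi * (1 + 44 / 5 * exp x)" by (rule order_trans[rotated])
  have "(1 + 2 / e)\<^sup>2 \<le> (2 * (1 / e + 2 / 3))\<^sup>2" using e by (intro power_mono) (auto simp: field_simps)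
  then have sq: "(1 + 2 / e)\<^sup>2 \<le> 4 * (1 / e + 2 / 3)\<^sup>2" by (subst (asm) power_mult_distrib) simp
  have "1032 * (1 + 1 / e) * (1 + 2 / e)\<^sup>2 \<le> 1032 * (1 + 1 / e) * (4 * (1 / e + 2 / 3)\<^sup>2)"
    using e by (intro mult_left_mono[OF sq]) auto
  also have "\<dots> = 4128 * ((1 + 1 / e) * (1 / e + 2 / 3)\<^sup>2)" by simp
  also have "\<dots> \<le> (54 / pi * (1 + 44 / 5 * exp x)) * ((1 + 1 / e) * (1 / e + 2 / 3)\<^sup>2)"
    using e by (intro mult_right_mono[OF c]) auto
  also have "(1 + 1 / e) * (1 / e + 2 / 3)\<^sup>2 = (1 / e ^ 3) * (1 + e) * (1 + 2 * e / 3)\<^sup>2"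
  proof -
    have "1 + 1 / e = (1 + e) / e" "1 / e + 2 / 3 = (1 + 2 * e / 3) / e" using e by (simp_all add: field_simps)
    then show ?thesis by (simp add: power_divide power2_eq_square power3_eq_cube)
  qed
  also have "(54 / pi * (1 + 44 / 5 * exp x)) * ((1 / e ^ 3) * (1 + e) * (1 + 2 * e / 3)\<^sup>2) = C_const e"
    unfolding C_const_def x_def by (simp only: mult_ac)
  finally show ?thesis .
qed

lemma C_const_pos: "e > 0 \<Longrightarrow> C_const e > 0"
  by (rule less_le_trans[OF _ C_const_lower]) (intro mult_pos_pos zero_less_power add_pos_pos, auto)

text \<open>The side conditions of \<open>resolvent_growth\<close> hold near the circle.\<close>

lemma near_circle:
  assumes e: "(e::real) > 0"
  obtains t0 where "0 < t0" "t0 < 1" "\<And>t. t0 < t \<Longrightarrow> t < 1 \<Longrightarrow> 1 / 2 \<le> t powr (1 / (1 + e)) \<and>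
    1 - (t powr (1 / (1 + e))) powr (1 + e / 2) \<le> 1 / 4"
proof (rule that[of "(3 / 4) powr ((1 + e) / (1 + e / 2))"])
  let ?t0 = "(3 / 4) powr ((1 + e) / (1 + e / 2)) :: real"
  show "0 < ?t0" by simp
  show "?t0 < 1" using e by (subst powr01_less_one) auto
  fix t :: real assume t: "?t0 < t" "t < 1"
  have t0: "t > 0" using t(1) by (rule less_trans[rotated]) simp
  let ?R = "t powr (1 / (1 + e))"
  have R: "0 < ?R" "?R \<le> 1" using t t0 e by (auto intro: powr_le1)
  have "3 / 4 = ?t0 powr ((1 + e / 2) / (1 + e))" using e by (simp add: powr_powr)
  also have "\<dots> \<le> t powr ((1 + e / 2) / (1 + e))" using t e by (intro powr_mono2) auto
  also have "\<dots> = ?R powr (1 + e / 2)" by (simp add: powr_powr)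
  finally have 1: "3 / 4 \<le> ?R powr (1 + e / 2)" .
  also have "\<dots> \<le> ?R" using R e powr_mono'[of 1 "1 + e / 2" ?R] by simp
  finally show "1 / 2 \<le> ?R \<and> 1 - ?R powr (1 + e / 2) \<le> 1 / 4" using 1 by simp
qed

context division_quotient
begin

lemma resolvent_bound_convergent:
  assumes fin: "(\<integral>\<^sup>+t\<in>{0..<1}. ennreal (weight E N t) \<partial>lborel) < \<infinity>"
  obtains K t0 where "0 \<le> K" "0 < t0" "t0 < 1"
    "\<And>l. t0 < cmod l \<Longrightarrow> cmod l < 1 \<Longrightarrow> q (resolvent_vec l) \<le> exp (K / (1 - cmod l))"
proof -
  obtain \<kappa> where \<kappa>: "\<kappa> \<ge> 0" and growth: "\<And>e l R. e > 0 \<Longrightarrow> 0 < cmod l \<Longrightarrow> cmod l < 1 \<Longrightarrow>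
     R = cmod l powr (1 / (1 + e)) \<Longrightarrow> 1 / 2 \<le> R \<Longrightarrow> 1 - R powr (1 + e / 2) \<le> 1 / 4 \<Longrightarrow>
     q (resolvent_vec l) \<le> exp (8 * (1 + 1 / e) * (\<kappa> + 64 * (1 + 2 / e)\<^sup>2 *
        weight_integral E N e (cmod l) * (weight_integral E N e (cmod l) + 1)) / (1 - cmod l))"
    by (rule resolvent_growth) (rule that, assumption+)
  obtain B where B: "0 \<le> B" "\<And>R. R < 1 \<Longrightarrow> integral {0..R} (weight E N) \<le> B"
    using integral_weight_bounded[OF fin] by blast
  obtain t0 :: real where t0: "0 < t0" "t0 < 1" "\<And>t. t0 < t \<Longrightarrow> t < 1 \<Longrightarrow> 1 / 2 \<le> t powr (1 / (1 + 1)) \<and>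
    1 - (t powr (1 / (1 + 1))) powr (1 + 1 / 2) \<le> 1 / 4" using near_circle[OF zero_less_one] by blast
  define K where "K = 8 * (1 + 1 / 1) * (\<kappa> + 64 * (1 + 2 / 1)\<^sup>2 * B * (B + 1))"
  show thesis
  proof (rule that[of K t0])
    show "0 \<le> K" using \<kappa> B(1) by (simp add: K_def)
    fix l :: complex assume l: "t0 < cmod l" "cmod l < 1"
    have lpos: "0 < cmod l" using l t0 by linarith
    let ?R = "cmod l powr (1 / (1 + 1))"
    have R1: "?R < 1" using l lpos by (subst powr01_less_one) auto
    let ?I = "weight_integral E N 1 (cmod l)"
    have I: "0 \<le> ?I" "?I \<le> B"
      unfolding weight_integral_def using integral_weight_nonneg[OF R1] B(2)[OF R1] by auto
    have "q (resolvent_vec l) \<le> exp (8 * (1 + 1 / 1) * (\<kappa> + 64 * (1 + 2 / 1)\<^sup>2 * ?I * (?I + 1)) / (1 - cmod l))"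
      using t0(3)[OF l] lpos l by (intro growth[of 1 l ?R]) auto
    also have "\<dots> \<le> exp (K / (1 - cmod l))"
      unfolding exp_le_cancel_iff K_def using I l
      by (intro divide_right_mono mult_left_mono add_left_mono mult_mono) auto
    finally show "q (resolvent_vec l) \<le> exp (K / (1 - cmod l))" .
  qed (use t0 in auto)
qed

lemma resolvent_bound_divergent:
  assumes inf: "(\<integral>\<^sup>+t\<in>{0..<1}. ennreal (weight E N t) \<partial>lborel) = \<infinity>" and e: "e > 0"
  obtains t0 where "0 < t0" "t0 < 1"
    "\<And>l. t0 < cmod l \<Longrightarrow> cmod l < 1 \<Longrightarrow> weight_integral E N e (cmod l) > 0"
    "\<And>l. t0 < cmod l \<Longrightarrow> cmod l < 1 \<Longrightarrow> q (resolvent_vec l) \<le> exp (C_const e * (weight_integral E N e (cmod l))\<^sup>2 / (1 - cmod l))"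
proof -
  obtain \<kappa> where \<kappa>: "\<kappa> \<ge> 0" and growth: "\<And>e l R. e > 0 \<Longrightarrow> 0 < cmod l \<Longrightarrow> cmod l < 1 \<Longrightarrow>
     R = cmod l powr (1 / (1 + e)) \<Longrightarrow> 1 / 2 \<le> R \<Longrightarrow> 1 - R powr (1 + e / 2) \<le> 1 / 4 \<Longrightarrow>
     q (resolvent_vec l) \<le> exp (8 * (1 + 1 / e) * (\<kappa> + 64 * (1 + 2 / e)\<^sup>2 *
        weight_integral E N e (cmod l) * (weight_integral E N e (cmod l) + 1)) / (1 - cmod l))"
    by (rule resolvent_growth) (rule that, assumption+)
  obtain R0 where R0: "0 \<le> R0" "R0 < 1" "\<And>R. R0 \<le> R \<Longrightarrow> R < 1 \<Longrightarrow> max 1 \<kappa> \<le> integral {0..R} (weight E N)"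
    using integral_weight_unbounded[OF inf] by blast
  obtain t1 where t1: "0 < t1" "t1 < 1" "\<And>t. t1 < t \<Longrightarrow> t < 1 \<Longrightarrow> 1 / 2 \<le> t powr (1 / (1 + e)) \<and>
    1 - (t powr (1 / (1 + e))) powr (1 + e / 2) \<le> 1 / 4" using near_circle[OF e] by blast
  define t0 where "t0 = max t1 R0"
  have I: "max 1 \<kappa> \<le> weight_integral E N e (cmod l)" if l: "t0 < cmod l" "cmod l < 1" for l
  proof -
    have "t1 < cmod l" using l by (simp add: t0_def)
    then have lpos: "0 < cmod l" using t1(1) by linarith
    have R1: "cmod l powr (1 / (1 + e)) < 1" using l lpos e by (subst powr01_less_one) auto
    have "cmod l \<le> cmod l powr (1 / (1 + e))"
      using powr_mono'[of "1 / (1 + e)" 1 "cmod l"] l lpos e by simp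
    then show ?thesis unfolding weight_integral_def using l R1 by (intro R0(3)) (auto simp: t0_def)
  qed
  show thesis
  proof (rule that[of t0])
    show "0 < t0" "t0 < 1" using t1 R0 by (auto simp: t0_def)
    fix l :: complex assume l: "t0 < cmod l" "cmod l < 1"
    let ?I = "weight_integral E N e (cmod l)"
    show Ipos: "?I > 0" using I[OF l] by linarith
    have "t1 < cmod l" using l by (simp add: t0_def)
    then have lpos: "0 < cmod l" "t1 < cmod l" using t1(1) by linarith+
    have "q (resolvent_vec l) \<le> exp (8 * (1 + 1 / e) * (\<kappa> + 64 * (1 + 2 / e)\<^sup>2 * ?I * (?I + 1)) / (1 - cmod l))"
      using t1(3)[OF lpos(2) l(2)] lpos l e by (intro growth[OF e]) auto
    also have "\<dots> \<le> exp (C_const e * ?I\<^sup>2 / (1 - cmod l))"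
      unfolding exp_le_cancel_iff
    proof (rule divide_right_mono)
      define c where "c = (1 + 2 / e)\<^sup>2"
      have c1: "1 \<le> c" unfolding c_def using e by (intro one_le_power) auto
      have I2: "?I \<le> ?I\<^sup>2" using I[OF l] by (intro self_le_power) auto
      have "\<kappa> \<le> 1 * ?I\<^sup>2" using I[OF l] I2 by linarith
      also have "\<dots> \<le> c * ?I\<^sup>2" using c1 by (intro mult_right_mono) auto
      finally have k: "\<kappa> \<le> c * ?I\<^sup>2" .
      have "64 * c * ?I * (?I + 1) = 64 * c * (?I\<^sup>2 + ?I)" by (simp add: power2_eq_square algebra_simps)
      also have "\<dots> \<le> 64 * c * (?I\<^sup>2 + ?I\<^sup>2)" using c1 I2 by (intro mult_left_mono add_left_mono) auto
      finally have "\<kappa> + 64 * c * ?I * (?I + 1) \<le> 129 * c * ?I\<^sup>2" using k by simp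
      then have "8 * (1 + 1 / e) * (\<kappa> + 64 * c * ?I * (?I + 1)) \<le> 8 * (1 + 1 / e) * (129 * c * ?I\<^sup>2)"
        using e by (intro mult_left_mono) auto
      also have "\<dots> = 1032 * (1 + 1 / e) * (1 + 2 / e)\<^sup>2 * ?I\<^sup>2" by (simp add: c_def)
      also have "\<dots> \<le> C_const e * ?I\<^sup>2" by (intro mult_right_mono C_const_lower[OF e]) auto
      finally show "8 * (1 + 1 / e) * (\<kappa> + 64 * (1 + 2 / e)\<^sup>2 * ?I * (?I + 1)) \<le> C_const e * ?I\<^sup>2"
        by (simp only: c_def)
    qed (use l in simp)
    finally show "q (resolvent_vec l) \<le> exp (C_const e * ?I\<^sup>2 / (1 - cmod l))" .
  qed
qed

lemma norm_U_pow_Suc: "quot_norm N ((U ^^ Suc n) (const_one +o M)) = q (orbit_vec n)"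
  unfolding U_pow_one q_def ..

lemma bigo_convergent:
  assumes fin: "(\<integral>\<^sup>+t\<in>{0..<1}. ennreal (weight E N t) \<partial>lborel) < \<infinity>"
  shows "(\<lambda>l. log_plus (quot_norm N (quot_suminf E N M (U_term M U l)))) \<in> O[to_circle](\<lambda>l. 1 / (1 - cmod l))"
    and "(\<lambda>n. log_plus (quot_norm N ((U ^^ n) (const_one +o M)))) \<in> O(\<lambda>n. sqrt (real n))"
proof -
  obtain K t0 where K: "0 \<le> K" "0 < t0" "t0 < 1"
    "\<And>l. t0 < cmod l \<Longrightarrow> cmod l < 1 \<Longrightarrow> q (resolvent_vec l) \<le> exp (K / (1 - cmod l))"
    using resolvent_bound_convergent[OF fin] by blast
  show "(\<lambda>l. log_plus (quot_norm N (quot_suminf E N M (U_term M U l)))) \<in> O[to_circle](\<lambda>l. 1 / (1 - cmod l))"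
  proof (rule bigoI[of _ K], rule eventually_to_circleI[OF K(3)])
    fix l :: complex assume l: "t0 < cmod l" "cmod l < 1"
    have "quot_norm N (quot_suminf E N M (U_term M U l)) \<le> exp (K / (1 - cmod l))"
      using K(4)[OF l] l by (subst quot_suminf_resolvent_vec) auto
    moreover have "0 \<le> K / (1 - cmod l)" using K l by simp
    ultimately show "norm (log_plus (quot_norm N (quot_suminf E N M (U_term M U l)))) \<le> K * norm (1 / (1 - cmod l))"
      using log_plus_le[of _ "K / (1 - cmod l)"] l by simp
  qed
  show "(\<lambda>n. log_plus (quot_norm N ((U ^^ n) (const_one +o M)))) \<in> O(\<lambda>n. sqrt (real n))"
  proof (rule bigoI[of _ "K + 2"])
    have "(\<lambda>n::nat. 1 - 1 / sqrt (real n)) \<longlonglongrightarrow> 1 - 0"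
      by (intro tendsto_diff tendsto_const tendsto_divide_0[OF tendsto_const] filterlim_at_top_imp_at_infinity
          filterlim_compose[OF sqrt_at_top] filterlim_real_sequentially)
    then have "\<forall>\<^sub>F n in sequentially. t0 < 1 - 1 / sqrt (real n)" using K(3) by (intro order_tendstoD) auto
    then show "\<forall>\<^sub>F n in sequentially. norm (log_plus (quot_norm N ((U ^^ n) (const_one +o M)))) \<le> (K + 2) * norm (sqrt (real n))"
      using eventually_ge_at_top[of 4]
    proof eventually_elim
      case (elim n)
      \<comment> \<open>Cauchy's estimate on the circle of radius \<open>1 - 1 / sqrt n\<close>\<close>
      define y where "y = 1 / sqrt (real n)"
      have sq2: "2 \<le> sqrt (real n)" using elim(2) real_sqrt_le_mono[of 4 "real n"] by simp
      have y: "0 < y" "y \<le> 1 / 2" using sq2 frac_le[of 1 1 2 "sqrt (real n)"] elim(2) by (auto simp: y_def)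
      obtain m where m: "n = Suc m" using elim(2) by (cases n) auto
      have ry: "1 - y > t0" using elim(1) by (simp add: y_def)
      have ny: "real n * y = sqrt (real n)" using elim(2) by (simp add: y_def real_div_sqrt)
      have "q (orbit_vec m) \<le> exp (K / y) / (1 - y) ^ m"
      proof (rule coefficient_bound)
        show "q (resolvent_vec l) \<le> exp (K / y)" if "cmod l = 1 - y" for l using K(4)[of l] that ry y by simp
      qed (use y in auto)
      also have "K / y = K * sqrt (real n)" by (simp add: y_def)
      also have "exp (K * sqrt (real n)) / (1 - y) ^ m \<le> exp (K * sqrt (real n)) / exp (- (2 * sqrt (real n)))"
      proof (rule divide_left_mono)
        have "exp (- (2 * sqrt (real n))) = exp (- (2 * y)) ^ n"
          using ny by (simp flip: exp_of_nat_mult add: mult.left_commute)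
        also have "\<dots> \<le> (1 - y) ^ n" using y by (intro power_mono exp_minus_le) auto
        also have "\<dots> \<le> (1 - y) ^ m" using y m by (intro power_decreasing) auto
        finally show "exp (- (2 * sqrt (real n))) \<le> (1 - y) ^ m" .
      qed (use y in auto)
      also have "\<dots> = exp ((K + 2) * sqrt (real n))" by (simp add: algebra_simps flip: exp_diff)
      finally have "quot_norm N ((U ^^ n) (const_one +o M)) \<le> exp ((K + 2) * sqrt (real n))"
        unfolding m norm_U_pow_Suc .
      moreover have "0 \<le> (K + 2) * sqrt (real n)" using K by simp
      ultimately show ?case using log_plus_le[of _ "(K + 2) * sqrt (real n)"] by simp
    qed
  qed
qed

lemma limsup_divergent:
  assumes inf: "(\<integral>\<^sup>+t\<in>{0..<1}. ennreal (weight E N t) \<partial>lborel) = \<infinity>" and e: "e > 0"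
  shows "Limsup to_circle
    (\<lambda>l. ereal (1 - cmod l) * elog (quot_norm N (quot_suminf E N M (U_term M U l))) *
       ereal (1 / (weight_integral E N e (cmod l))\<^sup>2)) \<le> ereal (C_const e)"
proof -
  obtain t0 where t0: "0 < t0" "t0 < 1"
    "\<And>l. t0 < cmod l \<Longrightarrow> cmod l < 1 \<Longrightarrow> weight_integral E N e (cmod l) > 0"
    "\<And>l. t0 < cmod l \<Longrightarrow> cmod l < 1 \<Longrightarrow> q (resolvent_vec l) \<le> exp (C_const e * (weight_integral E N e (cmod l))\<^sup>2 / (1 - cmod l))"
    using resolvent_bound_divergent[OF inf e] by blast
  show ?thesis
  proof (rule Limsup_bounded, rule eventually_to_circleI[OF t0(2)])
    fix l :: complex assume l: "t0 < cmod l" "cmod l < 1"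
    let ?I = "weight_integral E N e (cmod l)"
    have I: "?I > 0" using t0(3)[OF l] .
    have eq: "quot_norm N (quot_suminf E N M (U_term M U l)) = q (resolvent_vec l)"
      using l by (intro quot_suminf_resolvent_vec) auto
    show "ereal (1 - cmod l) * elog (quot_norm N (quot_suminf E N M (U_term M U l))) * ereal (1 / ?I\<^sup>2) \<le> ereal (C_const e)"
    proof (cases "q (resolvent_vec l) > 0")
      case True
      then have "ln (q (resolvent_vec l)) \<le> C_const e * ?I\<^sup>2 / (1 - cmod l)" using t0(4)[OF l] by (metis ln_exp ln_mono)
      then have "(1 - cmod l) * ln (q (resolvent_vec l)) * (1 / ?I\<^sup>2) \<le> C_const e"
        using l I by (simp add: field_simps)
      then show ?thesis using True by (simp add: eq elog_def)
    next
      case False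
      then show ?thesis using l I by (simp add: eq elog_def)
    qed
  qed
qed

lemma power_bound_divergent:
  assumes inf: "(\<integral>\<^sup>+t\<in>{0..<1}. ennreal (weight E N t) \<partial>lborel) = \<infinity>" and e: "e > 0"
  shows "\<forall>\<^sub>F n in sequentially.
    quot_norm N ((U ^^ n) (const_one +o M)) \<le> (INF r\<in>{0<..<1}. exp (L_fun E N e r) / r ^ n)"
proof -
  obtain t0 where t0: "0 < t0" "t0 < 1"
    "\<And>l. t0 < cmod l \<Longrightarrow> cmod l < 1 \<Longrightarrow> weight_integral E N e (cmod l) > 0"
    "\<And>l. t0 < cmod l \<Longrightarrow> cmod l < 1 \<Longrightarrow> q (resolvent_vec l) \<le> exp (C_const e * (weight_integral E N e (cmod l))\<^sup>2 / (1 - cmod l))"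
    using resolvent_bound_divergent[OF inf e] by blast
  have qA: "q (orbit_vec m) \<le> exp (C_const e * (weight_integral E N e r)\<^sup>2 / (1 - r)) / r ^ m" if r: "t0 < r" "r < 1" for m r
  proof (rule coefficient_bound)
    show "q (resolvent_vec l) \<le> exp (C_const e * (weight_integral E N e r)\<^sup>2 / (1 - r))" if "cmod l = r" for l
      using t0(4)[of l] that r by simp
  qed (use r t0 in auto)
  have C0: "C_const e > 0" by (rule C_const_pos[OF e])
  define s where "s = (t0 + 1) / 2"
  have s: "t0 < s" "s < 1" "0 < s" using t0 by (auto simp: s_def)
  define B where "B = exp (C_const e * (weight_integral E N e s)\<^sup>2 / (1 - s))"
  have B: "B > 0" by (simp add: B_def)
  have "(\<lambda>m. (t0 / s) ^ m) \<longlonglongrightarrow> 0" using t0 s by (intro LIMSEQ_realpow_zero) auto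
  then have "\<forall>\<^sub>F m in sequentially. (t0 / s) ^ m < 1 / B" using B by (intro order_tendstoD) auto
  then obtain m0 where m0: "\<And>m. m0 \<le> m \<Longrightarrow> (t0 / s) ^ m < 1 / B" by (auto simp: eventually_sequentially)
  have "quot_norm N ((U ^^ n) (const_one +o M)) \<le> (INF r\<in>{0<..<1}. exp (L_fun E N e r) / r ^ n)"
    if n: "Suc m0 \<le> n" for n
  proof -
    obtain m where m: "n = Suc m" "m0 \<le> m" using n by (cases n) auto
    have "q (orbit_vec m) \<le> exp (L_fun E N e r) / r ^ n" if r: "0 < r" "r < 1" for r
    \<comment> \<open>for \<open>r \<le> t0\<close> Cauchy's estimate on one circle of radius \<open>s > t0\<close> is better than \<open>r ^ (- n)\<close> when
      \<open>n\<close> is large\<close>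
    proof (cases "t0 < r")
      case True
      have "q (orbit_vec m) \<le> exp (C_const e * (weight_integral E N e r)\<^sup>2 / (1 - r)) / r ^ m" by (rule qA[OF True r(2)])
      also have "\<dots> \<le> exp (L_fun E N e r) / r ^ n"
      proof (rule frac_le)
        show "exp (C_const e * (weight_integral E N e r)\<^sup>2 / (1 - r)) \<le> exp (L_fun E N e r)"
          using r by (simp add: L_fun_def divide_right_mono mult_right_mono)
        show "r ^ n \<le> r ^ m" using r m by (intro power_decreasing) auto
      qed (use r in auto)
      finally show ?thesis .
    next
      case False
      have "q (orbit_vec m) \<le> B / s ^ m" unfolding B_def by (rule qA[OF s(1,2)])
      also have "\<dots> = B * (t0 / s) ^ m / t0 ^ m" using t0 by (simp add: power_divide)
      also have "\<dots> \<le> 1 / t0 ^ m"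
        using m0[OF m(2)] B t0 by (intro divide_right_mono) (auto simp: field_simps)
      also have "\<dots> \<le> exp (L_fun E N e r) / r ^ n"
      proof (rule frac_le)
        have "0 \<le> L_fun E N e r" using r C0 by (simp add: L_fun_def)
        then show "1 \<le> exp (L_fun E N e r)" by simp
        have "r ^ n \<le> r ^ m" using r m by (intro power_decreasing) auto
        also have "\<dots> \<le> t0 ^ m" using r False by (intro power_mono) auto
        finally show "r ^ n \<le> t0 ^ m" .
      qed (use r in auto)
      finally show ?thesis .
    qed
    then show ?thesis unfolding m(1) norm_U_pow_Suc by (intro cINF_greatest) auto
  qed
  then show ?thesis by (auto simp: eventually_sequentially)
qed

end

theorem proposition7p4:
  fixes E M :: "(complex \<Rightarrow> complex) set"
    and N :: "(complex \<Rightarrow> complex) \<Rightarrow> real"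
    and U :: "(complex \<Rightarrow> complex) set \<Rightarrow> (complex \<Rightarrow> complex) set"
  assumes "class_E E N"
    and "cfun.subspace M" and "M \<subseteq> E" and "closedin (norm_topology E N) M"
    and "M \<noteq> {0}" and "division_property M"
    and "quot_linear E M U"
    and "\<And>f. f \<in> E \<Longrightarrow> U (shift f +o M) = f +o M"
  shows
    "(\<forall>l\<in>disc. \<exists>x. quot_sums E N M (U_term M U l) x) \<and>
     ((\<integral>\<^sup>+t\<in>{0..<1}. ennreal (weight E N t) \<partial>lborel) < \<infinity> \<longrightarrow>
       (\<lambda>l. log_plus (quot_norm N (quot_suminf E N M (U_term M U l))))
          \<in> O[to_circle](\<lambda>l. 1 / (1 - cmod l)) \<and>
       (\<lambda>n. log_plus (quot_norm N ((U ^^ n) (const_one +o M)))) \<in> O(\<lambda>n. sqrt (real n))) \<and>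
     ((\<integral>\<^sup>+t\<in>{0..<1}. ennreal (weight E N t) \<partial>lborel) = \<infinity> \<longrightarrow>
       (\<forall>e>0.
          Limsup to_circle
            (\<lambda>l. ereal (1 - cmod l) *
                 elog (quot_norm N (quot_suminf E N M (U_term M U l))) *
                 ereal (1 / (weight_integral E N e (cmod l))\<^sup>2))
            \<le> ereal (C_const e) \<and>
          (\<forall>\<^sub>F n in sequentially.
             quot_norm N ((U ^^ n) (const_one +o M))
               \<le> (INF r\<in>{0<..<1}. exp (L_fun E N e r) / r ^ n))))"
proof -
  interpret division_quotient E N M U
    using assms by unfold_locales auto
  show ?thesis
    using quot_sums_resolvent_vec bigo_convergent limsup_divergent power_bound_divergent by blast
qed

end
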